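(* Let $a<b$ be real numbers, $\sigma>0$ and $x_0=\frac{a+b}{2}$. For $\mu\in\mathbb{R}$ let $L^{\sigma,\mu}=\frac{\sigma^2}{2}\frac{d^2}{dx^2}+\mu\frac{d}{dx}$, let $(X_t)_{t\ge 0}$ be the $L^{\sigma,\mu}$-diffusion in $(a,b)$ with jump boundary and deterministic jump distribution $\delta_{x_0}$, and let $\gamma_1(L^{\sigma,\mu},\delta_{x_0})$ denote its spectral gap. Then there exists a constant $\mu(\sigma,x_0)$ (not depending on $\mu$) such that for all $\mu>\mu(\sigma,x_0)$ $$\gamma_1(L^{\sigma,\mu},\delta_{x_0})=\frac{8\sigma^2\pi^2}{(b-a)^2}.$$
   Context: Diffusion with jump boundary: let $\nu$ be a probability measure on $(a,b)$. The $L^{\sigma,\mu}$-diffusion in $(a,b)$ with jump boundary and jump distribution $\nu$, started at $x\in(a,b)$, is the process $(X_t)_{t\ge0}$ which moves as $x+\sigma B_t+\mu t$ ($B$ a standard one-dimensional Brownian motion) until it first hits $\{a,b\}$; at that time it is instantly relocated to a point chosen according to $\nu$ (independently of the past), then again moves as a Brownian motion with diffusion coefficient $\sigma$ and drift $\mu$ until it next hits $\{a,b\}$, is relocated according to $\nu$, and so on forever. For $\nu=\delta_{x_0}$ it is always relocated to $x_0$. $\mathbb{P}_x$ denotes the law of the process started at $x$. The process has a unique invariant probability distribution $\pi$, and its spectral gap is $$\gamma_1(L^{\sigma,\mu},\nu)=-\lim_{t\to\infty}\frac1t\log\sup_{x\in(a,b)}\bigl\|\mathbb{P}_x(X_t\in\cdot)-\pi\bigr\|_{TV}>0,$$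 where $\|\cdot\|_{TV}$ is the total variation distance $\|P-Q\|_{TV}=\sup_A|P(A)-Q(A)|$. It is known that $\gamma_1(L^{\sigma,\mu},\nu)=\min\{\Re\tilde\lambda : \tilde\lambda\neq0,\ -\tilde\lambda \text{ is an eigenvalue of }(\mathcal{L},\mathcal{D}(\mathcal{L}))\}$, where $\mathcal{D}(\mathcal{L})=\{f\in C^2([a,b]): f(a)=f(b)=\int_{(a,b)} f\,d\nu\}$ ($f$ complex valued) and $\mathcal{L}f=\frac{\sigma^2}{2}f''+\mu f'$. *)

theory Defs
  imports "HOL-Probability.Probability"
begin

definition standard_brownian_motion :: "'w measure \<Rightarrow> (real \<Rightarrow> 'w \<Rightarrow> real) \<Rightarrow> bool" where
  "standard_brownian_motion M B \<longleftrightarrow>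
     prob_space M \<and>
     (\<forall>t\<ge>0. B t \<in> borel_measurable M) \<and>
     (\<forall>\<omega>\<in>space M. B 0 \<omega> = 0 \<and> continuous_on {0..} (\<lambda>t. B t \<omega>)) \<and>
     (\<forall>s\<ge>0. \<forall>t>s. distributed M lborel (\<lambda>\<omega>. B t \<omega> - B s \<omega>) (normal_density 0 (sqrt (t - s)))) \<and>
     (\<forall>u :: nat \<Rightarrow> real. 0 \<le> u 0 \<and> incseq u \<longrightarrow>
        prob_space.indep_vars M (\<lambda>_. borel) (\<lambda>k \<omega>. B (u (Suc k)) \<omega> - B (u k) \<omega>) UNIV)"

text \<open>First hitting time of the boundary by a path; it is infinite if the boundary is never hit.\<close>

definition hitting_time :: "real \<Rightarrow> real \<Rightarrow> (real \<Rightarrow> real) \<Rightarrow> ereal" where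
  "hitting_time a b w = (INF t\<in>{t. 0 \<le> t \<and> w t \<in> {a, b}}. ereal t)"

text \<open>Cycle \<open>0\<close> starts at \<open>x\<close>; cycle \<open>Suc n\<close> starts at the point \<open>Y n\<close> chosen at the
  \<open>n\<close>-th relocation, counting from \<open>0\<close>. Each cycle is driven by its own path \<open>B n\<close>, whose time
  restarts at \<open>0\<close>, and is only used up to its hitting time of the boundary.\<close>

definition cycle ::
    "real \<Rightarrow> real \<Rightarrow> real \<Rightarrow> (nat \<Rightarrow> real) \<Rightarrow> (nat \<Rightarrow> real \<Rightarrow> real) \<Rightarrow> nat \<Rightarrow> real \<Rightarrow> real" where
  "cycle \<sigma> \<mu> x Y B n t = (case n of 0 \<Rightarrow> x | Suc k \<Rightarrow> Y k) + \<sigma> * B n t + \<mu> * t"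

definition relocation_time ::
    "real \<Rightarrow> real \<Rightarrow> real \<Rightarrow> real \<Rightarrow> real \<Rightarrow> (nat \<Rightarrow> real) \<Rightarrow> (nat \<Rightarrow> real \<Rightarrow> real) \<Rightarrow> nat \<Rightarrow> ereal" where
  "relocation_time a b \<sigma> \<mu> x Y B n = (\<Sum>k<n. hitting_time a b (cycle \<sigma> \<mu> x Y B k))"

text \<open>\<open>X\<close> is, on the probability space \<open>M\<close>, a diffusion with jump boundary started at \<open>x\<close>, for a
  jump distribution \<open>\<nu>\<close> on the Borel sets of the real line with \<open>\<nu> {a<..<b} = 1\<close>.
  All relocation points and all driving paths are jointly independent, which is expressed
  through the sigma-algebras they generate because they take values in different types.\<close>

definition jump_diffusion ::
    "real \<Rightarrow> real \<Rightarrow> real \<Rightarrow> real \<Rightarrow> real measure \<Rightarrow> 'w measure \<Rightarrow> real \<Rightarrow> (real \<Rightarrow> 'w \<Rightarrow> real) \<Rightarrow> bool"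
  where
  "jump_diffusion a b \<sigma> \<mu> \<nu> M x X \<longleftrightarrow>
     prob_space M \<and>
     (\<forall>t\<ge>0. X t \<in> borel_measurable M) \<and>
     (\<exists>(Y :: nat \<Rightarrow> 'w \<Rightarrow> real) (B :: nat \<Rightarrow> real \<Rightarrow> 'w \<Rightarrow> real).
        (\<forall>n. Y n \<in> borel_measurable M \<and> distr M borel (Y n) = \<nu>) \<and>
        (\<forall>n. standard_brownian_motion M (B n)) \<and>
        prob_space.indep_sets M
          (\<lambda>i. case i of
             Inl n \<Rightarrow> sets (vimage_algebra (space M) (Y n) borel)
           | Inr n \<Rightarrow> sets (vimage_algebra (space M) (\<lambda>\<omega>. \<lambda>t\<in>{0..}. B n t \<omega>)
                              (PiM {0..} (\<lambda>_. borel))))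
          (UNIV :: (nat + nat) set) \<and>
        (AE \<omega> in M. \<forall>t\<ge>0. \<forall>n.
           (let Y' = (\<lambda>k. Y k \<omega>); B' = (\<lambda>k s. B k s \<omega>); T = relocation_time a b \<sigma> \<mu> x Y' B'
            in T n \<le> ereal t \<and> ereal t < T (Suc n) \<longrightarrow>
               X t \<omega> = cycle \<sigma> \<mu> x Y' B' n (t - real_of_ereal (T n)))))"

definition total_variation :: "real measure \<Rightarrow> real measure \<Rightarrow> real" where
  "total_variation P Q = (SUP A\<in>sets borel. \<bar>measure P A - measure Q A\<bar>)"

text \<open>Below, \<open>P x t\<close> is the law at time \<open>t\<close> of the process started at \<open>x\<close>; only
  \<open>x \<in> {a<..<b}\<close> matters.\<close>

definition invariant_distribution ::
    "real \<Rightarrow> real \<Rightarrow> (real \<Rightarrow> real \<Rightarrow> real measure) \<Rightarrow> real measure \<Rightarrow> bool" where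
  "invariant_distribution a b P \<pi> \<longleftrightarrow>
     prob_space \<pi> \<and> sets \<pi> = sets borel \<and> emeasure \<pi> {a<..<b} = 1 \<and>
     (\<forall>t\<ge>0. \<forall>A\<in>sets borel. emeasure \<pi> A = (\<integral>\<^sup>+ x\<in>{a<..<b}. emeasure (P x t) A \<partial>\<pi>))"

text \<open>The existence and uniqueness of the invariant distribution and the existence of the limit
  are part of the relation, so that no default value of \<open>THE\<close> or \<open>Lim\<close> can enter.\<close>

definition has_spectral_gap ::
    "real \<Rightarrow> real \<Rightarrow> (real \<Rightarrow> real \<Rightarrow> real measure) \<Rightarrow> real \<Rightarrow> bool" where
  "has_spectral_gap a b P \<gamma> \<longleftrightarrow>
     (\<exists>\<pi>. invariant_distribution a b P \<pi> \<and>
          (\<forall>\<pi>'. invariant_distribution a b P \<pi>' \<longrightarrow> \<pi>' = \<pi>) \<and>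
          ((\<lambda>t. - (1 / t * ln (SUP x\<in>{a<..<b}. total_variation (P x t) \<pi>))) \<longlongrightarrow> \<gamma>) at_top)"

end

theory Submission
  imports Defs
begin

text \<open>
  Put \<open>h = (b - a) / 2\<close> and measure positions from \<open>x\<^sub>0\<close>, so that a jump takes \<open>h\<close> or \<open>-h\<close> to \<open>0\<close>.
  Modulo \<open>h\<close> a jump is invisible: the diffusion seen modulo \<open>h\<close> is a Brownian motion with drift on
  a circle of length \<open>h\<close>. Accordingly \<open>e\<^sub>n(y) = exp (2 \<pi> i n y / h)\<close>, which takes the same value at
  \<open>-h\<close>, \<open>0\<close> and \<open>h\<close>, satisfies \<open>E\<^sub>x e\<^sub>n(X\<^sub>t) = exp (-\<lambda>\<^sub>n t) e\<^sub>n(x)\<close> with \<open>Re \<lambda>\<^sub>n = \<gamma> n\<^sup>2\<close> and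
  \<open>\<gamma> = 8 \<sigma>\<^sup>2 \<pi>\<^sup>2 / (b - a)\<^sup>2\<close>. What the circle forgets is the side of \<open>x\<^sub>0\<close> on which the diffusion is.
  This is seen by \<open>f\<^sub>k(y) = exp (-\<nu> y) sin (k \<pi> y / h)\<close> with \<open>\<nu> = \<mu> / \<sigma>\<^sup>2\<close>, which vanishes at \<open>-h\<close>,
  \<open>0\<close> and \<open>h\<close> and decays at the real rate \<open>\<gamma> k\<^sup>2 / 4 + \<mu>\<^sup>2 / (2 \<sigma>\<^sup>2)\<close>. As soon as \<open>\<mu> > 2 \<pi> \<sigma>\<^sup>2 / h\<close> all
  these rates exceed \<open>\<gamma>\<close>, the rate of \<open>e\<^sub>1\<close>, and the spectral gap is \<open>\<gamma>\<close>.

  The probabilistic half of the proof (\<open>eigenfunction_decay\<close>, \<open>jump_diffusion_moments\<close>) derives the two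
  families of identities from the construction of the process. Exponentials of a Brownian motion
  with drift give martingales, which are stopped at the exit time of a cycle
  (\<open>exponential_stopping\<close>). Since the eigenfunctions take equal values at \<open>a\<close>, \<open>b\<close> and \<open>x\<^sub>0\<close>, a jump
  does not change them, and by independence of the cycles the stopped expectation is the same after
  every number of cycles; the cycles are long enough for this number to become irrelevant.

  The analytic half (\<open>moment_distance\<close>) shows that the moments against \<open>e\<^sub>n\<close> and \<open>f\<^sub>k\<close> control a law
  on \<open>(-h, h)\<close> in total variation. Every bounded function on \<open>(-h, h)\<close> is a sum of an \<open>h\<close>-periodic
  function and \<open>exp (-\<nu> y)\<close> times an odd function: at \<open>u\<close> and \<open>u - h\<close> this is a system of two linear
  equations with determinant of absolute value \<open>exp (\<nu> h) - exp (-\<nu> h)\<close>. The first summand pairs with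
  the \<open>e\<^sub>n\<close> and the second one with the \<open>f\<^sub>k\<close>; both pairings are controlled by absolutely summable
  Fourier coefficients (\<open>charge_bound_by_moments\<close>).

  Both halves meet in \<open>mode_kernel.spectral_gap\<close>. An invariant law must have zero moments apart from
  the one of \<open>e\<^sub>0\<close>; exactly one law has these moments, and its density is explicit. The distance from
  it is at most a constant times \<open>exp (-\<gamma> t)\<close> for \<open>t \<ge> 1\<close>, and the moment of \<open>e\<^sub>1\<close> shows that it is
  at least \<open>exp (-\<gamma> t) / 4\<close> for the start at \<open>x\<^sub>0\<close>.
\<close>

section \<open>Charges on the unit circle and their Fourier coefficients\<close>

definition circle_bounded :: "(complex \<Rightarrow> complex) \<Rightarrow> bool" where
  "circle_bounded f \<longleftrightarrow> f \<in> borel_measurable borel \<and> (\<exists>C. \<forall>z\<in>sphere 0 1. norm (f z) \<le> C)"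

text \<open>A complex Borel measure on the unit circle, encoded as the functional of integration against it.
  Linearity and continuity under bounded pointwise convergence are all that determines such a
  measure, and differences of weighted images of different laws are covered without adding measures.\<close>
definition circle_charge :: "((complex \<Rightarrow> complex) \<Rightarrow> complex) \<Rightarrow> bool" where
  "circle_charge K \<longleftrightarrow>
     (\<forall>f g. circle_bounded f \<longrightarrow> circle_bounded g \<longrightarrow> K (\<lambda>z. f z + g z) = K f + K g) \<and>
     (\<forall>c f. circle_bounded f \<longrightarrow> K (\<lambda>z. c * f z) = c * K f) \<and>
     (\<forall>F f C. (\<forall>i. F i \<in> borel_measurable borel) \<longrightarrow> f \<in> borel_measurable borel \<longrightarrow>
        (\<forall>i. \<forall>z\<in>sphere 0 1. norm (F i z) \<le> C) \<longrightarrow> (\<forall>z\<in>sphere 0 1. (\<lambda>i. F i z) \<longlonglongrightarrow> f z) \<longrightarrow>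
        (\<lambda>i. K (F i)) \<longlonglongrightarrow> K f)"

lemma circle_chargeD:
  assumes "circle_charge K"
  shows "circle_bounded f \<Longrightarrow> circle_bounded g \<Longrightarrow> K (\<lambda>z. f z + g z) = K f + K g"
    and "circle_bounded f \<Longrightarrow> K (\<lambda>z. c * f z) = c * K f"
    and "(\<And>i. F i \<in> borel_measurable borel) \<Longrightarrow> f \<in> borel_measurable borel \<Longrightarrow>
        (\<And>i z. z\<in>sphere 0 1 \<Longrightarrow> norm (F i z) \<le> C) \<Longrightarrow> (\<And>z. z\<in>sphere 0 1 \<Longrightarrow> (\<lambda>i. F i z) \<longlonglongrightarrow> f z) \<Longrightarrow>
        (\<lambda>i. K (F i)) \<longlonglongrightarrow> K f"
  using assms unfolding circle_charge_def by blast+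

lemma circle_bounded_mult:
  assumes "circle_bounded f" "circle_bounded g"
  shows "circle_bounded (\<lambda>z. f z * g z)"
proof -
  obtain C D where "\<And>z. z\<in>sphere 0 1 \<Longrightarrow> norm (f z) \<le> C" "\<And>z. z\<in>sphere 0 1 \<Longrightarrow> norm (g z) \<le> D"
    using assms unfolding circle_bounded_def by blast
  then have "norm (f z * g z) \<le> C * D" if "z \<in> sphere 0 1" for z
    unfolding norm_mult using that by (intro mult_mono) (auto intro: order_trans[OF norm_ge_zero])
  moreover have "(\<lambda>z. f z * g z) \<in> borel_measurable borel"
    using assms by (auto simp: circle_bounded_def)
  ultimately show ?thesis unfolding circle_bounded_def by blast
qed

lemma circle_bounded_add:
  assumes "circle_bounded f" "circle_bounded g"
  shows "circle_bounded (\<lambda>z. f z + g z)"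
proof -
  obtain C D where "\<And>z. z\<in>sphere 0 1 \<Longrightarrow> norm (f z) \<le> C" "\<And>z. z\<in>sphere 0 1 \<Longrightarrow> norm (g z) \<le> D"
    using assms unfolding circle_bounded_def by blast
  then have "norm (f z + g z) \<le> C + D" if "z \<in> sphere 0 1" for z
    using that by (intro norm_triangle_mono) auto
  moreover have "(\<lambda>z. f z + g z) \<in> borel_measurable borel"
    using assms by (auto simp: circle_bounded_def)
  ultimately show ?thesis unfolding circle_bounded_def by blast
qed

lemma circle_bounded_continuous:
  assumes "continuous_on UNIV f" shows "circle_bounded f"
proof -
  have "compact (f ` sphere 0 1)"
    by (intro compact_continuous_image continuous_on_subset[OF assms]) auto
  then have "bounded (f ` sphere 0 1)" by (rule compact_imp_bounded)
  then show ?thesis unfolding circle_bounded_def bounded_iff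
    using borel_measurable_continuous_onI[OF assms] by auto
qed

lemma circle_bounded_indicator: "A \<in> sets borel \<Longrightarrow> circle_bounded (\<lambda>z. of_real (indicator A z))"
  unfolding circle_bounded_def by (auto intro!: exI[of _ 1] simp: indicator_def)

text \<open>Bounded convergence along a constant sequence sees only the values on the circle.\<close>
lemma circle_charge_cong:
  assumes "circle_charge K" "circle_bounded f" "g \<in> borel_measurable borel"
    "\<And>z. z \<in> sphere 0 1 \<Longrightarrow> f z = g z"
  shows "K f = K g"
proof -
  obtain C where C: "\<forall>z\<in>sphere 0 1. norm (f z) \<le> C" and f: "f \<in> borel_measurable borel"
    using assms(2) unfolding circle_bounded_def by blast
  have "(\<lambda>i::nat. K f) \<longlonglongrightarrow> K g"
    using C f assms by (intro circle_chargeD(3)[OF assms(1), of "\<lambda>_. f" g C]) auto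
  then show ?thesis by (rule LIMSEQ_unique[OF tendsto_const])
qed

lemma circle_bounded_monomial: "circle_bounded (\<lambda>z. z ^ n * cnj z ^ m)"
  by (intro circle_bounded_continuous continuous_intros)

lemma circle_bounded_powi: "circle_bounded (\<lambda>z. z powi n)"
proof -
  have "(\<lambda>z::complex. z powi n) \<in> borel_measurable borel"
    by (cases "n \<ge> 0") (simp_all add: power_int_def)
  then show ?thesis unfolding circle_bounded_def
    by (intro conjI exI[of _ 1]) (auto simp: norm_power_int)
qed

lemma continuous_on_real_polynomial: "real_polynomial_function (p :: complex \<Rightarrow> real) \<Longrightarrow> continuous_on S p"
  using continuous_on_polymonial_function real_polynomial_function_eq by blast

lemma circle_bounded_of_real_polynomial:
  "real_polynomial_function p \<Longrightarrow> circle_bounded (\<lambda>z. of_real (p z))"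
  by (intro circle_bounded_continuous continuous_intros continuous_on_real_polynomial)

text \<open>The real linear functions are combinations of \<open>z\<close> and \<open>cnj z\<close>, so multiplication by a real
  polynomial stays inside the span of the monomials. The extra factor \<open>f\<close> makes the induction go
  through products of polynomials.\<close>
lemma charge_real_polynomial_eq_0:
  assumes K: "circle_charge K" and "real_polynomial_function p"
  shows "circle_bounded f \<Longrightarrow> (\<And>n m. K (\<lambda>z. f z * (z ^ n * cnj z ^ m)) = 0) \<Longrightarrow>
     K (\<lambda>z. of_real (p z) * f z * (z ^ n * cnj z ^ m)) = 0"
  using assms(2)
proof (induction arbitrary: f n m rule: real_polynomial_function.induct)
  case (linear p)
  have p: "p z = Re z * p 1 + Im z * p \<i>" for z
  proof -
    have "z = Re z *\<^sub>R 1 + Im z *\<^sub>R \<i>" by (simp add: complex_eq_iff)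
    then have "p z = p (Re z *\<^sub>R 1 + Im z *\<^sub>R \<i>)" by (rule arg_cong)
    also have "\<dots> = Re z * p 1 + Im z * p \<i>"
      using linear(1) by (simp add: bounded_linear.linear linear_add linear_scale)
    finally show ?thesis .
  qed
  define \<alpha> \<beta> where "\<alpha> = (of_real (p 1) - \<i> * of_real (p \<i>)) / 2" and "\<beta> = (of_real (p 1) + \<i> * of_real (p \<i>)) / 2"
  have pz: "of_real (p z) = \<alpha> * z + \<beta> * cnj z" for z
    unfolding p[of z] \<alpha>_def \<beta>_def by (simp add: complex_eq_iff field_simps)
  have b: "circle_bounded (\<lambda>z. f z * (z ^ n * cnj z ^ m))" for n m
    by (intro circle_bounded_mult linear circle_bounded_monomial)
  have c: "circle_bounded (\<lambda>z. c * (f z * (z ^ n * cnj z ^ m)))" for n m c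
    by (intro circle_bounded_mult b circle_bounded_continuous continuous_intros)
  have "(\<lambda>z. of_real (p z) * f z * (z ^ n * cnj z ^ m)) =
     (\<lambda>z. \<alpha> * (f z * (z ^ Suc n * cnj z ^ m)) + \<beta> * (f z * (z ^ n * cnj z ^ Suc m)))"
    unfolding pz by (auto simp: algebra_simps)
  then show ?case
    using linear by (simp only: circle_chargeD(1)[OF K c c] circle_chargeD(2)[OF K b]) simp
next
  case (const c)
  have b: "circle_bounded (\<lambda>z. f z * (z ^ n * cnj z ^ m))" for n m
    by (intro circle_bounded_mult const circle_bounded_monomial)
  show ?case using const circle_chargeD(2)[OF K b, of "of_real c" n m] by (simp add: mult.assoc)
next
  case (add p q)
  have b: "real_polynomial_function p \<Longrightarrow> circle_bounded (\<lambda>z. of_real (p z) * f z * (z ^ n * cnj z ^ m))" for p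
    by (intro circle_bounded_mult add circle_bounded_monomial circle_bounded_of_real_polynomial)
  have "K (\<lambda>z. of_real (p z + q z) * f z * (z ^ n * cnj z ^ m)) =
    K (\<lambda>z. of_real (p z) * f z * (z ^ n * cnj z ^ m) + of_real (q z) * f z * (z ^ n * cnj z ^ m))"
    by (simp add: algebra_simps)
  also have "\<dots> = 0"
    using add by (simp only: circle_chargeD(1)[OF K b b]) simp
  finally show ?case .
next
  case (mult p q)
  have "K (\<lambda>z. of_real (p z) * (of_real (q z) * f z) * (z ^ n * cnj z ^ m)) = 0"
    using mult by (intro mult.IH(1) circle_bounded_mult circle_bounded_of_real_polynomial) simp_all
  then show ?case by (simp add: mult.assoc)
qed

text \<open>A charge with vanishing Fourier coefficients vanishes on polynomials, by the Stone-Weierstrass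
  theorem on continuous functions, as a bounded limit on indicators of open sets, and hence on the
  sigma-algebra that the open sets generate, because the sets on which it vanishes form a Dynkin
  system.\<close>
lemma charge_indicator_eq_0:
  assumes K: "circle_charge K" and 0: "\<And>n. K (\<lambda>z. z powi n) = 0" and A: "A \<in> sets borel"
  shows "K (\<lambda>z. of_real (indicator A z)) = 0"
proof -
  have mono: "K (\<lambda>z. z ^ n * cnj z ^ m) = 0" for n m
  proof -
    have "K (\<lambda>z. z ^ n * cnj z ^ m) = K (\<lambda>z. z powi (int n - int m))"
    proof (rule circle_charge_cong[OF K circle_bounded_monomial])
      show "(\<lambda>z::complex. z powi (int n - int m)) \<in> borel_measurable borel"
        using circle_bounded_powi unfolding circle_bounded_def by blast
      fix z :: complex assume "z \<in> sphere 0 1"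
      then have z: "norm z = 1" by simp
      then have z0: "z \<noteq> 0" by auto
      have c: "cnj z = inverse z" using z by (intro inverse_unique[symmetric]) (simp add: complex_norm_square[symmetric])
      show "z ^ n * cnj z ^ m = z powi (int n - int m)"
        unfolding c using z0 by (simp add: power_int_diff power_inverse divide_inverse)
    qed
    then show ?thesis using 0 by simp
  qed
  have poly: "K (\<lambda>z. of_real (p z)) = 0" if "real_polynomial_function p" for p
  proof -
    have "K (\<lambda>z. of_real (p z) * 1 * (z ^ 0 * cnj z ^ 0)) = 0"
      by (rule charge_real_polynomial_eq_0[OF K that]) (auto simp: mono intro!: circle_bounded_continuous)
    then show ?thesis by simp
  qed
  have cont: "K (\<lambda>z. of_real (f z)) = 0" if f: "continuous_on UNIV f" for f :: "complex \<Rightarrow> real"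
  proof -
    have "\<exists>g. real_polynomial_function g \<and> (\<forall>z\<in>sphere 0 1. \<bar>f z - g z\<bar> < 1 / Suc i)" for i
      using Stone_Weierstrass_real_polynomial_function[of "sphere 0 1" f "1 / Suc i"] f
      by (metis compact_sphere continuous_on_subset of_nat_0_less_iff subset_UNIV zero_less_Suc zero_less_divide_1_iff)
    then obtain g where g: "\<And>i. real_polynomial_function (g i)"
      "\<And>i z. z \<in> sphere 0 1 \<Longrightarrow> \<bar>f z - g i z\<bar> < 1 / Suc i" by metis
    have "bounded (f ` sphere 0 1)"
      by (intro compact_imp_bounded compact_continuous_image continuous_on_subset[OF f]) auto
    then obtain C where "\<forall>y \<in> f ` sphere 0 1. norm y \<le> C"
      unfolding bounded_iff by blast
    then have C: "\<bar>f z\<bar> \<le> C" if "z \<in> sphere 0 1" for z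
      using that by simp
    have "(\<lambda>i. K (\<lambda>z. of_real (g i z))) \<longlonglongrightarrow> K (\<lambda>z. of_real (f z))"
    proof (rule circle_chargeD(3)[OF K, where C = "C + 1"])
      show "(\<lambda>z. complex_of_real (g i z)) \<in> borel_measurable borel" for i
        using circle_bounded_of_real_polynomial[OF g(1)] unfolding circle_bounded_def by blast
      show "(\<lambda>z. complex_of_real (f z)) \<in> borel_measurable borel"
        using f by (intro borel_measurable_continuous_onI continuous_intros)
      fix z :: complex assume z: "z \<in> sphere 0 1"
      show "cmod (of_real (g i z)) \<le> C + 1" for i
      proof -
        have "1 / real (Suc i) \<le> 1" by simp
        then show ?thesis using g(2)[OF z, of i] C[OF z] unfolding norm_of_real by linarith
      qed
      have "(\<lambda>i. f z - g i z) \<longlonglongrightarrow> 0"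
      proof (rule Lim_null_comparison)
        show "\<forall>\<^sub>F i in sequentially. norm (f z - g i z) \<le> 1 / real (Suc i)"
          using g(2)[OF z] by (intro always_eventually allI) (simp add: less_imp_le)
        show "(\<lambda>i. 1 / real (Suc i)) \<longlonglongrightarrow> 0" by (rule LIMSEQ_Suc[OF lim_1_over_n])
      qed
      from tendsto_diff[OF tendsto_const[of "f z"] this]
      show "(\<lambda>i. complex_of_real (g i z)) \<longlonglongrightarrow> of_real (f z)"
        by (intro tendsto_of_real) simp
    qed
    then show ?thesis using poly[OF g(1)] by (simp add: LIMSEQ_const_iff)
  qed
  have op: "K (\<lambda>z. of_real (indicator U z)) = 0" if U: "open U" for U :: "complex set"
  proof (cases "U = UNIV")
    case True
    then show ?thesis using cont[of "\<lambda>_. 1"] by simp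
  next
    case False
    \<comment> \<open>continuous functions that increase to the indicator of \<open>U\<close>\<close>
    define f where "f i z = min 1 (real i * infdist z (- U))" for i z
    have "(\<lambda>i. K (\<lambda>z. of_real (f i z))) \<longlonglongrightarrow> K (\<lambda>z. of_real (indicator U z))"
    proof (rule circle_chargeD(3)[OF K, where C = 1])
      show "(\<lambda>z. complex_of_real (f i z)) \<in> borel_measurable borel" for i
        unfolding f_def by (intro borel_measurable_continuous_onI continuous_intros)
      show "(\<lambda>z. complex_of_real (indicator U z)) \<in> borel_measurable borel" using U by simp
      fix z :: complex
      show "cmod (of_real (f i z)) \<le> 1" for i
        unfolding f_def norm_of_real by (simp add: infdist_nonneg min_def)
      show "(\<lambda>i. complex_of_real (f i z)) \<longlonglongrightarrow> of_real (indicator U z)"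
      proof (cases "z \<in> U")
        case True
        then have pos: "infdist z (- U) > 0"
          using U False by (subst infdist_pos_not_in_closed) auto
        obtain N where N: "real N * infdist z (- U) > 1" using reals_Archimedean3[OF pos] by blast
        have "f i z = 1" if "i \<ge> N" for i
        proof -
          have "real N * infdist z (- U) \<le> real i * infdist z (- U)"
            using that pos by (intro mult_right_mono) auto
          then show ?thesis using N unfolding f_def by simp
        qed
        then have "(\<lambda>i. f i z) \<longlonglongrightarrow> 1"
          by (intro tendsto_eventually eventually_sequentiallyI)
        then show ?thesis using True by (intro tendsto_of_real) simp
      next
        case z: False
        then have "infdist z (- U) = 0" by simp
        then show ?thesis using z by (simp add: f_def)
      qed
    qed
    moreover have "K (\<lambda>z. of_real (f i z)) = 0" for i
      by (rule cont) (auto simp: f_def intro!: continuous_intros)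
    ultimately show ?thesis by (simp add: LIMSEQ_const_iff)
  qed
  have "Int_stable {U :: complex set. open U}" "{U :: complex set. open U} \<subseteq> Pow UNIV"
    "A \<in> sigma_sets UNIV {U. open U}" using A by (auto simp: borel_def Int_stable_def)
  then show ?thesis
  proof (induction rule: sigma_sets_induct_disjoint)
    case (basic A) then show ?case using op by simp
  next
    case empty then show ?case using op[of "{}"] by simp
  next
    case (compl A)
    then have A: "A \<in> sets borel" by (simp add: borel_def)
    have b: "circle_bounded (\<lambda>z. (-1) * of_real (indicator A z))"
      by (rule circle_bounded_mult[OF circle_bounded_continuous[OF continuous_on_const] circle_bounded_indicator[OF A]])
    have bU: "circle_bounded (\<lambda>z. of_real (indicator UNIV z))"
      by (rule circle_bounded_indicator) simp
    have "K (\<lambda>z. of_real (indicator (UNIV - A) z)) =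
       K (\<lambda>z. of_real (indicator UNIV z) + (-1) * of_real (indicator A z))"
      by (rule arg_cong[of _ _ K]) (auto simp: indicator_def)
    also have "\<dots> = K (\<lambda>z. of_real (indicator UNIV z)) + (-1) * K (\<lambda>z. of_real (indicator A z))"
      by (simp only: circle_chargeD(1)[OF K bU b] circle_chargeD(2)[OF K circle_bounded_indicator[OF A]])
    finally show ?case using compl op[of UNIV] by (simp del: indicator_UNIV)
  next
    case (union A)
    then have A: "A i \<in> sets borel" for i by (auto simp: borel_def)
    have fin: "K (\<lambda>z. of_real (indicator (\<Union>i<n. A i) z)) = 0" for n
    proof (induction n)
      case 0 then show ?case using op[of "{}"] by simp
    next
      case (Suc n)
      have "K (\<lambda>z. of_real (indicator (\<Union>i<Suc n. A i) z)) =
         K (\<lambda>z. of_real (indicator (\<Union>i<n. A i) z) + of_real (indicator (A n) z))"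
      proof (rule arg_cong[of _ _ K], rule ext)
        fix z
        have "A i \<inter> A n = {}" if "i < n" for i
          using union(1) that by (simp add: disjoint_family_on_def)
        then have "(\<Union>i<n. A i) \<inter> A n = {}" by blast
        then show "complex_of_real (indicator (\<Union>i<Suc n. A i) z) =
          of_real (indicator (\<Union>i<n. A i) z) + of_real (indicator (A n) z)"
          by (auto simp: indicator_def lessThan_Suc)
      qed
      also have "\<dots> = 0"
        using A Suc union by (subst circle_chargeD(1)[OF K]) (auto intro!: circle_bounded_indicator)
      finally show ?case .
    qed
    have "(\<lambda>n. K (\<lambda>z. of_real (indicator (\<Union>i<n. A i) z))) \<longlonglongrightarrow> K (\<lambda>z. of_real (indicator (\<Union>i. A i) z))"
    proof (rule circle_chargeD(3)[OF K, where C = 1])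
      show "(\<lambda>i. complex_of_real (indicator (\<Union>i<i. A i) z)) \<longlonglongrightarrow> of_real (indicator (\<Union>i. A i) z)" for z
        by (intro tendsto_of_real LIMSEQ_indicator_UN)
    qed (use A in \<open>auto simp: indicator_def\<close>)
    then show ?case using fin by (simp add: LIMSEQ_const_iff)
  qed
qed

text \<open>Uniqueness theorem for Fourier coefficients; simple functions carry it from indicators to all
  bounded Borel functions.\<close>
lemma charge_eq_0_if_moments_eq_0:
  assumes K: "circle_charge K" and 0: "\<And>n. K (\<lambda>z. z powi n) = 0" and f: "circle_bounded f"
  shows "K f = 0"
proof -
  obtain C where C: "\<And>z. z \<in> sphere 0 1 \<Longrightarrow> norm (f z) \<le> C" and fm: "f \<in> borel_measurable borel"
    using f unfolding circle_bounded_def by blast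
  obtain F where F: "\<And>i. simple_function borel (F i)" "\<And>z. (\<lambda>i. F i z) \<longlonglongrightarrow> f z"
    "\<And>i z. norm (F i z) \<le> 2 * norm (f z)"
    using borel_measurable_implies_sequence_metric[OF fm, of 0] by (auto simp: dist_norm)
  have "K (F i) = 0" for i
  proof -
    have sf: "finite (range (F i))" "\<And>y. F i -` {y} \<in> sets borel"
      using simple_functionD[OF F(1)[of i]] by auto
    have *: "K (\<lambda>z. \<Sum>y\<in>Y. y * of_real (indicator (F i -` {y}) z)) = 0 \<and>
       circle_bounded (\<lambda>z. \<Sum>y\<in>Y. y * of_real (indicator (F i -` {y}) z))" if "finite Y" for Y
      using that
    proof (induction Y)
      case empty
      have "K (\<lambda>z. of_real (indicator {} z)) = 0" by (rule charge_indicator_eq_0[OF K 0]) simp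
      then show ?case by (simp add: circle_bounded_continuous)
    next
      case (insert y Y)
      have b: "circle_bounded (\<lambda>z. y * of_real (indicator (F i -` {y}) z))"
        by (intro circle_bounded_mult circle_bounded_indicator sf circle_bounded_continuous continuous_intros)
      have "K (\<lambda>z. y * of_real (indicator (F i -` {y}) z)) = y * 0"
        by (subst circle_chargeD(2)[OF K circle_bounded_indicator[OF sf(2)]]) (simp add: charge_indicator_eq_0[OF K 0] sf)
      then show ?case using insert b by (simp add: circle_chargeD(1)[OF K] circle_bounded_add)
    qed
    have "F i = (\<lambda>z. \<Sum>y\<in>range (F i). y * of_real (indicator (F i -` {y}) z))"
    proof
      fix z
      have "(\<Sum>y\<in>range (F i). y * of_real (indicator (F i -` {y}) z)) = (\<Sum>y\<in>range (F i). if y = F i z then y else 0)"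
        by (intro sum.cong) (auto simp: indicator_def)
      also have "\<dots> = F i z" using sf(1) by simp
      finally show "F i z = (\<Sum>y\<in>range (F i). y * of_real (indicator (F i -` {y}) z))" ..
    qed
    then show ?thesis using *[OF sf(1)] by simp
  qed
  moreover have "(\<lambda>i. K (F i)) \<longlonglongrightarrow> K f"
  proof (rule circle_chargeD(3)[OF K, where C = "2 * C"])
    show "F i \<in> borel_measurable borel" for i by (rule borel_measurable_simple_function[OF F(1)])
    show "norm (F i z) \<le> 2 * C" if "z \<in> sphere 0 1" for i z using F(3)[of i z] C[OF that] by linarith
  qed (use F fm in auto)
  ultimately show ?thesis by (simp add: LIMSEQ_const_iff)
qed


lemma circle_charge_weighted_integral:
  assumes w: "integrable M w" and psi: "\<psi> \<in> borel_measurable M"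
    and S: "\<And>x. x \<in> space M \<Longrightarrow> \<psi> x \<in> sphere 0 1"
  shows "circle_charge (\<lambda>f. \<integral>x. w x * f (\<psi> x) \<partial>M)"
proof -
  have wm [measurable]: "w \<in> borel_measurable M" using w by simp
  note psi [measurable]
  have int: "integrable M (\<lambda>x. w x * f (\<psi> x))" if f: "circle_bounded f" for f
  proof -
    obtain C where C: "\<And>z. z \<in> sphere 0 1 \<Longrightarrow> norm (f z) \<le> C" and [measurable]: "f \<in> borel_measurable borel"
      using f unfolding circle_bounded_def by blast
    show ?thesis
    proof (rule Bochner_Integration.integrable_bound)
      show "integrable M (\<lambda>x. norm (w x) * C)" using w by (intro integrable_mult_left integrable_norm)
      show "AE x in M. norm (w x * f (\<psi> x)) \<le> norm (norm (w x) * C)"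
      proof (rule AE_I2)
        fix x assume "x \<in> space M"
        then have "norm (f (\<psi> x)) \<le> C" using S C by blast
        then have "norm (f (\<psi> x)) \<le> \<bar>C\<bar>" by simp
        then show "norm (w x * f (\<psi> x)) \<le> norm (norm (w x) * C)"
          unfolding norm_mult by (simp add: mult_left_mono)
      qed
    qed measurable
  qed
  show ?thesis
    unfolding circle_charge_def
  proof (intro conjI allI impI)
    fix f g assume "circle_bounded f" "circle_bounded g"
    then show "(\<integral>x. w x * (f (\<psi> x) + g (\<psi> x)) \<partial>M) = (\<integral>x. w x * f (\<psi> x) \<partial>M) + (\<integral>x. w x * g (\<psi> x) \<partial>M)"
      using int by (simp add: distrib_left)
  next
    fix c f
    show "(\<integral>x. w x * (c * f (\<psi> x)) \<partial>M) = c * (\<integral>x. w x * f (\<psi> x) \<partial>M)"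
      by (subst integral_mult_right_zero[symmetric]) (simp add: mult_ac)
  next
    fix F :: "nat \<Rightarrow> complex \<Rightarrow> complex" and f and C :: real
    assume F: "\<forall>i::nat. F i \<in> borel_measurable borel" and f [measurable]: "f \<in> borel_measurable borel"
      and C: "\<forall>i. \<forall>z\<in>sphere 0 1. cmod (F i z) \<le> C" and lim: "\<forall>z\<in>sphere 0 1. (\<lambda>i. F i z) \<longlonglongrightarrow> f z"
    have Fm [measurable]: "F i \<in> borel_measurable borel" for i using F by blast
    show "(\<lambda>i. \<integral>x. w x * F i (\<psi> x) \<partial>M) \<longlonglongrightarrow> (\<integral>x. w x * f (\<psi> x) \<partial>M)"
    proof (rule integral_dominated_convergence)
      show "integrable M (\<lambda>x. norm (w x) * C)" using w by (intro integrable_mult_left integrable_norm)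
      show "AE x in M. (\<lambda>i. w x * F i (\<psi> x)) \<longlonglongrightarrow> w x * f (\<psi> x)"
        using S lim by (intro AE_I2 tendsto_intros) blast
      show "AE x in M. norm (w x * F i (\<psi> x)) \<le> norm (w x) * C" for i
        unfolding norm_mult using S C by (intro AE_I2 mult_left_mono) auto
    qed measurable
  qed
qed

lemma circle_charge_add:
  assumes K: "circle_charge K" and L: "circle_charge L"
  shows "circle_charge (\<lambda>f. K f + L f)"
  unfolding circle_charge_def
proof (intro conjI allI impI)
  fix f g assume "circle_bounded f" "circle_bounded g"
  then show "K (\<lambda>z. f z + g z) + L (\<lambda>z. f z + g z) = K f + L f + (K g + L g)"
    by (simp add: circle_chargeD(1)[OF K] circle_chargeD(1)[OF L])
next
  fix c f assume "circle_bounded f"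
  then show "K (\<lambda>z. c * f z) + L (\<lambda>z. c * f z) = c * (K f + L f)"
    by (simp add: circle_chargeD(2)[OF K] circle_chargeD(2)[OF L] algebra_simps)
next
  fix F :: "nat \<Rightarrow> complex \<Rightarrow> complex" and f and C :: real
  assume *: "\<forall>i::nat. F i \<in> borel_measurable borel" "f \<in> borel_measurable borel"
      "\<forall>i. \<forall>z\<in>sphere 0 1. cmod (F i z) \<le> C" "\<forall>z\<in>sphere 0 1. (\<lambda>i. F i z) \<longlonglongrightarrow> f z"
  show "(\<lambda>i. K (F i) + L (F i)) \<longlonglongrightarrow> K f + L f"
    by (intro tendsto_add circle_chargeD(3)[OF K, of F f C] circle_chargeD(3)[OF L, of F f C]) (use * in auto)
qed

lemma circle_charge_uminus:
  assumes K: "circle_charge K" shows "circle_charge (\<lambda>f. - K f)"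
  unfolding circle_charge_def
proof (intro conjI allI impI)
  fix f g assume "circle_bounded f" "circle_bounded g"
  then show "- K (\<lambda>z. f z + g z) = - K f + - K g" by (simp add: circle_chargeD(1)[OF K])
next
  fix c f assume "circle_bounded f"
  then show "- K (\<lambda>z. c * f z) = c * - K f" by (simp add: circle_chargeD(2)[OF K])
next
  fix F :: "nat \<Rightarrow> complex \<Rightarrow> complex" and f and C :: real
  assume *: "\<forall>i::nat. F i \<in> borel_measurable borel" "f \<in> borel_measurable borel"
      "\<forall>i. \<forall>z\<in>sphere 0 1. cmod (F i z) \<le> C" "\<forall>z\<in>sphere 0 1. (\<lambda>i. F i z) \<longlonglongrightarrow> f z"
  show "(\<lambda>i. - K (F i)) \<longlonglongrightarrow> - K f"
    by (intro tendsto_minus circle_chargeD(3)[OF K, of F f C]) (use * in auto)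
qed

lemma circle_charge_diff:
  assumes "circle_charge K" and "circle_charge L"
  shows "circle_charge (\<lambda>f. K f - L f)"
  using circle_charge_add[OF assms(1) circle_charge_uminus[OF assms(2)]] by simp

text \<open>Orthogonality of the characters of the circle.\<close>
lemma integral_cis_period:
  "(\<integral>s. indicator {0..1} s *\<^sub>R cis (2 * pi * of_int k * s) \<partial>lborel) = (if k = 0 then 1 else 0)"
proof (cases "k = 0")
  case False
  let ?c = "2 * pi * of_int k :: real"
  have c: "?c \<noteq> 0" using False by simp
  have "(\<integral>s. indicator {0..1} s *\<^sub>R cis (?c * s) \<partial>lborel) = cis (?c * 1) / (\<i> * ?c) - cis (?c * 0) / (\<i> * ?c)"
  proof (rule integral_FTC_Icc)
    fix x :: real
    have "((\<lambda>z. exp (\<i> * ?c * z) / (\<i> * ?c)) has_field_derivative exp (\<i> * ?c * of_real x)) (at (of_real x))"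
      using c by (auto intro!: derivative_eq_intros simp: field_simps)
    from has_vector_derivative_real_field[OF this]
    show "((\<lambda>s. cis (?c * s) / (\<i> * ?c)) has_vector_derivative cis (?c * x)) (at x within {0..1})"
      by (simp add: cis_conv_exp mult_ac)
  qed (auto intro!: continuous_intros)
  also have "cis (?c * 1) = 1" by (simp add: complex_eq_iff cos_integer_2pi sin_integer_2pi)
  finally show ?thesis using False by simp
qed simp

text \<open>The sum of \<open>r ^ \<bar>n\<bar>\<close> over all integers, taken along an enumeration so that the theory of series
  over the natural numbers applies.\<close>
definition geometric_int_sum :: "real \<Rightarrow> real" where
  "geometric_int_sum r = (\<Sum>j. r ^ nat \<bar>int_decode j\<bar>)"

lemma summable_geometric_int:
  assumes "0 < r" "r < 1"
  shows "summable (\<lambda>j. r ^ nat \<bar>int_decode j\<bar> :: real)"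
proof (rule summable_comparison_test')
  show "summable (\<lambda>j. sqrt r ^ j / sqrt r)"
    using assms by (intro summable_divide summable_geometric) auto
  fix j :: nat
  have "nat \<bar>int_decode j\<bar> \<ge> j div 2"
    by (auto simp: int_decode_def sum_decode_def)
  then have "r ^ nat \<bar>int_decode j\<bar> \<le> r ^ (j div 2)"
    using assms by (intro power_decreasing) auto
  also have "r ^ (j div 2) = sqrt r ^ (2 * (j div 2) + 1) / sqrt r"
    using assms by (simp add: power_mult)
  also have "\<dots> \<le> sqrt r ^ j / sqrt r"
    using assms by (intro divide_right_mono power_decreasing) auto
  finally show "norm (r ^ nat \<bar>int_decode j\<bar>) \<le> sqrt r ^ j / sqrt r" using assms by simp
qed

lemma cis_powi: "cis a powi n = cis (of_int n * a)"
  by (cases n rule: int_cases2) (simp_all add: Complex.DeMoivre power_int_minus)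

text \<open>If the Fourier coefficients of a charge decay geometrically, their Fourier series converges to a
  bounded density. The charge with this density has the same coefficients, so it is the given charge,
  and it is bounded by the supremum of the density.\<close>
lemma charge_bound_by_moments:
  assumes I: "circle_charge I" and r: "0 < r" "r < 1"
    and d: "\<And>n. norm (I (\<lambda>z. z powi n)) \<le> K * r ^ nat \<bar>n\<bar>"
    and f: "f \<in> borel_measurable borel" "\<And>z. z \<in> sphere 0 1 \<Longrightarrow> norm (f z) \<le> B"
  shows "norm (I f) \<le> B * (K * geometric_int_sum r)"
proof -
  define d where "d n = I (\<lambda>z. z powi n)" for n
  have dn: "norm (d n) \<le> K * r ^ nat \<bar>n\<bar>" for n using assms(4) by (simp add: d_def)
  have sK: "summable (\<lambda>j. K * r ^ nat \<bar>int_decode j\<bar>)"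
    by (intro summable_mult summable_geometric_int r)
  have sd: "summable (\<lambda>j. norm (d (int_decode j)))"
    by (rule summable_comparison_test'[OF sK]) (use dn in auto)
  define D where "D s = (\<Sum>j. d (int_decode j) * cis (2 * pi * of_int (- int_decode j) * s))" for s :: real
  have sD: "summable (\<lambda>j. norm (d (int_decode j) * cis (2 * pi * of_int (- int_decode j) * s)))" for s
    using sd by (simp add: norm_mult)
  have D_le: "norm (D s) \<le> K * geometric_int_sum r" for s
  proof -
    have "norm (D s) \<le> (\<Sum>j. norm (d (int_decode j)))"
      unfolding D_def using summable_norm[OF sD[of s]] by (simp add: norm_mult)
    also have "\<dots> \<le> (\<Sum>j. K * r ^ nat \<bar>int_decode j\<bar>)"
      by (intro suminf_le dn sd sK)
    also have "\<dots> = K * geometric_int_sum r"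
      unfolding geometric_int_sum_def by (rule suminf_mult[OF summable_geometric_int[OF r]])
    finally show ?thesis .
  qed
  have [measurable]: "(\<lambda>s. D s) \<in> borel_measurable borel"
    unfolding D_def by (intro borel_measurable_suminf borel_measurable_continuous_onI continuous_intros)
  define J where "J g = (\<integral>s. (indicator {0..1} s *\<^sub>R D s) * g (cis (2 * pi * s)) \<partial>lborel)" for g
  have i01: "integrable lborel (\<lambda>s. indicator {0..1::real} s *\<^sub>R (1::complex))"
    by (intro integrable_scaleR_left) (auto intro!: integrable_real_indicator)
  have intD: "integrable lborel (\<lambda>s. indicator {0..1} s *\<^sub>R D s)"
  proof (rule Bochner_Integration.integrable_bound)
    show "integrable lborel (\<lambda>s. indicator {0..1::real} s *\<^sub>R (K * geometric_int_sum r))"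
      by (intro integrable_scaleR_left) (auto intro!: integrable_real_indicator)
    show "AE s in lborel. norm (indicator {0..1} s *\<^sub>R D s) \<le> norm (indicator {0..1} s *\<^sub>R (K * geometric_int_sum r))"
      using D_le by (intro AE_I2) (auto simp: indicator_def intro: order_trans[OF _ abs_ge_self])
  qed measurable
  have [measurable]: "(\<lambda>s. cis (c * s)) \<in> borel_measurable borel" for c
    by (intro borel_measurable_continuous_onI continuous_intros)
  have J: "circle_charge J"
    unfolding J_def
    by (rule circle_charge_weighted_integral[OF intD]) (auto intro!: borel_measurable_continuous_onI continuous_intros)
  have Jm: "J (\<lambda>z. z powi m) = d m" for m
  proof -
    have "J (\<lambda>z. z powi m) = (\<integral>s. (\<Sum>j. d (int_decode j) * (indicator {0..1} s *\<^sub>R cis (2 * pi * of_int (m - int_decode j) * s))) \<partial>lborel)"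
      unfolding J_def
    proof (rule Bochner_Integration.integral_cong[OF refl])
      fix s :: real
      have "D s * cis (2 * pi * of_int m * s) = (\<Sum>j. d (int_decode j) * cis (2 * pi * of_int (- int_decode j) * s) * cis (2 * pi * of_int m * s))"
        unfolding D_def by (rule suminf_mult2[OF summable_norm_cancel[OF sD]])
      also have "\<dots> = (\<Sum>j. d (int_decode j) * cis (2 * pi * of_int (m - int_decode j) * s))"
        by (simp add: mult.assoc cis_mult algebra_simps)
      finally show "indicator {0..1} s *\<^sub>R D s * cis (2 * pi * s) powi m =
          (\<Sum>j. d (int_decode j) * (indicator {0..1} s *\<^sub>R cis (2 * pi * of_int (m - int_decode j) * s)))"
        by (cases "s \<in> {0..1}") (simp_all add: cis_powi mult_ac)
    qed
    also have "\<dots> = (\<Sum>j. \<integral>s. d (int_decode j) * (indicator {0..1} s *\<^sub>R cis (2 * pi * of_int (m - int_decode j) * s)) \<partial>lborel)"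
    proof (rule integral_suminf)
      have b: "norm (d (int_decode j) * (indicator {0..1} s *\<^sub>R cis (2 * pi * of_int (m - int_decode j) * s))) =
         indicator {0..1} s *\<^sub>R norm (d (int_decode j))" for j s
        by (auto simp: norm_mult indicator_def)
      have ii: "integrable lborel (\<lambda>s. indicator {0..1::real} s *\<^sub>R norm (d (int_decode j)))" for j
        by (intro integrable_scaleR_left) (auto intro!: integrable_real_indicator)
      show "integrable lborel (\<lambda>s. d (int_decode j) * (indicator {0..1} s *\<^sub>R cis (2 * pi * of_int (m - int_decode j) * s)))" for j
      proof (rule Bochner_Integration.integrable_bound[OF ii[of j]])
        show "(\<lambda>s. d (int_decode j) * (indicator {0..1} s *\<^sub>R cis (2 * pi * of_int (m - int_decode j) * s))) \<in> borel_measurable lborel"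
          by measurable
        show "AE s in lborel. norm (d (int_decode j) * (indicator {0..1} s *\<^sub>R cis (2 * pi * of_int (m - int_decode j) * s)))
            \<le> norm (indicator {0..1::real} s *\<^sub>R norm (d (int_decode j)))"
          unfolding b by simp
      qed
      show "AE s in lborel. summable (\<lambda>j. norm (d (int_decode j) * (indicator {0..1} s *\<^sub>R cis (2 * pi * of_int (m - int_decode j) * s))))"
        unfolding b using sd by (intro AE_I2) (auto intro: summable_scaleR_right)
      show "summable (\<lambda>j. \<integral>s. norm (d (int_decode j) * (indicator {0..1} s *\<^sub>R cis (2 * pi * of_int (m - int_decode j) * s))) \<partial>lborel)"
        unfolding b using sd by simp
    qed
    also have "\<dots> = (\<Sum>j. if j = int_encode m then d m else 0)"
    proof (rule suminf_cong)
      fix j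
      have "m - int_decode j = 0 \<longleftrightarrow> j = int_encode m" by auto
      then show "(\<integral>s. d (int_decode j) * (indicator {0..1} s *\<^sub>R cis (2 * pi * of_int (m - int_decode j) * s)) \<partial>lborel) =
         (if j = int_encode m then d m else 0)"
        unfolding integral_mult_right_zero integral_cis_period by auto
    qed
    also have "\<dots> = d m" by (subst suminf_finite[of "{int_encode m}"]) auto
    finally show ?thesis .
  qed
  have fb: "circle_bounded f" unfolding circle_bounded_def using f by blast
  have "I f - J f = 0"
    by (rule charge_eq_0_if_moments_eq_0[OF circle_charge_diff[OF I J] _ fb]) (simp add: Jm d_def)
  then have "norm (I f) = norm (J f)" by simp
  also have "\<dots> \<le> (\<integral>s. norm ((indicator {0..1} s *\<^sub>R D s) * f (cis (2 * pi * s))) \<partial>lborel)"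
    unfolding J_def by (rule Bochner_Integration.integral_norm_bound)
  also have "\<dots> \<le> (\<integral>s. indicator {0..1::real} s *\<^sub>R (B * (K * geometric_int_sum r)) \<partial>lborel)"
  proof (rule Bochner_Integration.integral_mono')
    show "integrable lborel (\<lambda>s. indicator {0..1::real} s *\<^sub>R (B * (K * geometric_int_sum r)))"
      by (intro integrable_scaleR_left) (auto intro!: integrable_real_indicator)
    fix s :: real
    have "norm (D s * f (cis (2 * pi * s))) \<le> (K * geometric_int_sum r) * B"
      unfolding norm_mult using D_le[of s] f(2)[of "cis (2 * pi * s)"]
      by (intro mult_mono) (auto intro: order_trans[OF norm_ge_zero])
    then show "norm (indicator {0..1} s *\<^sub>R D s * f (cis (2 * pi * s))) \<le> indicator {0..1} s *\<^sub>R (B * (K * geometric_int_sum r))"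
      by (auto simp: indicator_def mult_ac)
    show "0 \<le> indicator {0..1} s *\<^sub>R (B * (K * geometric_int_sum r))"
      using D_le[of 0] f(2)[of 1]
      by (intro scaleR_nonneg_nonneg mult_nonneg_nonneg[of B]) (auto intro: order_trans[OF norm_ge_zero])
  qed
  also have "\<dots> = B * (K * geometric_int_sum r)" by simp
  finally show ?thesis .
qed

section \<open>Splitting functions on two arcs into a periodic and an odd part\<close>

lemma borel_measurable_Arg2pi [measurable]: "Arg2pi \<in> borel_measurable borel"
  by (rule borel_measurableI_greater) (simp add: borel_open open_Arg2pi2pi_gt)

lemma Arg2pi_cis: "0 \<le> a \<Longrightarrow> a < 2 * pi \<Longrightarrow> Arg2pi (cis a) = a"
  by (rule Arg2pi_unique[of 1]) (simp_all add: cis_conv_exp)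

lemma Arg2pi_cis_neg: "- (2 * pi) \<le> a \<Longrightarrow> a < 0 \<Longrightarrow> Arg2pi (cis a) = a + 2 * pi"
  using Arg2pi_cis[of "a + 2 * pi"] by (simp add: cis_mult[symmetric])

text \<open>The two arcs are \<open>(-h, 0)\<close> and \<open>(0, h)\<close>; each of them is a copy of the circle of length \<open>h\<close> cut at
  the origin.\<close>
locale two_arcs =
  fixes h \<nu> :: real
  assumes h: "0 < h" and \<nu>: "0 < \<nu>"
begin

text \<open>The determinant, up to sign, of the linear system that \<open>odd_part\<close> solves.\<close>
definition arc_det :: real where "arc_det = exp (\<nu> * h) - exp (- \<nu> * h)"

lemma arc_det_pos: "0 < arc_det" using h \<nu> by (simp add: arc_det_def)

text \<open>The value at \<open>u\<close> in \<open>(0, h)\<close> of the odd function \<open>S\<close> for which \<open>g - exp (-\<nu> y) S\<close> is \<open>h\<close>-periodic. It is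
  Cramer's rule for the two conditions at \<open>u\<close> and \<open>h - u\<close>, whose unknowns are \<open>S u\<close> and \<open>S (h - u)\<close>.\<close>
definition odd_part :: "(real \<Rightarrow> real) \<Rightarrow> real \<Rightarrow> real" where
  "odd_part g u = (exp (\<nu> * (h - u)) * (g (h - u) - g (- u)) - exp (- \<nu> * (h - u)) * (g u - g (u - h))) / arc_det"

text \<open>At the origin, whose translates \<open>-h\<close> and \<open>h\<close> lie outside the arcs, the odd part vanishes.\<close>
definition periodic_part :: "(real \<Rightarrow> real) \<Rightarrow> real \<Rightarrow> real" where
  "periodic_part g u = (if u = 0 then g 0 else g u - exp (- \<nu> * u) * odd_part g u)"

text \<open>The periodicity for which \<open>odd_part\<close> is made: at \<open>u - h\<close> the odd function takes the value
  \<open>- S (h - u)\<close>.\<close>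
lemma periodic_odd_shift:
  "g (u - h) = g u - exp (- \<nu> * u) * odd_part g u - exp (\<nu> * (h - u)) * odd_part g (h - u)"
proof -
  have 1: "exp (- \<nu> * u) * odd_part g u = (exp (\<nu> * (h - 2 * u)) * (g (h - u) - g (- u)) - exp (- \<nu> * h) * (g u - g (u - h))) / arc_det"
    unfolding odd_part_def times_divide_eq_right right_diff_distrib[of "exp (- \<nu> * u)"] mult.assoc[symmetric] mult_exp_exp
    by (simp add: algebra_simps)
  have 2: "exp (\<nu> * (h - u)) * odd_part g (h - u) = (exp (\<nu> * h) * (g u - g (u - h)) - exp (\<nu> * (h - 2 * u)) * (g (h - u) - g (- u))) / arc_det"
    unfolding odd_part_def times_divide_eq_right right_diff_distrib[of "exp (\<nu> * (h - u))"] mult.assoc[symmetric] mult_exp_exp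
    by (simp add: algebra_simps)
  have "exp (- \<nu> * u) * odd_part g u + exp (\<nu> * (h - u)) * odd_part g (h - u) = arc_det * (g u - g (u - h)) / arc_det"
    unfolding 1 2 add_divide_distrib[symmetric] arc_det_def by (simp add: algebra_simps)
  then show ?thesis using arc_det_pos by simp
qed

definition odd_bound :: real where "odd_bound = 2 * exp (\<nu> * h) / arc_det"
definition periodic_bound :: real where "periodic_bound = 1 + odd_bound"

lemma scaled_Arg2pi: "0 \<le> h * (Arg2pi z / (2 * pi))" "h * (Arg2pi z / (2 * pi)) \<le> h"
proof -
  have *: "0 \<le> Arg2pi z / (2 * pi)" "Arg2pi z / (2 * pi) \<le> 1" using Arg2pi[of z] by auto
  show "0 \<le> h * (Arg2pi z / (2 * pi))" by (rule mult_nonneg_nonneg[OF less_imp_le[OF h] *(1)])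
  show "h * (Arg2pi z / (2 * pi)) \<le> h" by (rule mult_left_le[OF *(2) less_imp_le[OF h]])
qed

lemma odd_bound_nonneg: "0 \<le> odd_bound"
  using arc_det_pos by (simp add: odd_bound_def)

lemma parts_bounded:
  assumes g: "\<And>y. 0 \<le> g y \<and> g y \<le> 1" and u: "0 \<le> u" "u \<le> h"
  shows "\<bar>odd_part g u\<bar> \<le> odd_bound" "\<bar>periodic_part g u\<bar> \<le> periodic_bound"
proof -
  have d: "\<bar>g y - g z\<bar> \<le> 1" for y z using g[of y] g[of z] by linarith
  have "\<bar>exp (\<nu> * (h - u)) * (g (h - u) - g (- u)) - exp (- \<nu> * (h - u)) * (g u - g (u - h))\<bar> \<le>
     exp (\<nu> * (h - u)) * \<bar>g (h - u) - g (- u)\<bar> + exp (- \<nu> * (h - u)) * \<bar>g u - g (u - h)\<bar>"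
    by (rule order_trans[OF abs_triangle_ineq4]) (simp add: abs_mult)
  also have "\<dots> \<le> exp (\<nu> * h) * 1 + exp (\<nu> * h) * 1"
  proof (intro add_mono mult_mono d)
    show "exp (\<nu> * (h - u)) \<le> exp (\<nu> * h)" using u \<nu> by simp
    have "- \<nu> * (h - u) \<le> 0" using u \<nu> by (intro mult_nonpos_nonneg) auto
    also have "0 \<le> \<nu> * h" using h \<nu> by simp
    finally show "exp (- \<nu> * (h - u)) \<le> exp (\<nu> * h)" by simp
  qed auto
  finally show o: "\<bar>odd_part g u\<bar> \<le> odd_bound"
    unfolding odd_part_def odd_bound_def using arc_det_pos by (simp add: divide_right_mono)
  have "\<bar>exp (- \<nu> * u) * odd_part g u\<bar> \<le> 1 * odd_bound"
    unfolding abs_mult using o u \<nu> by (intro mult_mono) auto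
  then show "\<bar>periodic_part g u\<bar> \<le> periodic_bound"
    unfolding periodic_part_def periodic_bound_def using g[of 0] g[of u] odd_bound_nonneg by auto
qed

definition distance_const :: "real \<Rightarrow> real" where
  "distance_const r = (periodic_bound + 2 * odd_bound) * geometric_int_sum r"

definition circle_mode :: "int \<Rightarrow> real \<Rightarrow> complex" where
  "circle_mode n v = cis (2 * pi * of_int n * v / h)"

definition sine_mode :: "nat \<Rightarrow> real \<Rightarrow> real" where
  "sine_mode k v = exp (- \<nu> * v) * sin (real k * pi * v / h)"

text \<open>A function of period \<open>h\<close>, moved to the unit circle along \<open>v \<mapsto> cis (2 \<pi> v / h)\<close>.\<close>
definition periodic_lift :: "(real \<Rightarrow> real) \<Rightarrow> complex \<Rightarrow> complex" where
  "periodic_lift g z = of_real (periodic_part g (h * (Arg2pi z / (2 * pi))))"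

text \<open>An odd function on \<open>(-h, h)\<close> lives on a circle of length \<open>2 h\<close>, that is, along \<open>v \<mapsto> cis (\<pi> v / h)\<close>. Only the upper
  half of this circle carries its values; antisymmetry is restored by a difference in
  \<open>periodic_odd_decomposition\<close>.\<close>
definition odd_lift :: "(real \<Rightarrow> real) \<Rightarrow> complex \<Rightarrow> complex" where
  "odd_lift g z = (let u = h * (Arg2pi z / pi) in if 0 < u \<and> u < h then of_real (odd_part g u) else 0)"

lemma periodic_odd_decomposition:
  assumes v: "v \<in> {-h<..<h}"
  shows "of_real (g v) = periodic_lift g (cis (2 * pi * v / h)) + of_real (exp (- \<nu> * v)) * (odd_lift g (cis (pi * v / h)) - odd_lift g (cis (- (pi * v / h))))"
proof -
  have v': "- h < v" "v < h" using v by auto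
  consider "v = 0" | "0 < v" | "v < 0" by linarith
  then show ?thesis
  proof cases
    case 1
    then show ?thesis using Arg2pi_cis[of 0] by (simp add: periodic_lift_def odd_lift_def periodic_part_def)
  next
    case 2
    have "Arg2pi (cis (2 * pi * v / h)) = 2 * pi * v / h"
      using 2 v' h by (intro Arg2pi_cis) (auto simp: field_simps)
    then have f1: "periodic_lift g (cis (2 * pi * v / h)) = of_real (g v - exp (- \<nu> * v) * odd_part g v)"
      using 2 h unfolding periodic_lift_def periodic_part_def by simp
    have "Arg2pi (cis (pi * v / h)) = pi * v / h"
      using 2 v' h by (intro Arg2pi_cis) (auto simp: field_simps intro: order_trans[of _ "h * pi"])
    then have f2: "odd_lift g (cis (pi * v / h)) = of_real (odd_part g v)"
      using 2 v' h unfolding odd_lift_def Let_def by simp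
    have "Arg2pi (cis (- (pi * v / h))) = - (pi * v / h) + 2 * pi"
      using 2 v' h by (intro Arg2pi_cis_neg) (auto simp: field_simps)
    then have "h * (Arg2pi (cis (- (pi * v / h))) / pi) = 2 * h - v" using h by (simp add: field_simps)
    then have f3: "odd_lift g (cis (- (pi * v / h))) = 0"
      using 2 v' unfolding odd_lift_def Let_def by simp
    show ?thesis unfolding f1 f2 f3 by simp
  next
    case 3
    have q: "pi * (- h) < pi * v" "pi * v < 0"
      using v' 3 by (intro mult_strict_left_mono mult_pos_neg; simp)+
    have "Arg2pi (cis (2 * pi * v / h)) = 2 * pi * v / h + 2 * pi"
      using q 3 v' h by (intro Arg2pi_cis_neg) (auto simp: field_simps)
    then have "h * (Arg2pi (cis (2 * pi * v / h)) / (2 * pi)) = v + h" using h by (simp add: field_simps)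
    then have f1: "periodic_lift g (cis (2 * pi * v / h)) = of_real (g (v + h) - exp (- \<nu> * (v + h)) * odd_part g (v + h))"
      using v' unfolding periodic_lift_def periodic_part_def by simp
    have "Arg2pi (cis (- (pi * v / h))) = - (pi * v / h)"
      using q 3 v' h by (intro Arg2pi_cis) (auto simp: field_simps intro: order_trans[of _ "h * pi"])
    then have f2: "odd_lift g (cis (- (pi * v / h))) = of_real (odd_part g (- v))"
      using 3 v' h unfolding odd_lift_def Let_def by simp
    have "Arg2pi (cis (pi * v / h)) = pi * v / h + 2 * pi"
      using q 3 v' h by (intro Arg2pi_cis_neg) (auto simp: field_simps)
    then have "h * (Arg2pi (cis (pi * v / h)) / pi) = 2 * h + v" using h by (simp add: field_simps)
    then have f3: "odd_lift g (cis (pi * v / h)) = 0"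
      using 3 v' unfolding odd_lift_def Let_def by simp
    show ?thesis unfolding f1 f2 f3 using periodic_odd_shift[of g "v + h"] by simp
  qed
qed

text \<open>The indicator of \<open>A\<close> is split by \<open>periodic_odd_decomposition\<close>. Against the first summand, the two
  laws act as charges whose Fourier coefficients are the circle moments. Against the second one, they
  act as charges whose coefficients are sine moments up to the factor \<open>2 i\<close>, because the difference of
  the two conjugate characters is a sine.\<close>
lemma moment_distance:
  assumes P: "prob_space P" "sets P = sets borel" "AE v in P. v \<in> {-h<..<h}"
    and Q: "prob_space Q" "sets Q = sets borel" "AE v in Q. v \<in> {-h<..<h}"
    and r: "0 < r" "r < 1"
    and c: "\<And>n. norm ((\<integral>v. circle_mode n v \<partial>P) - (\<integral>v. circle_mode n v \<partial>Q)) \<le> K * r ^ nat \<bar>n\<bar>"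
    and s: "\<And>k. \<bar>(\<integral>v. sine_mode k v \<partial>P) - (\<integral>v. sine_mode k v \<partial>Q)\<bar> \<le> K * r ^ k"
    and A: "A \<in> sets borel"
  shows "\<bar>measure P A - measure Q A\<bar> \<le> distance_const r * K"
proof -
  let ?g = "indicator A :: real \<Rightarrow> real"
  have gm [measurable]: "?g \<in> borel_measurable borel" using A by simp
  \<comment> \<open>the weight is cut off outside the arcs to be bounded; the laws do not charge the complement\<close>
  define w where "w v = (of_real (indicator {-h<..<h} v * exp (- \<nu> * v)) :: complex)" for v :: real
  have wm [measurable]: "w \<in> borel_measurable borel" unfolding w_def by measurable
  have w_le: "norm (w v) \<le> exp (\<nu> * h)" for v
  proof (cases "v \<in> {-h<..<h}")
    case True
    then have "\<nu> * (- v) \<le> \<nu> * h" using \<nu> by (intro mult_left_mono) auto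
    then show ?thesis using True by (simp add: w_def norm_mult)
  qed (simp add: w_def)
  have cism [measurable]: "(\<lambda>v. cis (f v)) \<in> borel_measurable N" if "f \<in> borel_measurable N" for f and N :: "real measure"
  proof -
    have "(\<lambda>v. cis v) \<in> borel_measurable borel" by (intro borel_measurable_continuous_onI continuous_intros)
    from measurable_compose[OF that this] show ?thesis .
  qed
  have om: "odd_part ?g \<in> borel_measurable borel" unfolding odd_part_def by measurable
  have pm: "periodic_part ?g \<in> borel_measurable borel" unfolding periodic_part_def using om by measurable
  have f1m [measurable]: "periodic_lift ?g \<in> borel_measurable borel" unfolding periodic_lift_def using pm by measurable
  have f2m [measurable]: "odd_lift ?g \<in> borel_measurable borel" unfolding odd_lift_def Let_def using om by measurable
  define I1 where "I1 N f = (\<integral>v. 1 * f (cis (2 * pi * v / h)) \<partial>N)" for N :: "real measure" and f :: "complex \<Rightarrow> complex"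
  define I2 where "I2 N f = (\<integral>v. w v * f (cis (pi * v / h)) \<partial>N) - (\<integral>v. w v * f (cis (- (pi * v / h))) \<partial>N)" for N :: "real measure" and f :: "complex \<Rightarrow> complex"
  have charges: "circle_charge (I1 N)" "circle_charge (I2 N)"
    and I1_mode: "I1 N (\<lambda>z. z powi n) = (\<integral>v. circle_mode n v \<partial>N)"
    and I2_mode: "I2 N (\<lambda>z. z powi n) = 2 * \<i> * of_int (sgn n) * of_real (\<integral>v. sine_mode (nat \<bar>n\<bar>) v \<partial>N)"
    and I_sum: "of_real (measure N A) = I1 N (periodic_lift ?g) + I2 N (odd_lift ?g)"
    if N: "prob_space N" "sets N = sets borel" "AE v in N. v \<in> {-h<..<h}" for N n
  proof -
    interpret N: prob_space N by (rule N(1))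
    note N(2)[measurable_cong]
    have iw: "integrable N w" by (rule N.integrable_const_bound[of _ "exp (\<nu> * h)"]) (use w_le in auto)
    show "circle_charge (I1 N)" unfolding I1_def
      by (rule circle_charge_weighted_integral) auto
    show "circle_charge (I2 N)" unfolding I2_def
      by (intro circle_charge_diff circle_charge_weighted_integral iw) auto
    show "I1 N (\<lambda>z. z powi n) = (\<integral>v. circle_mode n v \<partial>N)"
      unfolding I1_def circle_mode_def cis_powi by (simp add: mult_ac)
    have iwc: "integrable N (\<lambda>v. w v * f (cis (e v)))" if fb: "circle_bounded f" and em [measurable]: "e \<in> borel_measurable borel" for f e
    proof -
      obtain C where C: "\<And>z. z \<in> sphere 0 1 \<Longrightarrow> norm (f z) \<le> C" and [measurable]: "f \<in> borel_measurable borel"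
        using fb unfolding circle_bounded_def by blast
      show ?thesis
      proof (rule N.integrable_const_bound[where B = "exp (\<nu> * h) * C"])
        show "AE v in N. norm (w v * f (cis (e v))) \<le> exp (\<nu> * h) * C"
          unfolding norm_mult by (intro AE_I2 mult_mono w_le C) auto
      qed measurable
    qed
    have I2: "I2 N f = (\<integral>v. w v * (f (cis (pi * v / h)) - f (cis (- (pi * v / h)))) \<partial>N)" if "circle_bounded f" for f
      unfolding I2_def right_diff_distrib
      by (rule Bochner_Integration.integral_diff[symmetric]; rule iwc[OF that]; measurable)
    have "w v * (cis (pi * v / h) powi n - cis (- (pi * v / h)) powi n) = (2 * \<i> * of_int (sgn n)) * of_real (sine_mode (nat \<bar>n\<bar>) v)"
      if "v \<in> {-h<..<h}" for v
    proof -
      have "cis (pi * v / h) powi n - cis (- (pi * v / h)) powi n = 2 * \<i> * of_real (sin (of_int n * (pi * v / h)))"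
        unfolding cis_powi by (simp add: complex_eq_iff)
      also have "sin (of_int n * (pi * v / h)) = of_int (sgn n) * sin (real (nat \<bar>n\<bar>) * pi * v / h)"
        by (cases n rule: int_cases3) (simp_all add: mult_ac)
      finally show ?thesis using that unfolding w_def sine_mode_def by simp
    qed
    then have "I2 N (\<lambda>z. z powi n) = (\<integral>v. (2 * \<i> * of_int (sgn n)) * of_real (sine_mode (nat \<bar>n\<bar>) v) \<partial>N)"
      unfolding I2[OF circle_bounded_powi]
    proof (intro integral_cong_AE)
      show "(\<lambda>v. w v * (cis (pi * v / h) powi n - cis (- (pi * v / h)) powi n)) \<in> borel_measurable N"
        unfolding cis_powi by measurable
      show "(\<lambda>v. (2 * \<i> * of_int (sgn n)) * of_real (sine_mode (nat \<bar>n\<bar>) v)) \<in> borel_measurable N"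
        unfolding sine_mode_def by measurable
    qed (use N(3) in auto)
    then show "I2 N (\<lambda>z. z powi n) = 2 * \<i> * of_int (sgn n) * of_real (\<integral>v. sine_mode (nat \<bar>n\<bar>) v \<partial>N)"
      unfolding integral_mult_right_zero integral_complex_of_real .
    have g01: "\<And>y. 0 \<le> ?g y \<and> ?g y \<le> 1" by (auto simp: indicator_def)
    have cb2: "circle_bounded (odd_lift ?g)"
      unfolding circle_bounded_def using f2m
      by (intro conjI exI[of _ odd_bound]) (auto simp: odd_lift_def Let_def odd_bound_nonneg intro!: parts_bounded(1)[OF g01])
    have i1: "integrable N (\<lambda>v. periodic_lift ?g (cis (2 * pi * v / h)))"
    proof (rule N.integrable_const_bound[where B = periodic_bound])
      show "AE v in N. norm (periodic_lift ?g (cis (2 * pi * v / h))) \<le> periodic_bound"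
        unfolding periodic_lift_def norm_of_real by (intro AE_I2 parts_bounded(2)[OF g01] scaled_Arg2pi)
    qed measurable
    have i2: "integrable N (\<lambda>v. w v * (odd_lift ?g (cis (pi * v / h)) - odd_lift ?g (cis (- (pi * v / h)))))"
      unfolding right_diff_distrib by (intro Bochner_Integration.integrable_diff iwc cb2) auto
    have "of_real (measure N A) = (\<integral>v. of_real (?g v) \<partial>N :: complex)"
      using A N(2) by (simp add: integral_complex_of_real)
    also have "\<dots> = (\<integral>v. periodic_lift ?g (cis (2 * pi * v / h)) + w v * (odd_lift ?g (cis (pi * v / h)) - odd_lift ?g (cis (- (pi * v / h)))) \<partial>N)"
    proof (rule integral_cong_AE)
      show "AE v in N. of_real (?g v) = periodic_lift ?g (cis (2 * pi * v / h)) + w v * (odd_lift ?g (cis (pi * v / h)) - odd_lift ?g (cis (- (pi * v / h))))"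
        using N(3)
      proof eventually_elim
        case (elim v)
        then show ?case using periodic_odd_decomposition[OF elim, of ?g] by (simp add: w_def)
      qed
    qed measurable
    also have "\<dots> = I1 N (periodic_lift ?g) + I2 N (odd_lift ?g)"
      unfolding I2[OF cb2] I1_def mult_1 by (rule Bochner_Integration.integral_add[OF i1 i2])
    finally show "of_real (measure N A) = I1 N (periodic_lift ?g) + I2 N (odd_lift ?g)" .
  qed
  have g01: "\<And>y. 0 \<le> ?g y \<and> ?g y \<le> 1" by (auto simp: indicator_def)
  have b1: "norm (I1 P (periodic_lift ?g) - I1 Q (periodic_lift ?g)) \<le> periodic_bound * (K * geometric_int_sum r)"
  proof (rule charge_bound_by_moments[OF circle_charge_diff[OF charges(1)[OF P] charges(1)[OF Q]] r _ f1m])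
    show "norm (I1 P (\<lambda>z. z powi n) - I1 Q (\<lambda>z. z powi n)) \<le> K * r ^ nat \<bar>n\<bar>" for n
      unfolding I1_mode[OF P] I1_mode[OF Q] by (rule c)
    fix z :: complex
    show "norm (periodic_lift ?g z) \<le> periodic_bound"
      unfolding periodic_lift_def norm_of_real by (intro parts_bounded(2)[OF g01] scaled_Arg2pi)
  qed
  have K0: "0 \<le> K" using s[of 0] by (auto intro: order_trans)
  have b2: "norm (I2 P (odd_lift ?g) - I2 Q (odd_lift ?g)) \<le> odd_bound * ((2 * K) * geometric_int_sum r)"
  proof (rule charge_bound_by_moments[OF circle_charge_diff[OF charges(2)[OF P] charges(2)[OF Q]] r _ f2m])
    fix n :: int
    have "norm (I2 P (\<lambda>z. z powi n) - I2 Q (\<lambda>z. z powi n)) =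
       2 * \<bar>of_int (sgn n)\<bar> * \<bar>(\<integral>v. sine_mode (nat \<bar>n\<bar>) v \<partial>P) - (\<integral>v. sine_mode (nat \<bar>n\<bar>) v \<partial>Q)\<bar>"
      unfolding I2_mode[OF P] I2_mode[OF Q] right_diff_distrib[symmetric] of_real_diff[symmetric] norm_mult norm_of_real norm_of_int
      by simp
    also have "\<dots> \<le> 2 * 1 * (K * r ^ nat \<bar>n\<bar>)"
      by (intro mult_mono s) (auto simp: sgn_if)
    finally show "norm (I2 P (\<lambda>z. z powi n) - I2 Q (\<lambda>z. z powi n)) \<le> (2 * K) * r ^ nat \<bar>n\<bar>" by simp
  next
    fix z :: complex
    show "norm (odd_lift ?g z) \<le> odd_bound"
      unfolding odd_lift_def Let_def using parts_bounded(1)[OF g01] odd_bound_nonneg by auto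
  qed
  have "complex_of_real (measure P A - measure Q A) = (I1 P (periodic_lift ?g) - I1 Q (periodic_lift ?g)) + (I2 P (odd_lift ?g) - I2 Q (odd_lift ?g))"
    unfolding of_real_diff I_sum[OF P] I_sum[OF Q] by simp
  then have "\<bar>measure P A - measure Q A\<bar> = norm ((I1 P (periodic_lift ?g) - I1 Q (periodic_lift ?g)) + (I2 P (odd_lift ?g) - I2 Q (odd_lift ?g)))"
    by (metis norm_of_real)
  also have "\<dots> \<le> periodic_bound * (K * geometric_int_sum r) + odd_bound * ((2 * K) * geometric_int_sum r)"
    by (rule norm_triangle_mono[OF b1 b2])
  also have "\<dots> = distance_const r * K" by (simp add: distance_const_def algebra_simps)
  finally show ?thesis .
qed

end

section \<open>Total variation distance\<close>

lemma total_variation_bdd: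
  fixes P Q :: "real measure"
  assumes "prob_space P" "prob_space Q"
  shows "bdd_above ((\<lambda>A. \<bar>measure P A - measure Q A\<bar>) ` sets borel)"
proof (rule bdd_aboveI2)
  fix A :: "real set"
  show "\<bar>measure P A - measure Q A\<bar> \<le> 1"
    using prob_space.prob_le_1[OF assms(1), of A] prob_space.prob_le_1[OF assms(2), of A]
      measure_nonneg[of P A] measure_nonneg[of Q A] by linarith
qed

lemma total_variation_upper:
  assumes "prob_space P" "prob_space Q" "A \<in> sets borel"
  shows "\<bar>measure P A - measure Q A\<bar> \<le> total_variation P Q"
  unfolding total_variation_def by (rule cSUP_upper[OF assms(3) total_variation_bdd[OF assms(1,2)]])

lemma total_variation_least:
  assumes "\<And>A. A \<in> sets borel \<Longrightarrow> \<bar>measure P A - measure Q A\<bar> \<le> C"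
  shows "total_variation P Q \<le> C"
  unfolding total_variation_def by (rule cSUP_least) (use assms in auto)

text \<open>Cutting the range of \<open>f\<close> into \<open>m\<close> equal slices replaces \<open>f\<close>, up to an error \<open>1 / m\<close>, by an average
  of indicators of its superlevel sets.\<close>
lemma integral_diff_le_total_variation:
  assumes P: "prob_space P" "sets P = sets borel" and Q: "prob_space Q" "sets Q = sets borel"
    and f [measurable]: "f \<in> borel_measurable borel" and f01: "\<And>y. 0 \<le> f y" "\<And>y. f y \<le> 1"
  shows "(\<integral>y. f y \<partial>P) - (\<integral>y. f y \<partial>Q) \<le> total_variation P Q"
proof (rule field_le_epsilon)
  fix e :: real assume "0 < e"
  then obtain n where n: "1 / real (Suc n) < e" using nat_approx_posE by blast
  define m where "m = Suc n"
  have m: "0 < real m" "1 / real m < e" using n by (auto simp: m_def)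
  define A where "A j = {y. real (Suc j) / real m \<le> f y}" for j
  have A [measurable]: "A j \<in> sets borel" for j unfolding A_def by measurable
  define s where "s y = (\<Sum>j<m. indicator (A j) y :: real)" for y
  have s: "s y \<le> real m * f y" "real m * f y \<le> s y + 1" for y
  proof -
    define k where "k = nat \<lfloor>real m * f y\<rfloor>"
    have k: "real k \<le> real m * f y" "real m * f y < real k + 1"
      using f01(1)[of y] m unfolding k_def by auto
    have km: "k \<le> m"
    proof -
      have "real m * f y \<le> real m * 1" using f01(2)[of y] m by (intro mult_left_mono) auto
      then show ?thesis using k(1) by simp
    qed
    have "y \<in> A j \<longleftrightarrow> j < k" for j
    proof -
      have "y \<in> A j \<longleftrightarrow> real (Suc j) \<le> real m * f y" using m by (simp add: A_def field_simps del: of_nat_Suc)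
      also have "\<dots> \<longleftrightarrow> Suc j \<le> k" using k by linarith
      finally show ?thesis by auto
    qed
    then have "s y = (\<Sum>j<m. if j < k then 1 else 0)" unfolding s_def by (intro sum.cong) auto
    also have "\<dots> = real (card {j \<in> {..<m}. j < k})" by (simp add: sum.If_cases Int_def)
    also have "{j \<in> {..<m}. j < k} = {..<k}" using km by auto
    finally have "s y = real k" by simp
    then show "s y \<le> real m * f y" "real m * f y \<le> s y + 1" using k by auto
  qed
  have int: "integrable N f" "(\<integral>y. s y \<partial>N) = (\<Sum>j<m. measure N (A j))" "integrable N s"
    if N: "prob_space N" "sets N = sets borel" for N
  proof -
    interpret N: prob_space N by (rule N(1))
    note N(2)[measurable_cong]
    show "integrable N f" by (rule N.integrable_const_bound[where B = 1]) (use f01 in auto)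
    have i: "integrable N (\<lambda>y. indicator (A j) y :: real)" for j
      by (intro integrable_real_indicator) (auto simp: N.emeasure_eq_measure)
    show "integrable N s" unfolding s_def by (intro Bochner_Integration.integrable_sum i)
    show "(\<integral>y. s y \<partial>N) = (\<Sum>j<m. measure N (A j))"
      unfolding s_def Bochner_Integration.integral_sum[OF i]
      by (intro sum.cong) (use sets_eq_imp_space_eq[OF N(2)] in auto)
  qed
  interpret P: prob_space P by (rule P(1))
  have "real m * (\<integral>y. f y \<partial>P) \<le> (\<integral>y. s y + 1 \<partial>P)"
    unfolding integral_mult_right_zero[symmetric] using s int[OF P] by (intro integral_mono) auto
  also have "\<dots> = (\<Sum>j<m. measure P (A j)) + 1" using int[OF P] by (simp add: P.prob_space)
  finally have 1: "real m * (\<integral>y. f y \<partial>P) \<le> (\<Sum>j<m. measure P (A j)) + 1" .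
  have "(\<Sum>j<m. measure Q (A j)) = (\<integral>y. s y \<partial>Q)" using int[OF Q] by simp
  also have "\<dots> \<le> real m * (\<integral>y. f y \<partial>Q)"
    unfolding integral_mult_right_zero[symmetric] using s int[OF Q] by (intro integral_mono) auto
  finally have 2: "(\<Sum>j<m. measure Q (A j)) \<le> real m * (\<integral>y. f y \<partial>Q)" .
  have "(\<Sum>j<m. measure P (A j)) - (\<Sum>j<m. measure Q (A j)) = (\<Sum>j<m. measure P (A j) - measure Q (A j))"
    by (simp add: sum_subtractf)
  also have "\<dots> \<le> (\<Sum>j<m. total_variation P Q)"
    using total_variation_upper[OF P(1) Q(1) A] by (intro sum_mono) (auto simp: abs_le_iff)
  finally have "real m * ((\<integral>y. f y \<partial>P) - (\<integral>y. f y \<partial>Q)) \<le> real m * total_variation P Q + 1"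
    using 1 2 by (simp add: algebra_simps)
  then have "(\<integral>y. f y \<partial>P) - (\<integral>y. f y \<partial>Q) \<le> (real m * total_variation P Q + 1) / real m"
    using m by (simp add: field_simps)
  also have "\<dots> = total_variation P Q + 1 / real m" using m by (simp add: field_simps)
  finally show "(\<integral>y. f y \<partial>P) - (\<integral>y. f y \<partial>Q) \<le> total_variation P Q + e" using m(2) by linarith
qed

lemma total_variation_commute: "total_variation P Q = total_variation Q P"
  unfolding total_variation_def by (simp add: abs_minus_commute)

text \<open>Real and imaginary part are estimated separately, and each of them ranges over an interval of
  length two; this makes the factor four.\<close>
lemma cis_integral_diff_le_total_variation:
  assumes P: "prob_space P" "sets P = sets borel" and Q: "prob_space Q" "sets Q = sets borel"
    and \<phi> [measurable]: "\<phi> \<in> borel_measurable borel"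
  shows "norm ((\<integral>y. cis (\<phi> y) \<partial>P) - (\<integral>y. cis (\<phi> y) \<partial>Q)) \<le> 4 * total_variation P Q"
proof -
  have cism: "(\<lambda>y. cis (\<phi> y)) \<in> borel_measurable borel"
    by (rule measurable_compose[OF \<phi>]) (intro borel_measurable_continuous_onI continuous_intros)
  have int: "integrable N (\<lambda>y. cis (\<phi> y))" "prob_space.expectation N (\<lambda>y. (1 + u y) / 2) = (1 + (\<integral>y. u y \<partial>N)) / 2"
    if N: "prob_space N" "sets N = sets borel" and u: "u \<in> borel_measurable borel" "\<And>y. \<bar>u y\<bar> \<le> 1" for N and u :: "real \<Rightarrow> real"
  proof -
    interpret N: prob_space N by (rule N(1))
    note N(2)[measurable_cong]
    show "integrable N (\<lambda>y. cis (\<phi> y))"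
      by (rule N.integrable_const_bound[where B = 1]) (use cism N(2) in \<open>auto cong: measurable_cong_sets\<close>)
    have "integrable N u"
      by (rule N.integrable_const_bound[where B = 1]) (use u N(2) in \<open>auto cong: measurable_cong_sets\<close>)
    then show "(\<integral>y. (1 + u y) / 2 \<partial>N) = (1 + (\<integral>y. u y \<partial>N)) / 2" by (simp add: N.prob_space)
  qed
  have part: "\<bar>(\<integral>y. u y \<partial>P) - (\<integral>y. u y \<partial>Q)\<bar> \<le> 2 * total_variation P Q"
    if u: "u \<in> borel_measurable borel" "\<And>y. \<bar>u y\<bar> \<le> 1" for u :: "real \<Rightarrow> real"
  proof -
    have [measurable]: "u \<in> borel_measurable borel" by (rule u(1))
    have 01: "0 \<le> (1 + u y) / 2" "(1 + u y) / 2 \<le> 1" for y using u(2)[of y] by auto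
    have "(1 + (\<integral>y. u y \<partial>P)) / 2 - (1 + (\<integral>y. u y \<partial>Q)) / 2 \<le> total_variation P Q"
      unfolding int(2)[OF P u, symmetric] int(2)[OF Q u, symmetric]
      by (rule integral_diff_le_total_variation[OF P Q _ 01]) measurable
    moreover have "(1 + (\<integral>y. u y \<partial>Q)) / 2 - (1 + (\<integral>y. u y \<partial>P)) / 2 \<le> total_variation P Q"
      unfolding int(2)[OF P u, symmetric] int(2)[OF Q u, symmetric] total_variation_commute[of P Q]
      by (rule integral_diff_le_total_variation[OF Q P _ 01]) measurable
    ultimately show ?thesis by (auto simp: abs_le_iff field_simps)
  qed
  have c: "(\<lambda>y. cos (\<phi> y)) \<in> borel_measurable borel" "(\<lambda>y. sin (\<phi> y)) \<in> borel_measurable borel" by measurable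
  have zero: "(\<lambda>_. 0 :: real) \<in> borel_measurable borel" "\<And>y::real. \<bar>0 :: real\<bar> \<le> 1" by auto
  note iP = int(1)[OF P zero] and iQ = int(1)[OF Q zero]
  have "norm ((\<integral>y. cis (\<phi> y) \<partial>P) - (\<integral>y. cis (\<phi> y) \<partial>Q)) \<le>
     \<bar>Re ((\<integral>y. cis (\<phi> y) \<partial>P) - (\<integral>y. cis (\<phi> y) \<partial>Q))\<bar> + \<bar>Im ((\<integral>y. cis (\<phi> y) \<partial>P) - (\<integral>y. cis (\<phi> y) \<partial>Q))\<bar>"
    by (rule cmod_le)
  also have "\<dots> = \<bar>(\<integral>y. cos (\<phi> y) \<partial>P) - (\<integral>y. cos (\<phi> y) \<partial>Q)\<bar> + \<bar>(\<integral>y. sin (\<phi> y) \<partial>P) - (\<integral>y. sin (\<phi> y) \<partial>Q)\<bar>"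
    using integral_Re[OF iP] integral_Re[OF iQ] integral_Im[OF iP] integral_Im[OF iQ] by simp
  also have "\<dots> \<le> 2 * total_variation P Q + 2 * total_variation P Q"
    by (intro add_mono part c) auto
  finally show ?thesis by simp
qed

section \<open>The stationary density\<close>

context two_arcs begin

text \<open>The density with mass one whose two arcs add up to the uniform density on the circle and which
  becomes even after multiplication by \<open>exp (-\<nu> v)\<close>. These two properties annihilate the circle
  moments, apart from the zeroth one, and the sine moments.\<close>
definition stationary_density :: "real \<Rightarrow> real" where
  "stationary_density v = indicator {-h<..<h} v * (if 0 \<le> v then 1 - exp (- 2 * \<nu> * (h - v)) else exp (2 * \<nu> * v) - exp (- 2 * \<nu> * h)) / (h * (1 - exp (- 2 * \<nu> * h)))"

lemma density_normalisation_pos: "0 < h * (1 - exp (- 2 * \<nu> * h))"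
  using h \<nu> by simp

lemma stationary_density_nonneg: "0 \<le> stationary_density v"
proof (cases "v \<in> {-h<..<h}")
  case True
  have "0 \<le> (if 0 \<le> v then 1 - exp (- 2 * \<nu> * (h - v)) else exp (2 * \<nu> * v) - exp (- 2 * \<nu> * h))"
  proof (cases "0 \<le> v")
    case t: True
    have "0 \<le> \<nu> * (h - v)" using True \<nu> by (intro mult_nonneg_nonneg) auto
    then show ?thesis using t by simp
  next
    case f: False
    have "\<nu> * (- h) \<le> \<nu> * v" using True \<nu> by (intro mult_left_mono) auto
    then show ?thesis using f by simp
  qed
  then show ?thesis using True density_normalisation_pos unfolding stationary_density_def by simp
qed (simp add: stationary_density_def)

lemma stationary_density_measurable [measurable]: "stationary_density \<in> borel_measurable borel"
  unfolding stationary_density_def by measurable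

lemma stationary_density_integrable: "integrable lborel stationary_density"
proof (rule Bochner_Integration.integrable_bound)
  show "integrable lborel (\<lambda>v. indicator {-h<..<h} v *\<^sub>R (1 / (h * (1 - exp (- 2 * \<nu> * h)))))"
    by (intro integrable_scaleR_left) (auto intro!: integrable_real_indicator simp: emeasure_lborel_Ioo h less_imp_le)
  have "stationary_density v \<le> indicator {-h<..<h} v *\<^sub>R (1 / (h * (1 - exp (- 2 * \<nu> * h))))" for v
  proof -
    have "(if 0 \<le> v then 1 - exp (- 2 * \<nu> * (h - v)) else exp (2 * \<nu> * v) - exp (- 2 * \<nu> * h)) \<le> 1"
    proof (cases "0 \<le> v")
      case False
      then have "2 * \<nu> * v \<le> 0" using \<nu> by (intro mult_nonneg_nonpos) auto
      then have "exp (2 * \<nu> * v) \<le> 1" by simp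
      then have "exp (2 * \<nu> * v) - exp (- 2 * \<nu> * h) \<le> 1" using exp_ge_zero[of "- 2 * \<nu> * h"] by linarith
      then show ?thesis using False by (simp only: if_False)
    qed simp
    then show ?thesis using density_normalisation_pos unfolding stationary_density_def
      by (cases "v \<in> {-h<..<h}") (auto simp del: mult_minus_left intro!: divide_right_mono)
  qed
  then show "AE v in lborel. norm (stationary_density v) \<le> norm (indicator {-h<..<h} v *\<^sub>R (1 / (h * (1 - exp (- 2 * \<nu> * h)))))"
    using stationary_density_nonneg by (intro AE_I2) (simp only: real_norm_def abs_of_nonneg order_trans[OF _ abs_ge_self])
qed measurable

lemma stationary_density_wrap:
  "indicator {-h<..<0} (u - h) * stationary_density (u - h) + indicator {0..<h} u * stationary_density u = indicator {0..<h} u / h"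
proof -
  consider "u = 0" | "u \<in> {0<..<h}" | "u \<notin> {0..<h}" by force
  then show ?thesis
  proof cases
    case 1
    then show ?thesis using density_normalisation_pos h \<nu> by (simp add: stationary_density_def)
  next
    case 2
    let ?c = "1 - exp (- 2 * \<nu> * h)"
    have c: "?c \<noteq> 0" using h \<nu> by simp
    have e: "exp (2 * \<nu> * (u - h)) = exp (- 2 * \<nu> * (h - u))" by (rule arg_cong[of _ _ exp]) (simp add: algebra_simps)
    have "stationary_density (u - h) = (exp (2 * \<nu> * (u - h)) - exp (- 2 * \<nu> * h)) / (h * ?c)"
      "stationary_density u = (1 - exp (- 2 * \<nu> * (h - u))) / (h * ?c)"
      using 2 by (auto simp: stationary_density_def)
    then have "stationary_density (u - h) + stationary_density u = ?c / (h * ?c)"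
      unfolding e by (simp only: add_divide_distrib[symmetric]) (simp add: algebra_simps)
    then show ?thesis using 2 c by simp
  next
    case 3 then show ?thesis by (auto simp: indicator_def)
  qed
qed

lemma circle_mode_measurable [measurable]: "circle_mode n \<in> borel_measurable borel"
  unfolding circle_mode_def by (intro borel_measurable_continuous_onI continuous_intros) (use h in auto)

lemma norm_circle_mode [simp]: "norm (circle_mode n v) = 1"
  by (simp add: circle_mode_def)

lemma sine_mode_measurable [measurable]: "sine_mode k \<in> borel_measurable borel"
  unfolding sine_mode_def by measurable

text \<open>By periodicity the left arc may be shifted onto the right one, where both densities add up to a
  constant.\<close>
lemma stationary_circle_moment:
  "(\<integral>v. stationary_density v *\<^sub>R circle_mode n v \<partial>lborel) = (if n = 0 then 1 else 0)"
proof -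
  have per: "circle_mode n (u - h) = circle_mode n u" for u
  proof -
    have "2 * pi * of_int n * (u - h) / h = 2 * pi * of_int n * u / h + 2 * pi * of_int (- n)"
      using h by (simp add: field_simps)
    then show ?thesis unfolding circle_mode_def
      by (simp only: cis_mult[symmetric]) (simp add: complex_eq_iff cos_integer_2pi sin_integer_2pi)
  qed
  let ?L = "\<lambda>v. (indicator {-h<..<0} v * stationary_density v) *\<^sub>R circle_mode n v"
  let ?R = "\<lambda>v. (indicator {0..<h} v * stationary_density v) *\<^sub>R circle_mode n v"
  have iL: "integrable lborel ?L" and iR: "integrable lborel ?R"
  proof -
    show "integrable lborel ?L"
      by (rule Bochner_Integration.integrable_bound[OF stationary_density_integrable])
         (measurable, auto simp: indicator_def norm_circle_mode)
    show "integrable lborel ?R"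
      by (rule Bochner_Integration.integrable_bound[OF stationary_density_integrable])
         (measurable, auto simp: indicator_def norm_circle_mode)
  qed
  have "(\<integral>v. stationary_density v *\<^sub>R circle_mode n v \<partial>lborel) = (\<integral>v. ?L v + ?R v \<partial>lborel)"
  proof (rule Bochner_Integration.integral_cong[OF refl])
    fix v show "stationary_density v *\<^sub>R circle_mode n v = ?L v + ?R v"
      by (auto simp: indicator_def stationary_density_def)
  qed
  also have "\<dots> = (\<integral>v. ?L v \<partial>lborel) + (\<integral>v. ?R v \<partial>lborel)" by (rule Bochner_Integration.integral_add[OF iL iR])
  also have "(\<integral>v. ?L v \<partial>lborel) = (\<integral>u. ?L (u - h) \<partial>lborel)"
    by (subst lborel_integral_real_affine[where c = 1 and t = "-h"]) (simp_all add: add.commute)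
  also have "\<dots> + (\<integral>v. ?R v \<partial>lborel) = (\<integral>u. ?L (u - h) + ?R u \<partial>lborel)"
  proof (rule Bochner_Integration.integral_add[symmetric, OF _ iR])
    show "integrable lborel (\<lambda>u. ?L (u - h))"
      using lborel_integrable_real_affine[OF iL, of 1 "-h"] by (simp add: add.commute)
  qed
  also have "\<dots> = (\<integral>u. (indicator {0..<h} u / h) *\<^sub>R circle_mode n u \<partial>lborel)"
    unfolding per stationary_density_wrap[symmetric] by (simp add: scaleR_add_left)
  also have "\<dots> = h *\<^sub>R (\<integral>s. (indicator {0..<h} (h * s) / h) *\<^sub>R circle_mode n (h * s) \<partial>lborel)"
    using h by (subst lborel_integral_real_affine[where c = h and t = 0]) auto
  also have "\<dots> = (\<integral>s. indicator {0..<h} (h * s) *\<^sub>R circle_mode n (h * s) \<partial>lborel)"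
    using h by (subst integral_scaleR_right[symmetric]) (simp add: scaleR_scaleR)
  also have "\<dots> = (\<integral>s. indicator {0..1} s *\<^sub>R cis (2 * pi * of_int n * s) \<partial>lborel)"
  proof (rule integral_cong_AE)
    have "AE s in lborel. s \<noteq> (1::real)" by (rule AE_lborel_singleton)
    then show "AE s in lborel. indicator {0..<h} (h * s) *\<^sub>R circle_mode n (h * s) = indicator {0..1} s *\<^sub>R cis (2 * pi * of_int n * s)"
    proof eventually_elim
      case (elim s)
      have "indicator {0..<h} (h * s) = (indicator {0..1} s :: real)"
        using h elim by (auto simp: indicator_def zero_le_mult_iff)
      moreover have "circle_mode n (h * s) = cis (2 * pi * of_int n * s)"
        unfolding circle_mode_def using h by (simp add: mult_ac)
      ultimately show ?case by simp
    qed
    have "(\<lambda>s. cis (2 * pi * of_int n * s)) \<in> borel_measurable borel"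
      by (intro borel_measurable_continuous_onI continuous_intros)
    then show "(\<lambda>s. indicator {0..1} s *\<^sub>R cis (2 * pi * of_int n * s)) \<in> borel_measurable lborel" by simp
  qed measurable
  also have "\<dots> = (if n = 0 then 1 else 0)" by (rule integral_cis_period)
  finally show ?thesis .
qed

text \<open>The integrand is odd.\<close>
lemma stationary_sine_moment: "(\<integral>v. stationary_density v * sine_mode k v \<partial>lborel) = 0"
proof -
  have odd: "stationary_density (- v) * sine_mode k (- v) = - (stationary_density v * sine_mode k v)" for v
  proof -
    have pos: "exp (\<nu> * v) * stationary_density (- v) = exp (- \<nu> * v) * stationary_density v" if "0 < v" for v
    proof (cases "v < h")
      case True
      have "exp (\<nu> * v) * (exp (2 * \<nu> * (- v)) - exp (- 2 * \<nu> * h)) = exp (- \<nu> * v) * (1 - exp (- 2 * \<nu> * (h - v)))"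
        unfolding right_diff_distrib mult_exp_exp by (simp add: algebra_simps)
      then show ?thesis using True that unfolding stationary_density_def by simp
    qed (use that in \<open>auto simp: stationary_density_def\<close>)
    have even: "exp (\<nu> * v) * stationary_density (- v) = exp (- \<nu> * v) * stationary_density v"
    proof -
      consider "0 < v" | "v = 0" | "0 < - v" by linarith
      then show ?thesis
      proof cases
        case 3 then show ?thesis using pos[of "- v"] by simp
      qed (use pos in auto)
    qed
    have "stationary_density (- v) * sine_mode k (- v) = - (exp (\<nu> * v) * stationary_density (- v)) * sin (real k * pi * v / h)"
      by (simp add: sine_mode_def)
    also have "\<dots> = - (stationary_density v * sine_mode k v)" unfolding even by (simp add: sine_mode_def)
    finally show ?thesis .
  qed
  have "(\<integral>v. stationary_density v * sine_mode k v \<partial>lborel) = (\<integral>v. stationary_density (- v) * sine_mode k (- v) \<partial>lborel)"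
    by (subst lborel_integral_real_affine[where c = "-1" and t = 0]) simp_all
  also have "\<dots> = - (\<integral>v. stationary_density v * sine_mode k v \<partial>lborel)" unfolding odd by simp
  finally show ?thesis by simp
qed

definition stationary_law :: "real measure" where
  "stationary_law = density lborel (\<lambda>v. ennreal (stationary_density v))"

lemma stationary_law:
  shows "prob_space stationary_law" "sets stationary_law = sets borel" "AE v in stationary_law. v \<in> {-h<..<h}"
    and "(\<integral>v. circle_mode n v \<partial>stationary_law) = (if n = 0 then 1 else 0)"
    and "(\<integral>v. sine_mode k v \<partial>stationary_law) = 0"
proof -
  have "complex_of_real (\<integral>v. stationary_density v \<partial>lborel) = 1"
    using stationary_circle_moment[of 0] by (simp add: circle_mode_def scaleR_conv_of_real)
  then have "(\<integral>v. stationary_density v \<partial>lborel) = 1" by (simp only: of_real_eq_1_iff)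
  then have "(\<integral>\<^sup>+v. ennreal (stationary_density v) \<partial>lborel) = 1"
    using stationary_density_nonneg by (subst nn_integral_eq_integral[OF stationary_density_integrable]) auto
  then show "prob_space stationary_law"
    unfolding stationary_law_def by (intro prob_spaceI) (simp add: emeasure_density)
  show "sets stationary_law = sets borel" by (simp add: stationary_law_def)
  show "AE v in stationary_law. v \<in> {-h<..<h}"
    unfolding stationary_law_def by (subst AE_density) (auto simp: stationary_density_def indicator_def)
  show "(\<integral>v. circle_mode n v \<partial>stationary_law) = (if n = 0 then 1 else 0)"
    unfolding stationary_law_def using stationary_circle_moment[of n] stationary_density_nonneg
    by (subst integral_density) auto
  show "(\<integral>v. sine_mode k v \<partial>stationary_law) = 0"
    unfolding stationary_law_def using stationary_sine_moment[of k] stationary_density_nonneg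
    by (subst integral_density) auto
qed

end

section \<open>Kernels that multiply every mode by an exponential\<close>

context two_arcs begin

lemma sine_mode_bound:
  assumes "v \<in> {-h<..<h}" shows "\<bar>sine_mode k v\<bar> \<le> exp (\<nu> * h)"
proof -
  have "\<nu> * (- v) \<le> \<nu> * h" using assms \<nu> by (intro mult_left_mono) auto
  then have "exp (- \<nu> * v) * \<bar>sin (real k * pi * v / h)\<bar> \<le> exp (\<nu> * h) * 1"
    by (intro mult_mono) auto
  then show ?thesis by (simp add: sine_mode_def abs_mult)
qed

lemma circle_mode_lipschitz: "norm (circle_mode n v - circle_mode n w) \<le> 2 * pi * \<bar>of_int n\<bar> / h * \<bar>v - w\<bar>"
proof -
  define \<alpha> where "\<alpha> = 2 * pi * of_int n * (v - w) / h"
  have "circle_mode n v - circle_mode n w = circle_mode n w * (exp (\<i> * of_real \<alpha>) - 1)"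
    unfolding circle_mode_def right_diff_distrib cis_conv_exp[symmetric] cis_mult \<alpha>_def
    by (simp add: diff_divide_distrib algebra_simps)
  then have "norm (circle_mode n v - circle_mode n w) = 2 * \<bar>sin (\<alpha> / 2)\<bar>"
    by (simp only: norm_mult norm_circle_mode dist_exp_i_1)
  also have "\<dots> \<le> \<bar>\<alpha>\<bar>" using abs_sin_x_le_abs_x[of "\<alpha> / 2"] by simp
  also have "\<dots> = 2 * pi * \<bar>of_int n\<bar> / h * \<bar>v - w\<bar>" unfolding \<alpha>_def using h by (simp add: abs_mult)
  finally show ?thesis .
qed

lemma sine_mode_lipschitz:
  assumes "v \<in> {-h<..<h}" "w \<in> {-h<..<h}"
  shows "\<bar>sine_mode k v - sine_mode k w\<bar> \<le> exp (\<nu> * h) * (\<nu> + real k * pi / h) * \<bar>v - w\<bar>"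
proof -
  let ?c = "real k * pi / h"
  have "norm (sine_mode k v - sine_mode k w) \<le> exp (\<nu> * h) * (\<nu> + ?c) * norm (v - w)"
  proof (rule field_differentiable_bound[OF _ _ _ assms(1,2)])
    show "convex {-h<..<h}" by simp
    fix z assume z: "z \<in> {-h<..<h}"
    show "(sine_mode k has_field_derivative exp (- \<nu> * z) * (?c * cos (real k * pi * z / h) - \<nu> * sin (real k * pi * z / h))) (at z within {-h<..<h})"
      unfolding sine_mode_def[abs_def] using h by (auto intro!: derivative_eq_intros simp: field_simps)
    have "\<bar>?c * cos (real k * pi * z / h) - \<nu> * sin (real k * pi * z / h)\<bar> \<le> ?c * 1 + \<nu> * 1"
    proof (rule order_trans[OF abs_triangle_ineq4 add_mono])
      show "\<bar>?c * cos (real k * pi * z / h)\<bar> \<le> ?c * 1"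
        unfolding abs_mult using h by (intro mult_mono) auto
      show "\<bar>\<nu> * sin (real k * pi * z / h)\<bar> \<le> \<nu> * 1"
        unfolding abs_mult using \<nu> by (intro mult_mono) auto
    qed
    moreover have "\<nu> * (- z) \<le> \<nu> * h" using z \<nu> by (intro mult_left_mono) auto
    ultimately show "norm (exp (- \<nu> * z) * (?c * cos (real k * pi * z / h) - \<nu> * sin (real k * pi * z / h))) \<le> exp (\<nu> * h) * (\<nu> + ?c)"
      unfolding norm_mult by (intro mult_mono) auto
  qed
  then show ?thesis by simp
qed

end

text \<open>The transition laws \<open>P x t\<close> enter the analysis only through their moments: every circle mode and every
  sine mode is multiplied by an exponential in \<open>t\<close>. The hypothesis \<open>\<gamma> \<le> \<kappa>\<close> says that no sine mode
  decays more slowly than the first circle mode.\<close>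
locale mode_kernel = two_arcs h \<nu> for h \<nu> :: real +
  fixes x\<^sub>0 \<gamma> \<kappa> \<beta> :: real and P :: "real \<Rightarrow> real \<Rightarrow> real measure"
  assumes \<gamma>: "0 < \<gamma>" and \<kappa>: "\<gamma> \<le> \<kappa>"
    and P_prob: "\<And>x t. x \<in> {x\<^sub>0 - h<..<x\<^sub>0 + h} \<Longrightarrow> 0 \<le> t \<Longrightarrow> prob_space (P x t)"
    and P_sets: "\<And>x t. x \<in> {x\<^sub>0 - h<..<x\<^sub>0 + h} \<Longrightarrow> 0 \<le> t \<Longrightarrow> sets (P x t) = sets borel"
    and P_mem: "\<And>x t. x \<in> {x\<^sub>0 - h<..<x\<^sub>0 + h} \<Longrightarrow> 0 \<le> t \<Longrightarrow> AE y in P x t. y \<in> {x\<^sub>0 - h<..<x\<^sub>0 + h}"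
    and P_0: "\<And>x. x \<in> {x\<^sub>0 - h<..<x\<^sub>0 + h} \<Longrightarrow> P x 0 = return borel x"
    and P_circle: "\<And>x t n. x \<in> {x\<^sub>0 - h<..<x\<^sub>0 + h} \<Longrightarrow> 0 \<le> t \<Longrightarrow>
       (\<integral>y. circle_mode n (y - x\<^sub>0) \<partial>P x t) = exp (- Complex (\<gamma> * (of_int n)\<^sup>2) (\<beta> * of_int n) * of_real t) * circle_mode n (x - x\<^sub>0)"
    and P_sine: "\<And>x t k. x \<in> {x\<^sub>0 - h<..<x\<^sub>0 + h} \<Longrightarrow> 0 \<le> t \<Longrightarrow>
       (\<integral>y. sine_mode k (y - x\<^sub>0) \<partial>P x t) = exp (- (\<gamma> * (real k)\<^sup>2 / 4 + \<kappa>) * t) * sine_mode k (x - x\<^sub>0)"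
begin

abbreviation I :: "real set" where "I \<equiv> {x\<^sub>0 - h<..<x\<^sub>0 + h}"

abbreviation circle_moment :: "int \<Rightarrow> real measure \<Rightarrow> complex" where
  "circle_moment n \<rho> \<equiv> (\<integral>y. circle_mode n (y - x\<^sub>0) \<partial>\<rho>)"

abbreviation sine_moment :: "nat \<Rightarrow> real measure \<Rightarrow> real" where
  "sine_moment k \<rho> \<equiv> (\<integral>y. sine_mode k (y - x\<^sub>0) \<partial>\<rho>)"

abbreviation circle_decay :: "int \<Rightarrow> real \<Rightarrow> complex" where
  "circle_decay n t \<equiv> exp (- Complex (\<gamma> * (of_int n)\<^sup>2) (\<beta> * of_int n) * of_real t)"

abbreviation sine_decay :: "nat \<Rightarrow> real \<Rightarrow> real" where
  "sine_decay k t \<equiv> exp (- (\<gamma> * (real k)\<^sup>2 / 4 + \<kappa>) * t)"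

definition carried :: "real measure \<Rightarrow> bool" where
  "carried \<rho> \<longleftrightarrow> prob_space \<rho> \<and> sets \<rho> = sets borel \<and> (AE y in \<rho>. y \<in> I)"

lemma P_carried: "x \<in> I \<Longrightarrow> 0 \<le> t \<Longrightarrow> carried (P x t)"
  unfolding carried_def using P_prob P_sets P_mem by blast

lemma midpoint_mem: "x\<^sub>0 \<in> I" using h by simp

text \<open>\<open>moment_distance\<close>, transported from arcs centred at the origin to arcs centred at \<open>x\<^sub>0\<close>.\<close>
lemma distance_from_moments:
  assumes \<rho>: "carried \<rho>" and \<rho>': "carried \<rho>'" and r: "0 < r" "r < 1"
    and c: "\<And>n. norm (circle_moment n \<rho> - circle_moment n \<rho>') \<le> K * r ^ nat \<bar>n\<bar>"
    and s: "\<And>k. \<bar>sine_moment k \<rho> - sine_moment k \<rho>'\<bar> \<le> K * r ^ k"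
    and A: "A \<in> sets borel"
  shows "\<bar>measure \<rho> A - measure \<rho>' A\<bar> \<le> distance_const r * K"
proof -
  let ?S = "\<lambda>\<rho>. distr \<rho> borel (\<lambda>y. y - x\<^sub>0)"
  have S: "prob_space (?S \<rho>)" "sets (?S \<rho>) = sets borel" "AE v in ?S \<rho>. v \<in> {-h<..<h}"
      "(\<integral>v. circle_mode n v \<partial>?S \<rho>) = circle_moment n \<rho>"
      "(\<integral>v. sine_mode k v \<partial>?S \<rho>) = sine_moment k \<rho>"
      "measure (?S \<rho>) ((\<lambda>v. v + x\<^sub>0) -` A) = measure \<rho> A"
    if "carried \<rho>" for \<rho> n k
  proof -
    interpret prob_space \<rho> using that by (simp add: carried_def)
    have [measurable_cong]: "sets \<rho> = sets borel" using that by (simp add: carried_def)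
    show "prob_space (?S \<rho>)" by (rule prob_space_distr) measurable
    show "sets (?S \<rho>) = sets borel" by simp
    show "AE v in ?S \<rho>. v \<in> {-h<..<h}"
      using that unfolding carried_def by (subst AE_distr_iff) (auto elim!: AE_mp)
    show "(\<integral>v. circle_mode n v \<partial>?S \<rho>) = circle_moment n \<rho>"
      by (rule integral_distr) measurable
    show "(\<integral>v. sine_mode k v \<partial>?S \<rho>) = sine_moment k \<rho>"
      by (rule integral_distr) measurable
    have "(\<lambda>y. y - x\<^sub>0) -` ((\<lambda>v. v + x\<^sub>0) -` A) \<inter> space \<rho> = A"
      using sets_eq_imp_space_eq[OF \<open>sets \<rho> = sets borel\<close>] by auto
    moreover have "(\<lambda>v. v + x\<^sub>0) -` A \<in> sets borel"
      using measurable_sets[of "\<lambda>v. v + x\<^sub>0" borel borel A] A by simp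
    ultimately show "measure (?S \<rho>) ((\<lambda>v. v + x\<^sub>0) -` A) = measure \<rho> A"
      by (subst measure_distr) auto
  qed
  have A': "(\<lambda>v. v + x\<^sub>0) -` A \<in> sets borel"
    using measurable_sets[of "\<lambda>v. v + x\<^sub>0" borel borel A] A by simp
  show ?thesis
    using moment_distance[OF S(1-3)[OF \<rho>] S(1-3)[OF \<rho>'] r _ _ A', of K] c s
    by (simp only: S(4-6)[OF \<rho>] S(4-6)[OF \<rho>'])
qed

lemma equal_from_moments:
  assumes \<rho>: "carried \<rho>" and \<rho>': "carried \<rho>'"
    and c: "\<And>n. circle_moment n \<rho> = circle_moment n \<rho>'"
    and s: "\<And>k. sine_moment k \<rho> = sine_moment k \<rho>'"
  shows "\<rho> = \<rho>'"
proof (rule measure_eqI)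
  show "sets \<rho> = sets \<rho>'" using \<rho> \<rho>' by (simp add: carried_def)
  fix A assume "A \<in> sets \<rho>"
  then have "A \<in> sets borel" using \<rho> by (simp add: carried_def)
  then have "\<bar>measure \<rho> A - measure \<rho>' A\<bar> \<le> distance_const (1/2) * 0"
    by (intro distance_from_moments[OF \<rho> \<rho>']) (use c s in auto)
  then show "emeasure \<rho> A = emeasure \<rho>' A"
    using \<rho> \<rho>' by (simp add: carried_def prob_space_def finite_measure.emeasure_eq_measure)
qed

lemma norm_circle_decay: "norm (circle_decay n t) = exp (- \<gamma> * (of_int n)\<^sup>2 * t)"
  by (simp add: norm_exp_eq_Re)

lemma abs_le_square: "\<bar>of_int n\<bar> \<le> ((of_int n)\<^sup>2 :: real)"
proof -
  have "\<bar>n\<bar> \<le> n\<^sup>2" using self_le_power[of "\<bar>n\<bar>" 2] by (cases "n = 0") auto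
  then have "(of_int \<bar>n\<bar> :: real) \<le> of_int (n\<^sup>2)" by (simp only: of_int_le_iff)
  then show ?thesis by simp
qed

lemma self_le_exp: "(u :: real) \<le> exp u"
  using exp_ge_add_one_self[of u] by linarith

text \<open>The modes are Lipschitz functions of the starting point with constants that grow linearly in the
  index, whereas their decay by time \<open>t\<close> is Gaussian in the index. Lipschitz continuity is what makes
  \<open>x \<mapsto> P x t\<close> a measurable kernel.\<close>
lemma P_lipschitz:
  assumes t: "0 < t" and A: "A \<in> sets borel"
  shows "\<exists>L. \<forall>x\<in>I. \<forall>x'\<in>I. \<bar>measure (P x t) A - measure (P x' t) A\<bar> \<le> L * \<bar>x - x'\<bar>"
proof -
  \<comment> \<open>half of the slowest exponential rate per index, which leaves room to absorb linear factors\<close>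
  define r where "r = exp (- (\<gamma> * t / 8))"
  have r: "0 < r" "r < 1" using \<gamma> t by (auto simp: r_def)
  have r_pow: "r ^ k = exp (- (\<gamma> * t / 8) * real k)" for k
    unfolding r_def by (simp add: exp_of_nat_mult[symmetric] mult.commute)
  define D where "D = 8 / (\<gamma> * t)"
  have D: "0 < D" using \<gamma> t by (simp add: D_def)
  \<comment> \<open>a linear factor is absorbed by part of the exponential decay\<close>
  have absorb: "real k * exp (- \<gamma> * q * t) \<le> D * r ^ k" if "real k / 4 \<le> q" for k q
  proof -
    define u where "u = \<gamma> * t / 8 * real k"
    have "real k = D * u" unfolding u_def D_def using \<gamma> t by simp
    also have "\<dots> \<le> D * exp u" using D self_le_exp by (intro mult_left_mono) auto
    finally have k: "real k \<le> D * exp u" .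
    have "\<gamma> * t * (real k / 4) \<le> \<gamma> * t * q" using that \<gamma> t by (intro mult_left_mono) auto
    then have "exp (- \<gamma> * q * t) \<le> exp (- (2 * u))" unfolding u_def by (simp add: algebra_simps)
    then have "real k * exp (- \<gamma> * q * t) \<le> (D * exp u) * exp (- (2 * u))"
      using k D by (intro mult_mono) auto
    also have "\<dots> = D * r ^ k" unfolding r_pow mult.assoc mult_exp_exp u_def by simp
    finally show ?thesis .
  qed
  define L1 where "L1 = D * (2 * pi / h)"
  define L2 where "L2 = exp (\<nu> * h) * (\<nu> + D * (pi / h))"
  have L: "0 \<le> L1" "0 \<le> L2" using D h \<nu> by (auto simp: L1_def L2_def)
  have "\<bar>measure (P x t) A - measure (P x' t) A\<bar> \<le> distance_const r * ((L1 + L2) * \<bar>x - x'\<bar>)"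
    if x: "x \<in> I" and x': "x' \<in> I" for x x'
  proof (rule distance_from_moments[OF P_carried[OF x less_imp_le[OF t]] P_carried[OF x' less_imp_le[OF t]] r _ _ A])
    fix n :: int
    have "norm (circle_moment n (P x t) - circle_moment n (P x' t)) =
       exp (- \<gamma> * (of_int n)\<^sup>2 * t) * norm (circle_mode n (x - x\<^sub>0) - circle_mode n (x' - x\<^sub>0))"
      unfolding P_circle[OF x less_imp_le[OF t]] P_circle[OF x' less_imp_le[OF t]] right_diff_distrib[symmetric] norm_mult norm_circle_decay ..
    also have "\<dots> \<le> exp (- \<gamma> * (of_int n)\<^sup>2 * t) * (2 * pi * \<bar>of_int n\<bar> / h * \<bar>x - x'\<bar>)"
      using circle_mode_lipschitz[of n "x - x\<^sub>0" "x' - x\<^sub>0"] by (intro mult_left_mono) auto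
    also have "\<dots> = (real (nat \<bar>n\<bar>) * exp (- \<gamma> * (of_int n)\<^sup>2 * t)) * (2 * pi / h * \<bar>x - x'\<bar>)"
      by simp
    also have "\<dots> \<le> (D * r ^ nat \<bar>n\<bar>) * (2 * pi / h * \<bar>x - x'\<bar>)"
      using h abs_le_square[of n] by (intro mult_right_mono absorb) auto
    also have "\<dots> = (L1 * \<bar>x - x'\<bar>) * r ^ nat \<bar>n\<bar>" by (simp add: L1_def)
    also have "\<dots> \<le> ((L1 + L2) * \<bar>x - x'\<bar>) * r ^ nat \<bar>n\<bar>"
      using L r by (intro mult_right_mono) auto
    finally show "norm (circle_moment n (P x t) - circle_moment n (P x' t)) \<le> ((L1 + L2) * \<bar>x - x'\<bar>) * r ^ nat \<bar>n\<bar>" .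
  next
    fix k :: nat
    let ?e = "sine_decay k t"
    have k2: "real k \<le> (real k)\<^sup>2" using abs_le_square[of "int k"] by simp
    have "0 \<le> \<kappa> * t" using \<gamma> \<kappa> t by simp
    then have e: "?e \<le> exp (- \<gamma> * ((real k)\<^sup>2 / 4) * t)" by (simp add: algebra_simps)
    have e1: "real k * ?e \<le> D * r ^ k"
      by (rule order_trans[OF mult_left_mono[OF e]], simp, rule absorb, use k2 in simp)
    have e2: "?e \<le> r ^ k"
    proof (rule order_trans[OF e])
      have "real k / 8 \<le> (real k)\<^sup>2 / 4" using k2 zero_le_power2[of "real k"] by linarith
      then have "\<gamma> * t * (real k / 8) \<le> \<gamma> * t * ((real k)\<^sup>2 / 4)" using \<gamma> t by (intro mult_left_mono) auto
      then show "exp (- \<gamma> * ((real k)\<^sup>2 / 4) * t) \<le> r ^ k" unfolding r_pow by (simp add: algebra_simps)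
    qed
    have "\<bar>sine_moment k (P x t) - sine_moment k (P x' t)\<bar> =
       ?e * \<bar>sine_mode k (x - x\<^sub>0) - sine_mode k (x' - x\<^sub>0)\<bar>"
      unfolding P_sine[OF x less_imp_le[OF t]] P_sine[OF x' less_imp_le[OF t]] right_diff_distrib[symmetric] abs_mult by simp
    also have "\<dots> \<le> ?e * (exp (\<nu> * h) * (\<nu> + real k * pi / h) * \<bar>x - x'\<bar>)"
      using sine_mode_lipschitz[of "x - x\<^sub>0" "x' - x\<^sub>0" k] x x' by (intro mult_left_mono) auto
    also have "\<dots> = (exp (\<nu> * h) * \<bar>x - x'\<bar>) * (\<nu> * ?e + (real k * ?e) * (pi / h))"
      by (simp add: algebra_simps)
    also have "\<dots> \<le> (exp (\<nu> * h) * \<bar>x - x'\<bar>) * (\<nu> * r ^ k + (D * r ^ k) * (pi / h))"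
      using e1 e2 \<nu> h by (intro mult_left_mono add_mono mult_right_mono) auto
    also have "\<dots> = (L2 * \<bar>x - x'\<bar>) * r ^ k" by (simp add: L2_def algebra_simps)
    also have "\<dots> \<le> ((L1 + L2) * \<bar>x - x'\<bar>) * r ^ k"
      using L r by (intro mult_right_mono) auto
    finally show "\<bar>sine_moment k (P x t) - sine_moment k (P x' t)\<bar> \<le> ((L1 + L2) * \<bar>x - x'\<bar>) * r ^ k" .
  qed
  then show ?thesis by (intro exI[of _ "distance_const r * (L1 + L2)"]) (simp add: mult.assoc)
qed

text \<open>The value outside the arcs is an arbitrary law, chosen so that the kernel is total.\<close>
definition kernel :: "real \<Rightarrow> real \<Rightarrow> real measure" where
  "kernel t x = (if x \<in> I then P x t else return borel x\<^sub>0)"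

lemma kernel_prob: "0 \<le> t \<Longrightarrow> prob_space (kernel t x)"
  by (auto simp: kernel_def P_prob intro: prob_space_return)

lemma kernel_sets: "0 \<le> t \<Longrightarrow> sets (kernel t x) = sets borel"
  using P_sets by (simp add: kernel_def)

lemma kernel_measurable:
  assumes t: "0 < t"
  shows "kernel t \<in> measurable borel (subprob_algebra borel)"
proof (rule measurable_subprob_algebra)
  fix x
  show "subprob_space (kernel t x)" using t by (intro prob_space_imp_subprob_space kernel_prob) simp
  show "sets (kernel t x) = sets borel" using t by (intro kernel_sets) simp
next
  fix A :: "real set" assume A: "A \<in> sets borel"
  obtain L where L: "\<And>x x'. x \<in> I \<Longrightarrow> x' \<in> I \<Longrightarrow> \<bar>measure (P x t) A - measure (P x' t) A\<bar> \<le> L * \<bar>x - x'\<bar>"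
    using P_lipschitz[OF t A] by blast
  have "continuous_on I (\<lambda>x. measure (P x t) A)"
    unfolding continuous_on_iff
  proof (intro ballI allI impI)
    fix x e :: real assume x: "x \<in> I" and e: "0 < e"
    show "\<exists>d>0. \<forall>x'\<in>I. dist x' x < d \<longrightarrow> dist (measure (P x' t) A) (measure (P x t) A) < e"
    proof (intro exI[of _ "e / (\<bar>L\<bar> + 1)"] conjI ballI impI)
      show "0 < e / (\<bar>L\<bar> + 1)" using e by simp
      fix x' assume x': "x' \<in> I" and d: "dist x' x < e / (\<bar>L\<bar> + 1)"
      have "dist (measure (P x' t) A) (measure (P x t) A) \<le> L * \<bar>x' - x\<bar>"
        using L[OF x' x] by (simp add: dist_real_def)
      also have "\<dots> \<le> (\<bar>L\<bar> + 1) * \<bar>x' - x\<bar>" by (intro mult_right_mono) auto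
      also have "\<dots> < (\<bar>L\<bar> + 1) * (e / (\<bar>L\<bar> + 1))" using d by (intro mult_strict_left_mono) (auto simp: dist_real_def)
      also have "\<dots> = e" by simp
      finally show "dist (measure (P x' t) A) (measure (P x t) A) < e" .
    qed
  qed
  then have [measurable]: "(\<lambda>x. if x \<in> I then measure (P x t) A else indicator A x\<^sub>0) \<in> borel_measurable borel"
    by (intro borel_measurable_continuous_on_if) auto
  have eq: "emeasure (kernel t x) A = ennreal (if x \<in> I then measure (P x t) A else indicator A x\<^sub>0)" for x
  proof (cases "x \<in> I")
    case True
    interpret prob_space "P x t" using t True by (intro P_prob) auto
    show ?thesis using True by (simp add: kernel_def emeasure_eq_measure)
  next
    case False
    then show ?thesis using A by (simp only: kernel_def if_False) (simp add: ennreal_indicator)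
  qed
  show "(\<lambda>x. emeasure (kernel t x) A) \<in> borel_measurable borel" unfolding eq by measurable
qed

text \<open>The law at time \<open>t\<close> for the initial law \<open>\<rho>\<close>. Its modes are those of \<open>\<rho>\<close> multiplied by the decay
  factors, by integrating the moment identities over the starting point.\<close>
lemma evolved_law:
  assumes t: "0 < t" and \<rho>: "carried \<rho>"
  shows "carried (\<rho> \<bind> kernel t)"
    and "A \<in> sets borel \<Longrightarrow> emeasure (\<rho> \<bind> kernel t) A = (\<integral>\<^sup>+x\<in>I. emeasure (P x t) A \<partial>\<rho>)"
    and "circle_moment n (\<rho> \<bind> kernel t) = circle_decay n t * circle_moment n \<rho>"
    and "sine_moment k (\<rho> \<bind> kernel t) = sine_decay k t * sine_moment k \<rho>"
proof -
  interpret prob_space \<rho> using \<rho> by (simp add: carried_def)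
  have \<rho>_sets [measurable_cong]: "sets \<rho> = sets borel" using \<rho> by (simp add: carried_def)
  have \<rho>I: "AE y in \<rho>. y \<in> I" using \<rho> by (simp add: carried_def)
  have ne: "space \<rho> \<noteq> {}" by (rule not_empty)
  have Km: "kernel t \<in> measurable \<rho> (subprob_algebra borel)"
    using kernel_measurable[OF t] by (simp cong: measurable_cong_sets add: \<rho>_sets)
  have t0: "0 \<le> t" using t by simp
  let ?E = "\<rho> \<bind> kernel t"
  have E_sets: "sets ?E = sets borel" by (rule sets_bind[OF sets_kernel[OF Km] ne])
  have em: "emeasure ?E A = (\<integral>\<^sup>+x\<in>I. emeasure (P x t) A \<partial>\<rho>)" if A: "A \<in> sets borel" for A
  proof -
    have "emeasure ?E A = (\<integral>\<^sup>+x. emeasure (kernel t x) A \<partial>\<rho>)" by (rule emeasure_bind[OF ne Km A])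
    also have "\<dots> = (\<integral>\<^sup>+x\<in>I. emeasure (P x t) A \<partial>\<rho>)"
    proof (rule nn_integral_cong_AE)
      show "AE x in \<rho>. emeasure (kernel t x) A = emeasure (P x t) A * indicator I x"
        using \<rho>I by eventually_elim (simp add: kernel_def)
    qed
    finally show ?thesis .
  qed
  then show "A \<in> sets borel \<Longrightarrow> emeasure ?E A = (\<integral>\<^sup>+x\<in>I. emeasure (P x t) A \<partial>\<rho>)" .
  have E_full: "emeasure ?E B = 1" if B: "B \<in> sets borel" "I \<subseteq> B" for B
  proof -
    have "emeasure ?E B = (\<integral>\<^sup>+x. 1 \<partial>\<rho>)"
      unfolding em[OF B(1)]
    proof (rule nn_integral_cong_AE)
      show "AE x in \<rho>. emeasure (P x t) B * indicator I x = 1"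
        using \<rho>I
      proof eventually_elim
        case (elim x)
        interpret Px: prob_space "P x t" by (rule P_prob[OF elim t0])
        have "AE y in P x t. y \<in> B" using P_mem[OF elim t0] by eventually_elim (use B in auto)
        then have "emeasure (P x t) B = 1"
          using B P_sets[OF elim t0] by (intro Px.emeasure_eq_1_AE) auto
        then show ?case using elim by simp
      qed
    qed
    then show ?thesis by (simp add: emeasure_space_1)
  qed
  interpret E: prob_space ?E
    by (rule prob_spaceI) (use E_full[of UNIV] sets_eq_imp_space_eq[OF E_sets] in simp)
  have EI: "AE y in ?E. y \<in> I"
  proof (rule E.AE_prob_1)
    have "I \<in> sets borel" by simp
    then have "emeasure ?E I = 1" by (rule E_full) simp
    then show "E.prob I = 1" by (simp add: E.emeasure_eq_measure)
  qed
  show "carried ?E" unfolding carried_def using E_sets EI E.prob_space_axioms by simp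
  have ib: "(\<integral>y. f y \<partial>?E) = (\<integral>x. (\<integral>y. f y \<partial>kernel t x) \<partial>\<rho>)"
    if f: "f \<in> borel_measurable borel" "\<And>y. \<bar>f y\<bar> \<le> C" for f :: "real \<Rightarrow> real" and C
  proof (rule integral_bind[OF f(1) _ Km, where B' = 1])
    show "finite_measure \<rho>" by unfold_locales
    show "AE x in \<rho>. emeasure (kernel t x) (space (kernel t x)) \<le> ennreal 1"
      using prob_space.emeasure_space_1[OF kernel_prob[OF t0]] by (intro AE_I2) simp
  qed (use f in auto)
  show "circle_moment n ?E = circle_decay n t * circle_moment n \<rho>"
  proof -
    let ?c = "circle_decay n t"
    have int: "integrable N (\<lambda>y. circle_mode n (y - x\<^sub>0))" if "prob_space N" "sets N = sets borel" for N
    proof -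
      interpret N: prob_space N by (rule that(1))
      note that(2)[measurable_cong]
      show ?thesis by (rule N.integrable_const_bound[where B = 1]) auto
    qed
    have iE: "integrable ?E (\<lambda>y. circle_mode n (y - x\<^sub>0))" by (rule int[OF E.prob_space_axioms E_sets])
    have i\<rho>: "integrable \<rho> (\<lambda>y. ?c * circle_mode n (y - x\<^sub>0))"
      by (rule integrable_mult_right[OF int[OF prob_space_axioms \<rho>_sets]])
    have inner: "AE x in \<rho>. circle_moment n (kernel t x) = ?c * circle_mode n (x - x\<^sub>0)"
      using \<rho>I by eventually_elim (simp add: kernel_def P_circle[OF _ t0])
    have iK: "integrable (kernel t x) (\<lambda>y. circle_mode n (y - x\<^sub>0))" for x
      by (rule int[OF kernel_prob[OF t0] kernel_sets[OF t0]])
    have part: "(\<integral>y. \<Phi> (circle_mode n (y - x\<^sub>0)) \<partial>?E) = (\<integral>x. \<Phi> (?c * circle_mode n (x - x\<^sub>0)) \<partial>\<rho>)"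
      if \<Phi>: "\<Phi> \<in> borel_measurable borel" "\<And>z. \<bar>\<Phi> z\<bar> \<le> norm z"
        "\<And>x. (\<integral>y. \<Phi> (circle_mode n (y - x\<^sub>0)) \<partial>kernel t x) = \<Phi> (circle_moment n (kernel t x))"
      for \<Phi> :: "complex \<Rightarrow> real"
    proof -
      have m: "(\<lambda>y. \<Phi> (circle_mode n (y - x\<^sub>0))) \<in> borel_measurable borel" using \<Phi>(1) by measurable
      have "(\<integral>y. \<Phi> (circle_mode n (y - x\<^sub>0)) \<partial>?E) = (\<integral>x. (\<integral>y. \<Phi> (circle_mode n (y - x\<^sub>0)) \<partial>kernel t x) \<partial>\<rho>)"
        by (rule ib[OF m, of 1]) (use \<Phi>(2)[of "circle_mode n _"] in auto)
      also have "\<dots> = (\<integral>x. \<Phi> (?c * circle_mode n (x - x\<^sub>0)) \<partial>\<rho>)"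
      proof (rule integral_cong_AE)
        show "AE x in \<rho>. (\<integral>y. \<Phi> (circle_mode n (y - x\<^sub>0)) \<partial>kernel t x) = \<Phi> (?c * circle_mode n (x - x\<^sub>0))"
          using inner by eventually_elim (simp add: \<Phi>(3))
        show "(\<lambda>x. \<integral>y. \<Phi> (circle_mode n (y - x\<^sub>0)) \<partial>kernel t x) \<in> borel_measurable \<rho>"
          using m by (intro measurable_compose[OF Km integral_measurable_subprob_algebra]) auto
        show "(\<lambda>x. \<Phi> (?c * circle_mode n (x - x\<^sub>0))) \<in> borel_measurable \<rho>" using \<Phi>(1) by measurable
      qed
      finally show ?thesis .
    qed
    have "circle_moment n ?E = (\<integral>x. ?c * circle_mode n (x - x\<^sub>0) \<partial>\<rho>)"
    proof (rule complex_eqI)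
      show "Re (circle_moment n ?E) = Re (\<integral>x. ?c * circle_mode n (x - x\<^sub>0) \<partial>\<rho>)"
        unfolding integral_Re[OF iE, symmetric] integral_Re[OF i\<rho>, symmetric]
        by (rule part) (auto simp: abs_Re_le_cmod integral_Re[OF iK])
      show "Im (circle_moment n ?E) = Im (\<integral>x. ?c * circle_mode n (x - x\<^sub>0) \<partial>\<rho>)"
        unfolding integral_Im[OF iE, symmetric] integral_Im[OF i\<rho>, symmetric]
        by (rule part) (auto simp: abs_Im_le_cmod integral_Im[OF iK])
    qed
    then show ?thesis by simp
  qed
  show "sine_moment k ?E = sine_decay k t * sine_moment k \<rho>"
  proof -
    let ?c = "sine_decay k t"
    \<comment> \<open>sine modes are unbounded outside the arcs, where no law has mass\<close>
    define f where "f y = indicator I y * sine_mode k (y - x\<^sub>0)" for y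
    have fm [measurable]: "f \<in> borel_measurable borel" unfolding f_def by measurable
    have fb: "\<bar>f y\<bar> \<le> exp (\<nu> * h)" for y
      unfolding f_def using sine_mode_bound[of "y - x\<^sub>0" k] by (cases "y \<in> I") auto
    have eq: "(\<integral>y. f y \<partial>N) = sine_moment k N" if "sets N = sets borel" "AE y in N. y \<in> I" for N
    proof (rule integral_cong_AE)
      note that(1)[measurable_cong]
      show "f \<in> borel_measurable N" "(\<lambda>y. sine_mode k (y - x\<^sub>0)) \<in> borel_measurable N" by measurable
      show "AE y in N. f y = sine_mode k (y - x\<^sub>0)" using that(2) by eventually_elim (simp add: f_def)
    qed
    have "sine_moment k ?E = (\<integral>y. f y \<partial>?E)" by (rule eq[OF E_sets EI, symmetric])
    also have "\<dots> = (\<integral>x. (\<integral>y. f y \<partial>kernel t x) \<partial>\<rho>)" by (rule ib[OF fm fb])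
    also have "\<dots> = (\<integral>x. ?c * sine_mode k (x - x\<^sub>0) \<partial>\<rho>)"
    proof (rule integral_cong_AE)
      show "(\<lambda>x. \<integral>y. f y \<partial>kernel t x) \<in> borel_measurable \<rho>"
        by (intro measurable_compose[OF Km integral_measurable_subprob_algebra]) auto
      show "AE x in \<rho>. (\<integral>y. f y \<partial>kernel t x) = ?c * sine_mode k (x - x\<^sub>0)"
        using \<rho>I
      proof eventually_elim
        case (elim x)
        then show ?case using eq[OF P_sets[OF elim t0] P_mem[OF elim t0]] by (simp add: kernel_def P_sine[OF elim t0])
      qed
    qed measurable
    finally show ?thesis by simp
  qed
qed


definition stationary :: "real measure" where
  "stationary = distr stationary_law borel (\<lambda>v. v + x\<^sub>0)"

lemma stationary:
  shows "carried stationary"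
    and "circle_moment n stationary = (if n = 0 then 1 else 0)"
    and "sine_moment k stationary = 0"
proof -
  interpret prob_space stationary_law by (rule stationary_law)
  note stationary_law(2)[measurable_cong]
  have "prob_space stationary" unfolding stationary_def by (rule prob_space_distr) measurable
  moreover have "AE y in stationary. y \<in> I"
    unfolding stationary_def using stationary_law(3) by (subst AE_distr_iff) (auto elim!: AE_mp)
  ultimately show "carried stationary" unfolding carried_def by (simp add: stationary_def)
  show "circle_moment n stationary = (if n = 0 then 1 else 0)"
    unfolding stationary_def by (subst integral_distr) (measurable, simp add: stationary_law)
  show "sine_moment k stationary = 0"
    unfolding stationary_def by (subst integral_distr) (measurable, simp add: stationary_law)
qed

lemma carried_iff_emeasure: "carried \<rho> \<longleftrightarrow> prob_space \<rho> \<and> sets \<rho> = sets borel \<and> emeasure \<rho> I = 1"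
proof -
  have "(AE y in \<rho>. y \<in> I) \<longleftrightarrow> emeasure \<rho> I = 1" if p: "prob_space \<rho>" and s: "sets \<rho> = sets borel"
  proof -
    interpret prob_space \<rho> by (rule p)
    have I: "I \<in> sets \<rho>" by (simp add: s)
    show ?thesis
      using AE_in_set_eq_1[OF I] by (simp add: emeasure_eq_measure)
  qed
  then show ?thesis unfolding carried_def by blast
qed

lemma circle_mode_0: "circle_mode 0 v = 1" by (simp add: circle_mode_def)

text \<open>At positive times the evolved law has the moments of the stationary law, so it is the stationary law.
  At time zero there is no smoothing, and the claim is immediate from \<open>P_0\<close>.\<close>
lemma stationary_invariant: "invariant_distribution (x\<^sub>0 - h) (x\<^sub>0 + h) P stationary"
  unfolding invariant_distribution_def
proof (intro conjI allI impI ballI)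
  show "prob_space stationary" "sets stationary = sets borel" "emeasure stationary {x\<^sub>0 - h<..<x\<^sub>0 + h} = 1"
    using stationary(1) unfolding carried_iff_emeasure by auto
  fix t :: real and A :: "real set" assume t: "0 \<le> t" and A: "A \<in> sets borel"
  have sI: "AE y in stationary. y \<in> I" and ss: "sets stationary = sets borel" using stationary(1) by (auto simp: carried_def)
  show "emeasure stationary A = (\<integral>\<^sup>+x\<in>I. emeasure (P x t) A \<partial>stationary)"
  proof (cases "t = 0")
    case True
    have "(\<integral>\<^sup>+x\<in>I. emeasure (P x t) A \<partial>stationary) = (\<integral>\<^sup>+x. indicator A x \<partial>stationary)"
    proof (rule nn_integral_cong_AE)
      show "AE x in stationary. emeasure (P x t) A * indicator I x = indicator A x"
        using sI by eventually_elim (use A True in \<open>simp add: P_0\<close>)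
    qed
    then show ?thesis using A ss by simp
  next
    case False
    then have t: "0 < t" using t by simp
    have "stationary \<bind> kernel t = stationary"
    proof (rule equal_from_moments[OF evolved_law(1)[OF t stationary(1)] stationary(1)])
      show "circle_moment n (stationary \<bind> kernel t) = circle_moment n stationary" for n
        unfolding evolved_law(3)[OF t stationary(1)] stationary(2) by (simp add: zero_complex.code[symmetric])
      show "sine_moment k (stationary \<bind> kernel t) = sine_moment k stationary" for k
        unfolding evolved_law(4)[OF t stationary(1)] stationary(3) by simp
    qed
    then show ?thesis using evolved_law(2)[OF t stationary(1) A] by simp
  qed
qed

text \<open>Time one suffices: a moment that is multiplied by a number different from one and does not change is
  zero.\<close>
lemma invariant_unique:
  assumes inv: "invariant_distribution (x\<^sub>0 - h) (x\<^sub>0 + h) P \<rho>"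
  shows "\<rho> = stationary"
proof -
  have \<rho>: "carried \<rho>" using inv unfolding carried_iff_emeasure invariant_distribution_def by blast
  then have p: "prob_space \<rho>" and s: "sets \<rho> = sets borel" by (auto simp: carried_def)
  have fixed: "\<rho> \<bind> kernel 1 = \<rho>"
  proof (rule measure_eqI)
    show ss: "sets (\<rho> \<bind> kernel 1) = sets \<rho>" using evolved_law(1)[of 1, OF _ \<rho>] s by (simp add: carried_def)
    fix A assume "A \<in> sets (\<rho> \<bind> kernel 1)"
    then have A: "A \<in> sets borel" using ss s by simp
    have "emeasure \<rho> A = (\<integral>\<^sup>+x\<in>I. emeasure (P x 1) A \<partial>\<rho>)"
      using inv A unfolding invariant_distribution_def by (auto dest!: spec[of _ "1::real"])
    then show "emeasure (\<rho> \<bind> kernel 1) A = emeasure \<rho> A" using evolved_law(2)[of 1, OF _ \<rho> A] by simp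
  qed
  show ?thesis
  proof (rule equal_from_moments[OF \<rho> stationary(1)])
    fix n :: int
    let ?m = "circle_moment n \<rho>"
    let ?c = "circle_decay n 1"
    show "?m = circle_moment n stationary"
    proof (cases "n = 0")
      case True
      interpret \<rho>: prob_space \<rho> by (rule p)
      interpret S: prob_space stationary using stationary(1) by (simp add: carried_def)
      show ?thesis using True by (simp add: circle_mode_0 \<rho>.prob_space S.prob_space)
    next
      case False
      have "?m = ?c * ?m" using evolved_law(3)[of 1, OF _ \<rho>, of n] unfolding fixed by simp
      moreover have "?c \<noteq> 1"
      proof
        assume "?c = 1"
        then have "norm ?c = 1" by simp
        then show False unfolding norm_circle_decay using \<gamma> False by simp
      qed
      ultimately have "?m = 0" by (metis mult_cancel_right1 mult.commute)
      then show ?thesis using False by (simp add: stationary)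
    qed
  next
    fix k :: nat
    let ?m = "sine_moment k \<rho>"
    let ?c = "sine_decay k 1"
    have "?m = ?c * ?m" using evolved_law(4)[of 1, OF _ \<rho>, of k] unfolding fixed by simp
    moreover have "0 < \<gamma> * (real k)\<^sup>2 / 4 + \<kappa>" using \<gamma> \<kappa> by (intro add_nonneg_pos) auto
    then have "?c \<noteq> 1" by simp
    ultimately have "?m = 0" by (metis mult_cancel_right1 mult.commute)
    then show "?m = sine_moment k stationary" by (simp add: stationary)
  qed
qed

definition tv_const :: real where
  "tv_const = distance_const (exp (- \<gamma> / 4)) * (exp \<gamma> + exp (\<nu> * h))"

text \<open>For \<open>t \<ge> 1\<close> the exponents exceed \<open>\<gamma> t\<close> by an amount that grows linearly in the index. This leaves a
  geometric sequence with ratio \<open>exp (- \<gamma> / 4)\<close> after \<open>exp (- \<gamma> t)\<close> is split off.\<close>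
lemma total_variation_le:
  assumes x: "x \<in> I" and t: "1 \<le> t"
  shows "total_variation (P x t) stationary \<le> tv_const * exp (- \<gamma> * t)"
proof (rule total_variation_least)
  fix A :: "real set" assume A: "A \<in> sets borel"
  have t0: "0 \<le> t" using t by simp
  define r where "r = exp (- \<gamma> / 4)"
  have r: "0 < r" "r < 1" using \<gamma> by (auto simp: r_def)
  have r_pow: "r ^ k = exp (- \<gamma> / 4 * real k)" for k
    unfolding r_def by (simp add: exp_of_nat_mult[symmetric] mult.commute)
  let ?K = "(exp \<gamma> + exp (\<nu> * h)) * exp (- \<gamma> * t)"
  have "\<bar>measure (P x t) A - measure stationary A\<bar> \<le> distance_const r * ?K"
  proof (rule distance_from_moments[OF P_carried[OF x t0] stationary(1) r _ _ A])
    fix n :: int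
    show "norm (circle_moment n (P x t) - circle_moment n stationary) \<le> ?K * r ^ nat \<bar>n\<bar>"
    proof (cases "n = 0")
      case True
      have "circle_moment n (P x t) = 1"
        using True prob_space.prob_space[OF P_prob[OF x t0]] by (simp add: circle_mode_0)
      then show ?thesis using True r by (simp add: stationary)
    next
      case False
      then have "1 \<le> \<bar>n\<bar>" by simp
      then have n1: "1 \<le> \<bar>real_of_int n\<bar>" by (metis of_int_1_le_iff of_int_abs)
      have n2: "\<bar>real_of_int n\<bar> \<le> (real_of_int n)\<^sup>2" by (rule abs_le_square)
      have "((real_of_int n)\<^sup>2 - 1) * 1 \<le> ((real_of_int n)\<^sup>2 - 1) * t"
        using t n1 n2 by (intro mult_left_mono) auto
      then have "0 \<le> (real_of_int n)\<^sup>2 * t - t + 1 - \<bar>real_of_int n\<bar> / 4"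
        using n1 n2 by (simp add: algebra_simps)
      then have "0 \<le> \<gamma> * ((real_of_int n)\<^sup>2 * t - t + 1 - \<bar>real_of_int n\<bar> / 4)" using \<gamma> by simp
      then have le: "- \<gamma> * (real_of_int n)\<^sup>2 * t \<le> \<gamma> + - \<gamma> * t + - \<gamma> / 4 * \<bar>real_of_int n\<bar>"
        by (simp add: algebra_simps)
      have "norm (circle_moment n (P x t) - circle_moment n stationary) = exp (- \<gamma> * (of_int n)\<^sup>2 * t)"
        unfolding P_circle[OF x t0] stationary(2)
        using False by (simp only: if_False diff_zero norm_mult norm_circle_decay norm_circle_mode mult_1_right)
      also have "\<dots> \<le> exp (\<gamma> + - \<gamma> * t + - \<gamma> / 4 * \<bar>real_of_int n\<bar>)" using le by simp
      also have "\<dots> = (exp \<gamma> * exp (- \<gamma> * t)) * r ^ nat \<bar>n\<bar>" unfolding r_pow mult_exp_exp by simp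
      also have "\<dots> \<le> ?K * r ^ nat \<bar>n\<bar>" using r by (intro mult_right_mono) auto
      finally show ?thesis .
    qed
  next
    fix k :: nat
    have k2: "real k \<le> (real k)\<^sup>2" using abs_le_square[of "int k"] by simp
    also have "\<dots> \<le> (real k)\<^sup>2 * t" using t by (simp add: mult_le_cancel_left1)
    finally have "\<gamma> / 4 * real k \<le> \<gamma> / 4 * ((real k)\<^sup>2 * t)" using \<gamma> by (intro mult_left_mono) auto
    moreover have "\<gamma> * t \<le> \<kappa> * t" using \<kappa> t by (intro mult_right_mono) auto
    ultimately have le: "- (\<gamma> * (real k)\<^sup>2 / 4 + \<kappa>) * t \<le> - \<gamma> * t + - \<gamma> / 4 * real k" by (simp add: algebra_simps)
    have "\<bar>sine_moment k (P x t) - sine_moment k stationary\<bar> =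
        sine_decay k t * \<bar>sine_mode k (x - x\<^sub>0)\<bar>"
      unfolding P_sine[OF x t0] stationary(3) by (simp add: abs_mult)
    also have "\<dots> \<le> exp (- \<gamma> * t + - \<gamma> / 4 * real k) * exp (\<nu> * h)"
      using le x by (intro mult_mono sine_mode_bound) auto
    also have "\<dots> = (exp (\<nu> * h) * exp (- \<gamma> * t)) * r ^ k" unfolding r_pow mult_exp_exp by (simp add: algebra_simps)
    also have "\<dots> \<le> ?K * r ^ k" using r by (intro mult_right_mono) auto
    finally show "\<bar>sine_moment k (P x t) - sine_moment k stationary\<bar> \<le> ?K * r ^ k" .
  qed
  then show "\<bar>measure (P x t) A - measure stationary A\<bar> \<le> tv_const * exp (- \<gamma> * t)"
    by (simp add: tv_const_def r_def mult.assoc)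
qed

text \<open>Started at \<open>x\<^sub>0\<close>, the first circle moment has modulus exactly \<open>exp (- \<gamma> t)\<close>, and it is zero in
  equilibrium.\<close>
lemma total_variation_ge:
  assumes t: "0 \<le> t"
  shows "exp (- \<gamma> * t) / 4 \<le> total_variation (P x\<^sub>0 t) stationary"
proof -
  have st: "prob_space stationary" "sets stationary = sets borel" using stationary(1) by (auto simp: carried_def)
  have m: "(\<lambda>y. 2 * pi * of_int 1 * (y - x\<^sub>0) / h) \<in> borel_measurable borel" by measurable
  have "exp (- \<gamma> * t) = norm (circle_moment 1 (P x\<^sub>0 t) - circle_moment 1 stationary)"
    unfolding P_circle[OF midpoint_mem t] stationary(2) using norm_circle_decay[of 1 t] by (simp add: norm_mult del: norm_exp_eq_Re)
  also have "\<dots> \<le> 4 * total_variation (P x\<^sub>0 t) stationary"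
    unfolding circle_mode_def
    by (rule cis_integral_diff_le_total_variation[OF P_prob[OF midpoint_mem t] P_sets[OF midpoint_mem t] st m])
  finally show ?thesis by simp
qed

theorem spectral_gap: "has_spectral_gap (x\<^sub>0 - h) (x\<^sub>0 + h) P \<gamma>"
proof -
  define S where "S t = (SUP x\<in>I. total_variation (P x t) stationary)" for t
  have upper: "S t \<le> tv_const * exp (- \<gamma> * t)" if "1 \<le> t" for t
    unfolding S_def using midpoint_mem total_variation_le[OF _ that] by (intro cSUP_least) blast+
  have lower: "exp (- \<gamma> * t) / 4 \<le> S t" if "1 \<le> t" for t
  proof -
    have "total_variation (P x\<^sub>0 t) stationary \<le> S t"
      unfolding S_def using total_variation_le[OF _ that] by (intro cSUP_upper midpoint_mem bdd_aboveI2) blast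
    then show ?thesis using total_variation_ge[of t] that by linarith
  qed
  have "0 < exp (- \<gamma> * 1) / 4" by simp
  also have "\<dots> \<le> tv_const * exp (- \<gamma> * 1)" using lower[of 1] upper[of 1] by linarith
  finally have C: "0 < tv_const" by (simp add: zero_less_mult_iff)
  have "((\<lambda>t. - (1 / t * ln (S t))) \<longlongrightarrow> \<gamma>) at_top"
  proof (rule tendsto_sandwich)
    show "\<forall>\<^sub>F t in at_top. \<gamma> - ln tv_const / t \<le> - (1 / t * ln (S t))"
      using eventually_ge_at_top[of 1]
    proof eventually_elim
      case (elim t)
      have "0 < S t" using lower[OF elim] by (rule less_le_trans[rotated]) simp
      then have "ln (S t) \<le> ln (tv_const * exp (- \<gamma> * t))" using upper[OF elim] by (intro ln_mono) auto
      also have "\<dots> = ln tv_const - \<gamma> * t" using C by (simp add: ln_mult)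
      finally have "ln (S t) / t \<le> (ln tv_const - \<gamma> * t) / t" using elim by (intro divide_right_mono) auto
      then show ?case using elim by (simp add: diff_divide_distrib)
    qed
    show "\<forall>\<^sub>F t in at_top. - (1 / t * ln (S t)) \<le> \<gamma> + ln 4 / t"
      using eventually_ge_at_top[of 1]
    proof eventually_elim
      case (elim t)
      have "- \<gamma> * t - ln 4 = ln (exp (- \<gamma> * t) / 4)" by (simp add: ln_div)
      also have "\<dots> \<le> ln (S t)" using lower[OF elim] by (intro ln_mono) auto
      finally have "(- \<gamma> * t - ln 4) / t \<le> ln (S t) / t" using elim by (intro divide_right_mono) auto
      then show ?case using elim by (simp add: diff_divide_distrib)
    qed
    have inv: "((\<lambda>t::real. c / t) \<longlongrightarrow> 0) at_top" for c
      by (rule tendsto_divide_0[OF tendsto_const filterlim_at_top_imp_at_infinity[OF filterlim_ident]])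
    show "((\<lambda>t. \<gamma> - ln tv_const / t) \<longlongrightarrow> \<gamma>) at_top"
      using tendsto_diff[OF tendsto_const inv] by simp
    show "((\<lambda>t. \<gamma> + ln 4 / t) \<longlongrightarrow> \<gamma>) at_top"
      using tendsto_add[OF tendsto_const inv] by simp
  qed
  then show ?thesis
    unfolding has_spectral_gap_def S_def using stationary_invariant invariant_unique by blast
qed

end

section \<open>Gaussian exponential moments and convergence of means\<close>

lemma std_normal_cis: "(\<integral>y. std_normal_density y *\<^sub>R cis (t * y) \<partial>lborel) = of_real (exp (- (t\<^sup>2) / 2))"
proof -
  have "(\<integral>y. std_normal_density y *\<^sub>R cis (t * y) \<partial>lborel) = char std_normal_distribution t"
    unfolding char_def by (subst integral_density) (auto simp: cis_conv_exp)
  then show ?thesis by (simp add: char_std_normal_distribution)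
qed

text \<open>Completing the square: an exponential weight shifts the mean of a Gaussian. It reduces complex
  exponential moments to the characteristic function.\<close>
lemma normal_density_tilt:
  assumes "v > 0"
  shows "normal_density 0 (sqrt v) y * exp (\<alpha> * y) = exp (\<alpha>\<^sup>2 * v / 2) * normal_density (\<alpha> * v) (sqrt v) y"
proof -
  have "- (y\<^sup>2 / (2 * v)) + \<alpha> * y = \<alpha>\<^sup>2 * v / 2 + - ((y - \<alpha> * v)\<^sup>2 / (2 * v))"
    using assms by (simp add: field_simps power2_eq_square)
  then show ?thesis
    using assms by (simp add: normal_density_def exp_add[symmetric] field_simps)
qed

lemma normal_exp_moment:
  assumes v: "v > 0" and Z: "distributed M lborel Z (normal_density 0 (sqrt v))"
  shows "integrable M (\<lambda>\<omega>. exp (\<zeta> * of_real (Z \<omega>)) :: complex)"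
    and "(\<integral>\<omega>. exp (\<zeta> * of_real (Z \<omega>)) \<partial>M) = exp (\<zeta>\<^sup>2 * of_real v / 2)"
proof -
  define \<alpha> \<beta> where "\<alpha> = Re \<zeta>" and "\<beta> = Im \<zeta>"
  have em: "(\<lambda>y. exp (\<zeta> * of_real y)) \<in> borel_measurable borel"
    by (intro borel_measurable_continuous_onI continuous_intros)
  have cm: "(\<lambda>y. cis (\<beta> * y)) \<in> borel_measurable borel"
    by (intro borel_measurable_continuous_onI continuous_intros)
  have eq: "distr M lborel Z = density lborel (\<lambda>y. ennreal (normal_density 0 (sqrt v) y))"
    using Z by (rule distributed_distr_eq_density)
  have Zm: "Z \<in> measurable M lborel" using Z by (rule distributed_measurable)
  have split: "normal_density 0 (sqrt v) y *\<^sub>R exp (\<zeta> * of_real y) =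
      exp (\<alpha>\<^sup>2 * v / 2) *\<^sub>R (normal_density (\<alpha> * v) (sqrt v) y *\<^sub>R cis (\<beta> * y))" for y
  proof -
    have "exp (\<zeta> * of_real y) = exp (\<alpha> * y) *\<^sub>R cis (\<beta> * y)"
      unfolding exp_eq_polar \<alpha>_def \<beta>_def by (simp add: scaleR_conv_of_real)
    then have "normal_density 0 (sqrt v) y *\<^sub>R exp (\<zeta> * of_real y) = (normal_density 0 (sqrt v) y * exp (\<alpha> * y)) *\<^sub>R cis (\<beta> * y)"
      by simp
    then show ?thesis unfolding normal_density_tilt[OF v] by simp
  qed
  have int1: "integrable lborel (\<lambda>y. normal_density (\<alpha> * v) (sqrt v) y *\<^sub>R cis (\<beta> * y))"
    by (rule Bochner_Integration.integrable_bound[OF integrable_normal_density[of "sqrt v" "\<alpha> * v"]])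
       (use v cm in auto)
  have int: "integrable lborel (\<lambda>y. normal_density 0 (sqrt v) y *\<^sub>R exp (\<zeta> * of_real y))"
    unfolding split by (intro integrable_scaleR_right int1)
  show "integrable M (\<lambda>\<omega>. exp (\<zeta> * of_real (Z \<omega>)))"
    using int em Zm unfolding eq by (subst integrable_distr_eq[symmetric, where N = lborel]) (auto simp: eq integrable_density)
  have "(\<integral>y. normal_density (\<alpha> * v) (sqrt v) y *\<^sub>R cis (\<beta> * y) \<partial>lborel) =
     sqrt v *\<^sub>R (\<integral>y. normal_density (\<alpha> * v) (sqrt v) (\<alpha> * v + sqrt v * y) *\<^sub>R cis (\<beta> * (\<alpha> * v + sqrt v * y)) \<partial>lborel)"
    using v by (subst lborel_integral_real_affine[where c = "sqrt v" and t = "\<alpha> * v"]) auto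
  also have "\<dots> = (\<integral>y. cis (\<beta> * \<alpha> * v) * (std_normal_density y *\<^sub>R cis (\<beta> * sqrt v * y)) \<partial>lborel)"
    unfolding integral_scaleR_right[symmetric]
  proof (rule Bochner_Integration.integral_cong[OF refl])
    fix y :: real
    have "sqrt v * normal_density (\<alpha> * v) (sqrt v) (\<alpha> * v + sqrt v * y) = std_normal_density y"
      using v by (simp add: normal_density_def real_sqrt_mult power_mult_distrib field_simps)
    moreover have "cis (\<beta> * (\<alpha> * v + sqrt v * y)) = cis (\<beta> * \<alpha> * v) * cis (\<beta> * sqrt v * y)"
      by (simp add: cis_mult algebra_simps)
    ultimately show "sqrt v *\<^sub>R (normal_density (\<alpha> * v) (sqrt v) (\<alpha> * v + sqrt v * y) *\<^sub>R cis (\<beta> * (\<alpha> * v + sqrt v * y))) =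
      cis (\<beta> * \<alpha> * v) * (std_normal_density y *\<^sub>R cis (\<beta> * sqrt v * y))"
      by simp
  qed
  also have "\<dots> = cis (\<beta> * \<alpha> * v) * of_real (exp (- ((\<beta> * sqrt v)\<^sup>2) / 2))"
    unfolding integral_mult_right_zero std_normal_cis ..
  finally have "(\<integral>y. normal_density 0 (sqrt v) y *\<^sub>R exp (\<zeta> * of_real y) \<partial>lborel) =
      exp (\<alpha>\<^sup>2 * v / 2) *\<^sub>R (cis (\<beta> * \<alpha> * v) * of_real (exp (- ((\<beta> * sqrt v)\<^sup>2) / 2)))"
    unfolding split integral_scaleR_right by simp
  also have "\<dots> = of_real (exp (\<alpha>\<^sup>2 * v / 2) * exp (- ((\<beta> * sqrt v)\<^sup>2) / 2)) * cis (\<beta> * \<alpha> * v)"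
    by (simp add: scaleR_conv_of_real)
  also have "\<dots> = exp (\<zeta>\<^sup>2 * of_real v / 2)"
  proof -
    have "Re (\<zeta>\<^sup>2 * of_real v / 2) = \<alpha>\<^sup>2 * v / 2 - (\<beta> * sqrt v)\<^sup>2 / 2"
      using v by (simp add: \<alpha>_def \<beta>_def power2_eq_square field_simps)
    moreover have "Im (\<zeta>\<^sup>2 * of_real v / 2) = \<beta> * \<alpha> * v"
      by (simp add: \<alpha>_def \<beta>_def power2_eq_square field_simps)
    moreover have "exp (\<alpha>\<^sup>2 * v / 2) * exp (- ((\<beta> * sqrt v)\<^sup>2) / 2) = exp (\<alpha>\<^sup>2 * v / 2 - (\<beta> * sqrt v)\<^sup>2 / 2)"
      unfolding mult_exp_exp by simp
    ultimately show ?thesis unfolding exp_eq_polar[of "\<zeta>\<^sup>2 * of_real v / 2"] by (simp only:)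
  qed
  finally have *: "(\<integral>y. normal_density 0 (sqrt v) y *\<^sub>R exp (\<zeta> * of_real y) \<partial>lborel) = exp (\<zeta>\<^sup>2 * of_real v / 2)" .
  have "(\<integral>\<omega>. exp (\<zeta> * of_real (Z \<omega>)) \<partial>M) = (\<integral>y. exp (\<zeta> * of_real y) \<partial>distr M lborel Z)"
    by (rule integral_distr[symmetric]) (use em Zm in simp_all)
  also have "\<dots> = (\<integral>y. normal_density 0 (sqrt v) y *\<^sub>R exp (\<zeta> * of_real y) \<partial>lborel)"
    unfolding eq by (rule integral_density) (use em in simp_all)
  finally show "(\<integral>\<omega>. exp (\<zeta> * of_real (Z \<omega>)) \<partial>M) = exp (\<zeta>\<^sup>2 * of_real v / 2)"
    using * by (rule trans)
qed

text \<open>Boundedness in \<open>L\<^sup>2\<close> implies uniform integrability. The distance \<open>d\<close> of a term from the limit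
  satisfies \<open>d \<le> min d K + d\<^sup>2 / K\<close>, where the first summand converges dominatedly and the second one has
  small mean for large \<open>K\<close>.\<close>
lemma (in prob_space) L2_bounded_convergence:
  fixes f :: "nat \<Rightarrow> 'a \<Rightarrow> 'b :: {banach, second_countable_topology}"
  assumes f [measurable]: "\<And>n. f n \<in> borel_measurable M" and g [measurable]: "g \<in> borel_measurable M"
    and int: "\<And>n. integrable M (\<lambda>\<omega>. (norm (f n \<omega>))\<^sup>2)" and C: "\<And>n. (\<integral>\<omega>. (norm (f n \<omega>))\<^sup>2 \<partial>M) \<le> C"
    and lim: "\<And>\<omega>. \<omega> \<in> space M \<Longrightarrow> (\<lambda>n. f n \<omega>) \<longlonglongrightarrow> g \<omega>"
  shows "integrable M g" "(\<lambda>n. \<integral>\<omega>. f n \<omega> \<partial>M) \<longlonglongrightarrow> (\<integral>\<omega>. g \<omega> \<partial>M)"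
proof -
  have C0: "0 \<le> C" using C[of 0] by (rule order_trans[rotated]) simp
  have "(\<integral>\<^sup>+\<omega>. ennreal ((norm (g \<omega>))\<^sup>2) \<partial>M) = (\<integral>\<^sup>+\<omega>. liminf (\<lambda>n. ennreal ((norm (f n \<omega>))\<^sup>2)) \<partial>M)"
  proof (rule nn_integral_cong)
    fix \<omega> assume "\<omega> \<in> space M"
    then have "(\<lambda>n. ennreal ((norm (f n \<omega>))\<^sup>2)) \<longlonglongrightarrow> ennreal ((norm (g \<omega>))\<^sup>2)"
      by (intro tendsto_ennrealI tendsto_power tendsto_norm lim)
    then show "ennreal ((norm (g \<omega>))\<^sup>2) = liminf (\<lambda>n. ennreal ((norm (f n \<omega>))\<^sup>2))"
      by (intro lim_imp_Liminf[symmetric]) auto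
  qed
  also have "\<dots> \<le> liminf (\<lambda>n. \<integral>\<^sup>+\<omega>. ennreal ((norm (f n \<omega>))\<^sup>2) \<partial>M)"
    by (rule nn_integral_liminf) measurable
  also have "\<dots> \<le> ennreal C"
  proof -
    have "(\<integral>\<^sup>+\<omega>. ennreal ((norm (f n \<omega>))\<^sup>2) \<partial>M) \<le> ennreal C" for n
      using C[of n] by (subst nn_integral_eq_integral[OF int]) (auto intro: ennreal_leI)
    then show ?thesis
      by (intro order_trans[OF Liminf_le_Limsup Limsup_bounded]) auto
  qed
  finally have g2: "(\<integral>\<^sup>+\<omega>. ennreal ((norm (g \<omega>))\<^sup>2) \<partial>M) \<le> ennreal C" .
  have intg2: "integrable M (\<lambda>\<omega>. (norm (g \<omega>))\<^sup>2)"
    using g2 by (intro integrableI_bounded) (auto simp: top_unique le_less_trans)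
  have g2C: "(\<integral>\<omega>. (norm (g \<omega>))\<^sup>2 \<partial>M) \<le> C"
    using g2 C0 by (subst (asm) nn_integral_eq_integral[OF intg2]) auto
  have L1: "integrable M h" if "integrable M (\<lambda>\<omega>. (norm (h \<omega>))\<^sup>2)" "h \<in> borel_measurable M" for h :: "'a \<Rightarrow> 'b"
  proof (rule Bochner_Integration.integrable_bound[OF _ that(2)])
    show "integrable M (\<lambda>\<omega>. 1 + (norm (h \<omega>))\<^sup>2)" using that by auto
    have "x \<le> 1 + x\<^sup>2" for x :: real using zero_le_power2[of "x - 1/2"] by (simp add: power2_eq_square algebra_simps)
    then show "AE \<omega> in M. norm (h \<omega>) \<le> norm (1 + (norm (h \<omega>))\<^sup>2)" by (intro AE_I2) auto
  qed
  show ig: "integrable M g" by (rule L1[OF intg2 g])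
  have if': "integrable M (f n)" for n by (rule L1[OF int f])
  have "(\<lambda>n. \<integral>\<omega>. norm (f n \<omega> - g \<omega>) \<partial>M) \<longlonglongrightarrow> 0"
  proof (rule LIMSEQ_I)
    fix e :: real assume e: "e > 0"
    \<comment> \<open>the truncation level that makes \<open>4 * C / K\<close> smaller than \<open>e / 2\<close>\<close>
    define K where "K = (8 * C + 1) / e"
    have K: "K > 0" "4 * C / K < e / 2" using e C0 by (auto simp: K_def field_simps)
    have "(\<lambda>n. \<integral>\<omega>. min (norm (f n \<omega> - g \<omega>)) K \<partial>M) \<longlonglongrightarrow> (\<integral>\<omega>. 0 \<partial>M)"
    proof (rule integral_dominated_convergence[where w = "\<lambda>_. K"])
      show "AE \<omega> in M. (\<lambda>n. min (norm (f n \<omega> - g \<omega>)) K) \<longlonglongrightarrow> 0"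
      proof (rule AE_I2)
        fix \<omega> assume "\<omega> \<in> space M"
        then have "(\<lambda>n. min (norm (f n \<omega> - g \<omega>)) K) \<longlonglongrightarrow> min (norm (g \<omega> - g \<omega>)) K"
          by (intro tendsto_intros lim)
        then show "(\<lambda>n. min (norm (f n \<omega> - g \<omega>)) K) \<longlonglongrightarrow> 0" using K by simp
      qed
    qed (use K in auto)
    from LIMSEQ_D[OF this, of "e / 2"] obtain n0
      where n0: "\<And>n. n \<ge> n0 \<Longrightarrow> \<bar>\<integral>\<omega>. min (norm (f n \<omega> - g \<omega>)) K \<partial>M\<bar> < e / 2"
      using e by fastforce
    have "norm ((\<integral>\<omega>. norm (f n \<omega> - g \<omega>) \<partial>M) - 0) < e" if "n \<ge> n0" for n
    proof -
      have pt: "norm (f n \<omega> - g \<omega>) \<le> min (norm (f n \<omega> - g \<omega>)) K + (2 * (norm (f n \<omega>))\<^sup>2 + 2 * (norm (g \<omega>))\<^sup>2) / K" for \<omega>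
      proof (cases "norm (f n \<omega> - g \<omega>) \<le> K")
        case True then show ?thesis using K by simp
      next
        case False
        have "(norm (f n \<omega> - g \<omega>))\<^sup>2 \<le> (norm (f n \<omega>) + norm (g \<omega>))\<^sup>2"
          by (intro power_mono norm_triangle_ineq4) auto
        also have "\<dots> \<le> 2 * (norm (f n \<omega>))\<^sup>2 + 2 * (norm (g \<omega>))\<^sup>2"
          using zero_le_power2[of "norm (f n \<omega>) - norm (g \<omega>)"] by (simp add: power2_eq_square algebra_simps)
        finally have 1: "(norm (f n \<omega> - g \<omega>))\<^sup>2 \<le> 2 * (norm (f n \<omega>))\<^sup>2 + 2 * (norm (g \<omega>))\<^sup>2" .
        have "norm (f n \<omega> - g \<omega>) * K \<le> norm (f n \<omega> - g \<omega>) * norm (f n \<omega> - g \<omega>)"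
          using False by (intro mult_left_mono) auto
        then have "norm (f n \<omega> - g \<omega>) \<le> (norm (f n \<omega> - g \<omega>))\<^sup>2 / K"
          using K by (simp add: field_simps power2_eq_square)
        also have "\<dots> \<le> (2 * (norm (f n \<omega>))\<^sup>2 + 2 * (norm (g \<omega>))\<^sup>2) / K"
          using 1 K by (intro divide_right_mono) auto
        finally show ?thesis using K by (simp add: min_def)
      qed
      have imin: "integrable M (\<lambda>\<omega>. min (norm (f n \<omega> - g \<omega>)) K)"
        using K by (intro integrable_const_bound[where B = K] AE_I2) auto
      have "(\<integral>\<omega>. norm (f n \<omega> - g \<omega>) \<partial>M) \<le>
         (\<integral>\<omega>. min (norm (f n \<omega> - g \<omega>)) K + (2 * (norm (f n \<omega>))\<^sup>2 + 2 * (norm (g \<omega>))\<^sup>2) / K \<partial>M)"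
        using pt ig if' int intg2 imin by (intro integral_mono) auto
      also have "\<dots> = (\<integral>\<omega>. min (norm (f n \<omega> - g \<omega>)) K \<partial>M) + (2 * (\<integral>\<omega>. (norm (f n \<omega>))\<^sup>2 \<partial>M) + 2 * (\<integral>\<omega>. (norm (g \<omega>))\<^sup>2 \<partial>M)) / K"
        using ig if' int intg2 imin by simp
      also have "\<dots> \<le> (\<integral>\<omega>. min (norm (f n \<omega> - g \<omega>)) K \<partial>M) + (4 * C) / K"
        using C[of n] g2C K by (intro add_left_mono divide_right_mono) auto
      also have "\<dots> < e" using n0[OF that] K(2) by linarith
      finally show ?thesis by simp
    qed
    then show "\<exists>no. \<forall>n\<ge>no. norm ((\<integral>\<omega>. norm (f n \<omega> - g \<omega>) \<partial>M) - 0) < e" by blast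
  qed
  then have "(\<lambda>n. (\<integral>\<omega>. f n \<omega> \<partial>M) - (\<integral>\<omega>. g \<omega> \<partial>M)) \<longlonglongrightarrow> 0"
  proof (rule Lim_null_comparison[rotated], intro always_eventually allI)
    fix n
    show "norm ((\<integral>\<omega>. f n \<omega> \<partial>M) - (\<integral>\<omega>. g \<omega> \<partial>M)) \<le> (\<integral>\<omega>. norm (f n \<omega> - g \<omega>) \<partial>M)"
      using ig if' Bochner_Integration.integral_norm_bound[of M "\<lambda>\<omega>. f n \<omega> - g \<omega>"] by simp
  qed
  then show "(\<lambda>n. \<integral>\<omega>. f n \<omega> \<partial>M) \<longlonglongrightarrow> (\<integral>\<omega>. g \<omega> \<partial>M)" by (simp add: LIM_zero_iff)
qed

section \<open>Hitting times of continuous paths\<close>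

text \<open>Staying in a closed interval during \<open>[0, s]\<close> can be tested on finer and finer grids, because a
  continuous path that leaves the interval is outside on an open set of times.\<close>
lemma grid_stays_tendsto:
  fixes w :: "real \<Rightarrow> real"
  assumes w: "continuous_on {0..s} w" and s: "0 \<le> s"
  shows "(\<lambda>n. of_bool (\<forall>j\<le>Suc n. w (s * (real j / real (Suc n))) \<in> {p..q}) :: real)
     \<longlonglongrightarrow> of_bool (\<forall>r\<in>{0..s}. w r \<in> {p..q})"
proof (cases "\<forall>r\<in>{0..s}. w r \<in> {p..q}")
  case True
  have "\<forall>j\<le>Suc n. w (s * (real j / real (Suc n))) \<in> {p..q}" for n
  proof (intro allI impI)
    fix j assume "j \<le> Suc n"
    then have "real j / real (Suc n) \<le> 1" by simp
    then have "s * (real j / real (Suc n)) \<in> {0..s}" using s mult_left_le[of "real j / real (Suc n)" s] by simp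
    then show "w (s * (real j / real (Suc n))) \<in> {p..q}" using True by blast
  qed
  then show ?thesis using True by simp
next
  case False
  then obtain r where r: "0 \<le> r" "r \<le> s" "w r \<notin> {p..q}" by auto
  define u where "u = r / s"
  have u: "0 \<le> u" "u \<le> 1" "r = s * u" using r s by (auto simp: u_def divide_le_eq_1)
  define k where "k n = nat \<lfloor>u * real (Suc n)\<rfloor>" for n
  have kle: "real (k n) \<le> u * real (Suc n)" "u * real (Suc n) < real (k n) + 1" for n
    using u(1) by (auto simp: k_def mult_nonneg_nonneg)
  have k: "k n \<le> Suc n" for n
  proof -
    have "u * real (Suc n) \<le> real (Suc n)" using u by (intro mult_left_le_one_le) auto
    then show ?thesis using kle(1)[of n] by linarith
  qed
  have "(\<lambda>n. u - real (k n) / real (Suc n)) \<longlonglongrightarrow> 0"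
  proof (rule Lim_null_comparison[OF _ LIMSEQ_Suc[OF lim_1_over_n]], intro always_eventually allI)
    fix n
    have "real (k n) / real (Suc n) \<le> u" "u \<le> (real (k n) + 1) / real (Suc n)"
      by (rule mult_imp_div_pos_le, simp, rule kle(1)) (rule mult_imp_le_div_pos, simp, rule less_imp_le[OF kle(2)])
    then show "norm (u - real (k n) / real (Suc n)) \<le> 1 / real (Suc n)"
      unfolding add_divide_distrib real_norm_def by linarith
  qed
  from tendsto_diff[OF tendsto_const[of u] this]
  have "(\<lambda>n. s * (real (k n) / real (Suc n))) \<longlonglongrightarrow> s * u"
    by (intro tendsto_mult tendsto_const) simp
  moreover have mem: "s * (real (k n) / real (Suc n)) \<in> {0..s}" for n
  proof -
    have "real (k n) / real (Suc n) \<le> 1" using k[of n] by simp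
    then show ?thesis using s mult_left_le[of "real (k n) / real (Suc n)" s] by simp
  qed
  ultimately have "(\<lambda>n. w (s * (real (k n) / real (Suc n)))) \<longlonglongrightarrow> w r"
    using r u(3) w by (intro continuous_on_tendsto_compose[OF w]) auto
  moreover have "open (- {p..q})" by (intro open_Compl closed_atLeastAtMost)
  ultimately have "\<forall>\<^sub>F n in sequentially. w (s * (real (k n) / real (Suc n))) \<in> - {p..q}"
    using r(3) by (auto dest: topological_tendstoD)
  then have "\<forall>\<^sub>F n in sequentially. of_bool (\<forall>j\<le>Suc n. w (s * (real j / real (Suc n))) \<in> {p..q}) = (0::real)"
  proof eventually_elim
    case (elim n)
    then have "\<not> (\<forall>j\<le>Suc n. w (s * (real j / real (Suc n))) \<in> {p..q})" using k[of n] by blast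
    then show ?case by simp
  qed
  moreover have "of_bool (\<forall>r\<in>{0..s}. w r \<in> {p..q}) = (0::real)"
    using False by (simp only: of_bool_eq_0_iff not_False_eq_True)
  ultimately show ?thesis by (simp only: tendsto_eventually)
qed

text \<open>By compactness, a path that stays in the open interval stays away from its end points.\<close>
lemma shrinking_stays_tendsto:
  fixes w :: "real \<Rightarrow> real"
  assumes w: "continuous_on {0..s} w" and s: "0 \<le> s"
  shows "(\<lambda>k. of_bool (\<forall>r\<in>{0..s}. w r \<in> {p + 1 / real (Suc k)..q - 1 / real (Suc k)}) :: real)
     \<longlonglongrightarrow> of_bool (\<forall>r\<in>{0..s}. w r \<in> {p<..<q})"
proof (cases "\<forall>r\<in>{0..s}. w r \<in> {p<..<q}")
  case True
  have "\<exists>x\<in>{0..s}. \<forall>y\<in>{0..s}. w x \<le> w y"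
    by (rule continuous_attains_inf[OF compact_Icc _ w]) (use s in simp)
  then obtain r1 where r1: "r1 \<in> {0..s}" "\<forall>r\<in>{0..s}. w r1 \<le> w r" by blast
  have "\<exists>x\<in>{0..s}. \<forall>y\<in>{0..s}. w y \<le> w x"
    by (rule continuous_attains_sup[OF compact_Icc _ w]) (use s in simp)
  then obtain r2 where r2: "r2 \<in> {0..s}" "\<forall>r\<in>{0..s}. w r \<le> w r2" by blast
  define d where "d = min (w r1 - p) (q - w r2)"
  have d: "d > 0" using bspec[OF True r1(1)] bspec[OF True r2(1)] by (simp add: d_def)
  have "\<forall>\<^sub>F k in sequentially. 1 / real (Suc k) < d"
    using LIMSEQ_Suc[OF lim_1_over_n[where 'a = real]] d by (rule order_tendstoD)
  then have "\<forall>\<^sub>F k in sequentially. of_bool (\<forall>r\<in>{0..s}. w r \<in> {p + 1 / real (Suc k)..q - 1 / real (Suc k)}) = (1::real)"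
  proof eventually_elim
    case (elim k)
    then have "w r \<in> {p + 1 / real (Suc k)..q - 1 / real (Suc k)}" if "r \<in> {0..s}" for r
      using bspec[OF r1(2) that] bspec[OF r2(2) that] unfolding atLeastAtMost_iff d_def by linarith
    then show ?case by simp
  qed
  moreover have "of_bool (\<forall>r\<in>{0..s}. w r \<in> {p<..<q}) = (1::real)"
    using True by (simp only: of_bool_eq_1_iff)
  ultimately show ?thesis by (simp only: tendsto_eventually)
next
  case False
  then obtain r where r: "r \<in> {0..s}" "w r \<notin> {p<..<q}" by auto
  have "w r \<notin> {p + 1 / real (Suc k)..q - 1 / real (Suc k)}" for k
  proof -
    have "1 / real (Suc k) > 0" by simp
    then show ?thesis using r unfolding atLeastAtMost_iff greaterThanLessThan_iff by linarith
  qed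
  then have "\<not> (\<forall>r\<in>{0..s}. w r \<in> {p + 1 / real (Suc k)..q - 1 / real (Suc k)})" for k using r(1) by blast
  then have "of_bool (\<forall>r\<in>{0..s}. w r \<in> {p + 1 / real (Suc k)..q - 1 / real (Suc k)}) = (0::real)" for k
    by (simp only: of_bool_eq_0_iff not_False_eq_True)
  moreover have "of_bool (\<forall>r\<in>{0..s}. w r \<in> {p<..<q}) = (0::real)"
    using False by (simp only: of_bool_eq_0_iff not_False_eq_True)
  ultimately show ?thesis by (simp only: tendsto_const)
qed

lemma exit_imp_hit:
  fixes w :: "real \<Rightarrow> real"
  assumes w: "continuous_on {0..} w" and w0: "w 0 \<in> {a<..<b}" and r: "0 \<le> r" "w r \<notin> {a<..<b}"
  obtains t where "0 \<le> t" "t \<le> r" "w t \<in> {a, b}"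
proof -
  have c: "continuous_on {0..r} w" by (rule continuous_on_subset[OF w]) auto
  consider "w r \<le> a" | "b \<le> w r" using r by force
  then show ?thesis
  proof cases
    case 1 then show ?thesis using IVT2'[of w r a 0] r w0 c that by auto
  next
    case 2 then show ?thesis using IVT'[of w 0 b r] r w0 c that by auto
  qed
qed

lemma less_hitting_time_iff:
  fixes w :: "real \<Rightarrow> real"
  assumes w: "continuous_on {0..} w" and w0: "w 0 \<in> {a<..<b}" and s: "0 \<le> s"
  shows "ereal s < hitting_time a b w \<longleftrightarrow> (\<forall>r\<in>{0..s}. w r \<in> {a<..<b})"
proof
  assume l: "ereal s < hitting_time a b w"
  show "\<forall>r\<in>{0..s}. w r \<in> {a<..<b}"
  proof (rule ccontr)
    assume "\<not> ?thesis"
    then obtain r where r: "0 \<le> r" "r \<le> s" "w r \<notin> {a<..<b}" by auto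
    then obtain t where t: "0 \<le> t" "t \<le> r" "w t \<in> {a, b}" using exit_imp_hit[OF w w0] by blast
    then have "hitting_time a b w \<le> ereal t" unfolding hitting_time_def by (intro INF_lower) auto
    also have "\<dots> \<le> ereal s" using t r by simp
    finally show False using l by simp
  qed
next
  assume all: "\<forall>r\<in>{0..s}. w r \<in> {a<..<b}"
  then have "w s \<in> {a<..<b}" using s by auto
  then have e: "min (w s - a) (b - w s) > 0" by simp
  obtain d where d: "d > 0" "\<And>r. r \<in> {0..} \<Longrightarrow> dist r s < d \<Longrightarrow> dist (w r) (w s) < min (w s - a) (b - w s)"
    using w[unfolded continuous_on_iff, rule_format, OF _ e, of s] s by auto
  have "ereal (s + d) \<le> hitting_time a b w" unfolding hitting_time_def
  proof (rule INF_greatest)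
    fix t assume t: "t \<in> {t. 0 \<le> t \<and> w t \<in> {a, b}}"
    have "\<not> t < s + d"
    proof
      assume "t < s + d"
      then have "w t \<in> {a<..<b}"
        using t all d(2)[of t] by (cases "t \<le> s") (auto simp: dist_real_def abs_less_iff)
      then show False using t by auto
    qed
    then show "ereal (s + d) \<le> ereal t" by simp
  qed
  moreover have "ereal s < ereal (s + d)" using d by simp
  ultimately show "ereal s < hitting_time a b w" by (rule less_le_trans[rotated])
qed

lemma hitting_time_nonneg: "0 \<le> hitting_time a b w"
  unfolding hitting_time_def by (rule INF_greatest) simp

lemma at_hitting_time:
  fixes w :: "real \<Rightarrow> real"
  assumes w: "continuous_on {0..} w" and w0: "w 0 \<in> {a<..<b}" and T: "hitting_time a b w = ereal T"
  shows "w T \<in> {a, b}"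
proof -
  have T0: "0 \<le> T" using hitting_time_nonneg[of a b w] T by simp
  have "\<not> ereal T < hitting_time a b w" using T by simp
  then have "\<exists>r\<in>{0..T}. w r \<notin> {a<..<b}" using less_hitting_time_iff[OF w w0 T0] by blast
  then obtain r where r: "0 \<le> r" "r \<le> T" "w r \<notin> {a<..<b}" by (auto simp only: atLeastAtMost_iff)
  then obtain t where t: "0 \<le> t" "t \<le> r" "w t \<in> {a, b}" using exit_imp_hit[OF w w0] by blast
  then have "hitting_time a b w \<le> ereal t" unfolding hitting_time_def by (intro INF_lower) auto
  then have "t = T" using t r T by simp
  then show ?thesis using t by simp
qed

section \<open>Optional stopping of exponential martingales\<close>

text \<open>One cycle: a Brownian motion with drift, started at \<open>x\<close> between the boundary points.\<close>
locale drifted_bm = prob_space M for M :: "'w measure" +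
  fixes B :: "real \<Rightarrow> 'w \<Rightarrow> real" and x \<sigma> \<mu> a b :: real
  assumes bm: "standard_brownian_motion M B" and start: "x \<in> {a<..<b}"
begin

definition W :: "real \<Rightarrow> 'w \<Rightarrow> real" where "W s \<omega> = x + \<sigma> * B s \<omega> + \<mu> * s"

definition exit_time :: "'w \<Rightarrow> ereal" where "exit_time \<omega> = hitting_time a b (\<lambda>s. W s \<omega>)"

definition exp_martingale :: "complex \<Rightarrow> real \<Rightarrow> 'w \<Rightarrow> complex" where
  "exp_martingale \<zeta> s \<omega> = exp (\<zeta> * of_real (B s \<omega>) - \<zeta>\<^sup>2 * of_real s / 2)"

lemma B_measurable: "0 \<le> s \<Longrightarrow> B s \<in> borel_measurable M"
  using bm unfolding standard_brownian_motion_def by blast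

lemma B_0: "\<omega> \<in> space M \<Longrightarrow> B 0 \<omega> = 0"
  using bm unfolding standard_brownian_motion_def by blast

lemma B_continuous: "\<omega> \<in> space M \<Longrightarrow> continuous_on {0..} (\<lambda>s. B s \<omega>)"
  using bm unfolding standard_brownian_motion_def by blast

lemma B_increment: "0 \<le> s \<Longrightarrow> s < t \<Longrightarrow> distributed M lborel (\<lambda>\<omega>. B t \<omega> - B s \<omega>) (normal_density 0 (sqrt (t - s)))"
  using bm unfolding standard_brownian_motion_def by blast

lemma B_indep: "0 \<le> u (0::nat) \<Longrightarrow> incseq u \<Longrightarrow> indep_vars (\<lambda>_. borel) (\<lambda>k \<omega>. B (u (Suc k)) \<omega> - B (u k) \<omega>) UNIV"
  using bm unfolding standard_brownian_motion_def by blast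

lemma W_0: "\<omega> \<in> space M \<Longrightarrow> W 0 \<omega> \<in> {a<..<b}"
  using start by (simp add: W_def B_0)

lemma W_continuous: "\<omega> \<in> space M \<Longrightarrow> continuous_on {0..} (\<lambda>s. W s \<omega>)"
  unfolding W_def by (intro continuous_intros B_continuous)

lemma exp_martingale_measurable: "0 \<le> s \<Longrightarrow> exp_martingale \<zeta> s \<in> borel_measurable M"
proof -
  assume "0 \<le> s"
  from B_measurable[OF this] have [measurable]: "B s \<in> borel_measurable M" .
  have [measurable]: "(\<lambda>z. exp z :: complex) \<in> borel_measurable borel"
    by (intro borel_measurable_continuous_onI continuous_intros)
  show ?thesis unfolding exp_martingale_def by measurable
qed

lemma exp_martingale_continuous: "\<omega> \<in> space M \<Longrightarrow> continuous_on {0..} (\<lambda>s. exp_martingale \<zeta> s \<omega>)"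
  unfolding exp_martingale_def by (intro continuous_intros B_continuous) auto

lemma increment_moment:
  fixes \<zeta> :: complex
  assumes "0 \<le> s" "s < t"
  shows "integrable M (\<lambda>\<omega>. exp (\<zeta> * of_real (B t \<omega> - B s \<omega>) - \<zeta>\<^sup>2 * of_real (t - s) / 2))"
    and "(\<integral>\<omega>. exp (\<zeta> * of_real (B t \<omega> - B s \<omega>) - \<zeta>\<^sup>2 * of_real (t - s) / 2) \<partial>M) = 1"
proof -
  have ts: "t - s > 0" using assms by simp
  have e: "exp (\<zeta> * of_real (B t \<omega> - B s \<omega>) - \<zeta>\<^sup>2 * of_real (t - s) / 2) =
     exp (- \<zeta>\<^sup>2 * of_real (t - s) / 2) * exp (\<zeta> * of_real (B t \<omega> - B s \<omega>))" for \<omega>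
    unfolding mult_exp_exp by (rule arg_cong[of _ _ exp]) simp
  show "integrable M (\<lambda>\<omega>. exp (\<zeta> * of_real (B t \<omega> - B s \<omega>) - \<zeta>\<^sup>2 * of_real (t - s) / 2))"
    unfolding e by (intro integrable_mult_right normal_exp_moment(1)[OF ts B_increment[OF assms]])
  show "(\<integral>\<omega>. exp (\<zeta> * of_real (B t \<omega> - B s \<omega>) - \<zeta>\<^sup>2 * of_real (t - s) / 2) \<partial>M) = 1"
    unfolding e integral_mult_right_zero normal_exp_moment(2)[OF ts B_increment[OF assms]]
    by (subst mult_exp_exp) simp
qed

lemma exp_martingale_moment:
  assumes s: "0 \<le> s"
  shows "integrable M (exp_martingale \<zeta> s)" "(\<integral>\<omega>. exp_martingale \<zeta> s \<omega> \<partial>M) = 1"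
proof -
  have "integrable M (exp_martingale \<zeta> s) \<and> (\<integral>\<omega>. exp_martingale \<zeta> s \<omega> \<partial>M) = 1"
  proof (cases "s = 0")
    case True
    have e: "exp_martingale \<zeta> 0 \<omega> = 1" if "\<omega> \<in> space M" for \<omega> by (simp add: exp_martingale_def B_0[OF that])
    have "integrable M (exp_martingale \<zeta> 0) \<longleftrightarrow> integrable M (\<lambda>\<omega>. 1 :: complex)"
      by (rule Bochner_Integration.integrable_cong) (simp_all add: e)
    moreover have "(\<integral>\<omega>. exp_martingale \<zeta> 0 \<omega> \<partial>M) = (\<integral>\<omega>. 1 \<partial>M)"
      by (rule Bochner_Integration.integral_cong) (simp_all add: e)
    ultimately show ?thesis using True by (simp add: prob_space)
  next
    case False
    then have s: "0 < s" using s by simp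
    have e: "exp_martingale \<zeta> s \<omega> = exp (\<zeta> * of_real (B s \<omega> - B 0 \<omega>) - \<zeta>\<^sup>2 * of_real (s - 0) / 2)" if "\<omega> \<in> space M" for \<omega>
      by (simp add: exp_martingale_def B_0[OF that])
    note * = increment_moment[OF order_refl s, of \<zeta>]
    have "integrable M (exp_martingale \<zeta> s)"
      using *(1) by (subst Bochner_Integration.integrable_cong[OF refl e])
    moreover have "(\<integral>\<omega>. exp_martingale \<zeta> s \<omega> \<partial>M) = 1"
      unfolding *(2)[symmetric] by (rule Bochner_Integration.integral_cong[OF refl e])
    ultimately show ?thesis by simp
  qed
  then show "integrable M (exp_martingale \<zeta> s)" "(\<integral>\<omega>. exp_martingale \<zeta> s \<omega> \<partial>M) = 1" by auto
qed

text \<open>The event that the path is in \<open>[p, q]\<close> at the grid times up to \<open>s\<close> and the martingale at \<open>s\<close> depend only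
  on increments before \<open>s\<close>. The relative increment of the martingale from \<open>s\<close> to \<open>t\<close> is independent of
  them and has mean one.\<close>
lemma exp_martingale_grid_increment:
  assumes s: "0 \<le> s" "s < t" and m: "0 < m"
  shows "(\<integral>\<omega>. of_bool (\<forall>j\<le>m. W (s * (real j / real m)) \<omega> \<in> {p..q}) * (exp_martingale \<zeta> t \<omega> - exp_martingale \<zeta> s \<omega>) \<partial>M) = 0"
proof -
  \<comment> \<open>grid of mesh \<open>s / m\<close> on \<open>[0, s]\<close>, continued by \<open>t\<close>; increment \<open>m\<close> leads from \<open>s\<close> to \<open>t\<close>\<close>
  define u where "u j = (if j \<le> m then s * (real j / real m) else t)" for j
  define Z where "Z j \<omega> = B (u (Suc j)) \<omega> - B (u j) \<omega>" for j \<omega>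
  have u_le: "s * (real j / real m) \<le> s" if "j \<le> m" for j
    using that s m by (intro mult_left_le) auto
  have "incseq u"
    unfolding incseq_def
  proof (intro allI impI)
    fix i j :: nat assume ij: "i \<le> j"
    show "u i \<le> u j"
    proof (cases "j \<le> m")
      case True
      then show ?thesis using ij s m by (auto simp: u_def intro!: mult_left_mono divide_right_mono)
    next
      case False
      then show ?thesis using u_le[of i] s by (auto simp: u_def)
    qed
  qed
  moreover have u0: "u 0 = 0" by (simp add: u_def)
  ultimately have ind: "indep_vars (\<lambda>_. borel) Z UNIV"
    unfolding Z_def by (intro B_indep) auto
  have um: "u m = s" "u (Suc m) = t" using m by (auto simp: u_def)
  have tele: "(\<Sum>i<j. Z i \<omega>) = B (u j) \<omega>" if "\<omega> \<in> space M" for j \<omega>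
    using sum_lessThan_telescope[of "\<lambda>i. B (u i) \<omega>" j] by (simp add: Z_def u0 B_0[OF that])
  define H :: "(nat \<Rightarrow> real) \<Rightarrow> complex" where
    "H z = of_bool (\<forall>j\<in>{..m}. x + \<sigma> * (\<Sum>i<j. z i) + \<mu> * u j \<in> {p..q}) * exp (\<zeta> * of_real (\<Sum>i<m. z i) - \<zeta>\<^sup>2 * of_real s / 2)" for z
  define E :: "(nat \<Rightarrow> real) \<Rightarrow> complex" where
    "E z = exp (\<zeta> * of_real (z m) - \<zeta>\<^sup>2 * of_real (t - s) / 2) - 1" for z
  have [measurable]: "(\<lambda>z. exp z :: complex) \<in> borel_measurable borel"
    by (intro borel_measurable_continuous_onI continuous_intros)
  have sum_m: "(\<lambda>z. \<Sum>i<j. z i) \<in> borel_measurable (PiM {..<m} (\<lambda>_. borel :: real measure))" if "j \<le> m" for j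
    using that by (intro borel_measurable_sum measurable_component_singleton) auto
  have H: "H \<in> borel_measurable (PiM {..<m} (\<lambda>_. borel))"
  proof -
    have 1: "Measurable.pred (PiM {..<m} (\<lambda>_. borel)) (\<lambda>z. x + \<sigma> * (\<Sum>i<j. z i) + \<mu> * u j \<in> {p..q})" if "j \<in> {..m}" for j
    proof -
      have [measurable]: "(\<lambda>z. \<Sum>i<j. z i) \<in> borel_measurable (PiM {..<m} (\<lambda>_. borel :: real measure))"
        using that by (intro sum_m) auto
      show ?thesis by measurable
    qed
    have [measurable]: "Measurable.pred (PiM {..<m} (\<lambda>_. borel)) (\<lambda>z. \<forall>j\<in>{..m}. x + \<sigma> * (\<Sum>i<j. z i) + \<mu> * u j \<in> {p..q})"
      by (rule pred_intros_finite(3)) (use 1 in auto)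
    note sum_m[OF order_refl, measurable]
    have [measurable]: "(of_bool :: bool \<Rightarrow> complex) \<in> borel_measurable (count_space UNIV)" by simp
    show ?thesis unfolding H_def by measurable
  qed
  have E: "E \<in> borel_measurable (PiM {m} (\<lambda>_. borel))"
  proof -
    have [measurable]: "(\<lambda>z. z m) \<in> borel_measurable (PiM {m} (\<lambda>_. borel :: real measure))"
      by (rule measurable_component_singleton) simp
    show ?thesis unfolding E_def by measurable
  qed
  have "indep_var borel (H \<circ> (\<lambda>\<omega>. restrict (\<lambda>i. Z i \<omega>) {..<m})) borel (E \<circ> (\<lambda>\<omega>. restrict (\<lambda>i. Z i \<omega>) {m}))"
    by (rule indep_var_compose[OF indep_var_restrict[OF ind] H E]) auto
  then have iv: "indep_var borel (\<lambda>\<omega>. H (restrict (\<lambda>i. Z i \<omega>) {..<m})) borel (\<lambda>\<omega>. E (restrict (\<lambda>i. Z i \<omega>) {m}))"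
    by (simp add: comp_def)
  have HZ: "H (restrict (\<lambda>i. Z i \<omega>) {..<m}) = of_bool (\<forall>j\<le>m. W (s * (real j / real m)) \<omega> \<in> {p..q}) * exp_martingale \<zeta> s \<omega>"
    if "\<omega> \<in> space M" for \<omega>
  proof -
    have "(\<Sum>i<j. restrict (\<lambda>i. Z i \<omega>) {..<m} i) = B (u j) \<omega>" if "j \<le> m" for j
      using that tele[OF \<open>\<omega> \<in> space M\<close>, of j] by simp
    then have "(\<forall>j\<in>{..m}. x + \<sigma> * (\<Sum>i<j. restrict (\<lambda>i. Z i \<omega>) {..<m} i) + \<mu> * u j \<in> {p..q}) \<longleftrightarrow>
        (\<forall>j\<le>m. W (s * (real j / real m)) \<omega> \<in> {p..q})"
      and "(\<Sum>i<m. restrict (\<lambda>i. Z i \<omega>) {..<m} i) = B s \<omega>"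
      using um by (auto simp: W_def u_def)
    then show ?thesis unfolding H_def exp_martingale_def by (simp only:)
  qed
  have EZ: "E (restrict (\<lambda>i. Z i \<omega>) {m}) = exp (\<zeta> * of_real (B t \<omega> - B s \<omega>) - \<zeta>\<^sup>2 * of_real (t - s) / 2) - 1" for \<omega>
    unfolding E_def by (simp add: Z_def um)
  have iE: "integrable M (\<lambda>\<omega>. E (restrict (\<lambda>i. Z i \<omega>) {m}))"
    unfolding EZ using increment_moment(1)[OF s] by simp
  have iH: "integrable M (\<lambda>\<omega>. H (restrict (\<lambda>i. Z i \<omega>) {..<m}))"
  proof (rule Bochner_Integration.integrable_bound[OF exp_martingale_moment(1)[OF s(1), of \<zeta>]])
    show "(\<lambda>\<omega>. H (restrict (\<lambda>i. Z i \<omega>) {..<m})) \<in> borel_measurable M"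
      using indep_var_rv1[OF iv] .
    show "AE \<omega> in M. norm (H (restrict (\<lambda>i. Z i \<omega>) {..<m})) \<le> norm (exp_martingale \<zeta> s \<omega>)"
      by (intro AE_I2) (simp add: HZ norm_mult)
  qed
  have "(\<integral>\<omega>. of_bool (\<forall>j\<le>m. W (s * (real j / real m)) \<omega> \<in> {p..q}) * (exp_martingale \<zeta> t \<omega> - exp_martingale \<zeta> s \<omega>) \<partial>M) =
     (\<integral>\<omega>. H (restrict (\<lambda>i. Z i \<omega>) {..<m}) * E (restrict (\<lambda>i. Z i \<omega>) {m}) \<partial>M)"
  proof (rule Bochner_Integration.integral_cong[OF refl])
    fix \<omega> assume \<omega>: "\<omega> \<in> space M"
    have "exp_martingale \<zeta> t \<omega> = exp_martingale \<zeta> s \<omega> * exp (\<zeta> * of_real (B t \<omega> - B s \<omega>) - \<zeta>\<^sup>2 * of_real (t - s) / 2)"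
      unfolding exp_martingale_def mult_exp_exp by (rule arg_cong[of _ _ exp]) (simp add: field_simps)
    then show "of_bool (\<forall>j\<le>m. W (s * (real j / real m)) \<omega> \<in> {p..q}) * (exp_martingale \<zeta> t \<omega> - exp_martingale \<zeta> s \<omega>) =
       H (restrict (\<lambda>i. Z i \<omega>) {..<m}) * E (restrict (\<lambda>i. Z i \<omega>) {m})"
      unfolding HZ[OF \<omega>] EZ by (simp add: algebra_simps)
  qed
  also have "\<dots> = (\<integral>\<omega>. H (restrict (\<lambda>i. Z i \<omega>) {..<m}) \<partial>M) * (\<integral>\<omega>. E (restrict (\<lambda>i. Z i \<omega>) {m}) \<partial>M)"
    by (rule indep_var_lebesgue_integral[OF iv iH iE])
  also have "(\<integral>\<omega>. E (restrict (\<lambda>i. Z i \<omega>) {m}) \<partial>M) = 0"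
    unfolding EZ using increment_moment[OF s, of \<zeta>] by (simp add: prob_space)
  finally show ?thesis by simp
qed


lemma grid_survival_measurable:
  assumes B': "\<And>r. 0 \<le> r \<Longrightarrow> B r \<in> borel_measurable M'" and s: "0 \<le> s"
  shows "(\<lambda>\<omega>. of_bool (\<forall>j\<le>Suc n. W (s * (real j / real (Suc n))) \<omega> \<in> {p..q}) :: real) \<in> borel_measurable M'"
proof -
  have 1: "Measurable.pred M' (\<lambda>\<omega>. W (s * (real j / real (Suc n))) \<omega> \<in> {p..q})" for j
  proof -
    have [measurable]: "B (s * (real j / real (Suc n))) \<in> borel_measurable M'" by (rule B') (use s in auto)
    show ?thesis unfolding W_def by measurable
  qed
  have [measurable]: "Measurable.pred M' (\<lambda>\<omega>. \<forall>j\<in>{..Suc n}. W (s * (real j / real (Suc n))) \<omega> \<in> {p..q})"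
    by (rule pred_intros_finite(3)) (use 1 in auto)
  have "(\<lambda>\<omega>. of_bool (\<forall>j\<in>{..Suc n}. W (s * (real j / real (Suc n))) \<omega> \<in> {p..q}) :: real) \<in> borel_measurable M'"
    by measurable
  then show ?thesis by (simp only: Ball_def atMost_iff)
qed

text \<open>The sigma-algebra is a parameter, because exit times are needed as functions of the path of their
  own cycle alone. This is what makes different cycles independent.\<close>
lemma survival_measurable:
  fixes M' :: "'w measure"
  assumes sp: "space M' = space M" and B': "\<And>r. 0 \<le> r \<Longrightarrow> B r \<in> borel_measurable M'" and s: "0 \<le> s"
  shows "(\<lambda>\<omega>. of_bool (\<forall>r\<in>{0..s}. W r \<omega> \<in> {a<..<b}) :: real) \<in> borel_measurable M'"
proof -
  note grid = grid_survival_measurable[OF B' s]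
  have c: "continuous_on {0..s} (\<lambda>r. W r \<omega>)" if "\<omega> \<in> space M'" for \<omega>
    using that sp by (intro continuous_on_subset[OF W_continuous]) auto
  have closed: "(\<lambda>\<omega>. of_bool (\<forall>r\<in>{0..s}. W r \<omega> \<in> {p..q}) :: real) \<in> borel_measurable M'" for p q
    by (rule borel_measurable_LIMSEQ_real[OF grid_stays_tendsto[OF c s] grid])
  show ?thesis
    by (rule borel_measurable_LIMSEQ_real[OF shrinking_stays_tendsto[OF c s] closed])
qed

lemma less_exit_time_iff:
  assumes "\<omega> \<in> space M" "0 \<le> s"
  shows "ereal s < exit_time \<omega> \<longleftrightarrow> (\<forall>r\<in>{0..s}. W r \<omega> \<in> {a<..<b})"
  unfolding exit_time_def by (rule less_hitting_time_iff[OF W_continuous W_0]) (use assms in auto)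

lemma exit_time_measurable:
  fixes M' :: "'w measure"
  assumes sp: "space M' = space M" and B': "\<And>r. 0 \<le> r \<Longrightarrow> B r \<in> borel_measurable M'"
  shows "exit_time \<in> borel_measurable M'"
proof (rule borel_measurableI_greater)
  fix y :: ereal
  show "{\<omega> \<in> space M'. y < exit_time \<omega>} \<in> sets M'"
  proof (cases y)
    case (real s)
    show ?thesis
    proof (cases "0 \<le> s")
      case True
      have [measurable]: "(\<lambda>\<omega>. of_bool (\<forall>r\<in>{0..s}. W r \<omega> \<in> {a<..<b}) :: real) \<in> borel_measurable M'"
        by (rule survival_measurable[OF sp B' True])
      have "{\<omega> \<in> space M'. y < exit_time \<omega>} = {\<omega> \<in> space M'. of_bool (\<forall>r\<in>{0..s}. W r \<omega> \<in> {a<..<b}) = (1::real)}"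
        using less_exit_time_iff[OF _ True] real sp by (simp only: of_bool_eq_1_iff) blast
      also have "\<dots> \<in> sets M'" by measurable
      finally show ?thesis .
    next
      case False
      then have "y < 0" using real by simp
      then have "y < exit_time \<omega>" for \<omega>
        using hitting_time_nonneg unfolding exit_time_def by (rule less_le_trans)
      then show ?thesis by simp
    qed
  next
    case PInf then show ?thesis by simp
  next
    case MInf
    then have "y < 0" by simp
    then have "y < exit_time \<omega>" for \<omega>
      using hitting_time_nonneg unfolding exit_time_def by (rule less_le_trans)
    then show ?thesis by simp
  qed
qed

text \<open>The martingale property restricted to the event that no boundary point is hit before \<open>s\<close>, obtained
  from grids by two bounded limits.\<close>
lemma exp_martingale_survival_increment:
  assumes s: "0 \<le> s" "s < t"
  shows "(\<integral>\<omega>. of_bool (ereal s < exit_time \<omega>) * (exp_martingale \<zeta> t \<omega> - exp_martingale \<zeta> s \<omega>) \<partial>M) = 0"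
proof -
  let ?D = "\<lambda>\<omega>. exp_martingale \<zeta> t \<omega> - exp_martingale \<zeta> s \<omega>"
  have t: "0 \<le> t" using s by simp
  note exp_martingale_measurable[OF s(1), of \<zeta>, measurable] exp_martingale_measurable[OF t, of \<zeta>, measurable]
  have iD: "integrable M (\<lambda>\<omega>. norm (?D \<omega>))"
    using exp_martingale_moment(1)[OF s(1), of \<zeta>] exp_martingale_moment(1)[OF t, of \<zeta>] by simp
  have c: "continuous_on {0..s} (\<lambda>r. W r \<omega>)" if "\<omega> \<in> space M" for \<omega>
    using that by (intro continuous_on_subset[OF W_continuous]) auto
  have bool_real: "(of_bool P :: complex) = of_real (of_bool P)" for P by simp
  have pass: "(\<integral>\<omega>. of_bool (P \<omega>) * ?D \<omega> \<partial>M) = 0"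
    if Q: "\<And>n. (\<integral>\<omega>. of_bool (Q n \<omega>) * ?D \<omega> \<partial>M) = 0"
      and lim: "\<And>\<omega>. \<omega> \<in> space M \<Longrightarrow> (\<lambda>n. of_bool (Q n \<omega>) :: real) \<longlonglongrightarrow> of_bool (P \<omega>)"
      and m: "\<And>n. (\<lambda>\<omega>. of_bool (Q n \<omega>) :: real) \<in> borel_measurable M"
    for P and Q :: "nat \<Rightarrow> 'w \<Rightarrow> bool"
  proof -
    have mP: "(\<lambda>\<omega>. of_bool (P \<omega>) :: real) \<in> borel_measurable M"
      by (rule borel_measurable_LIMSEQ_real[OF lim m])
    have "(\<lambda>n. \<integral>\<omega>. of_real (of_bool (Q n \<omega>)) * ?D \<omega> \<partial>M) \<longlonglongrightarrow> (\<integral>\<omega>. of_real (of_bool (P \<omega>)) * ?D \<omega> \<partial>M)"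
    proof (rule integral_dominated_convergence[OF _ _ iD])
      show "(\<lambda>\<omega>. of_real (of_bool (P \<omega>)) * ?D \<omega>) \<in> borel_measurable M"
        using mP by measurable
      show "(\<lambda>\<omega>. of_real (of_bool (Q n \<omega>)) * ?D \<omega>) \<in> borel_measurable M" for n
        using m[of n] by measurable
      show "AE \<omega> in M. (\<lambda>n. of_real (of_bool (Q n \<omega>)) * ?D \<omega>) \<longlonglongrightarrow> of_real (of_bool (P \<omega>)) * ?D \<omega>"
        by (intro AE_I2 tendsto_mult tendsto_of_real tendsto_const lim)
      show "AE \<omega> in M. norm (of_real (of_bool (Q n \<omega>)) * ?D \<omega>) \<le> norm (?D \<omega>)" for n
        by (intro AE_I2) (simp add: norm_mult)
    qed
    then have "(\<lambda>n::nat. 0) \<longlonglongrightarrow> (\<integral>\<omega>. of_bool (P \<omega>) * ?D \<omega> \<partial>M)"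
      unfolding bool_real[symmetric] Q .
    then show ?thesis by (simp add: LIMSEQ_const_iff)
  qed
  note grid_meas = grid_survival_measurable[OF B_measurable s(1)]
  have closed: "(\<integral>\<omega>. of_bool (\<forall>r\<in>{0..s}. W r \<omega> \<in> {p..q}) * ?D \<omega> \<partial>M) = 0" for p q
    by (rule pass[OF _ grid_stays_tendsto[OF c s(1)] grid_meas]) (rule exp_martingale_grid_increment[OF s], simp)
  have closed_meas: "(\<lambda>\<omega>. of_bool (\<forall>r\<in>{0..s}. W r \<omega> \<in> {p..q}) :: real) \<in> borel_measurable M" for p q
    by (rule borel_measurable_LIMSEQ_real[OF grid_stays_tendsto[OF c s(1)] grid_meas])
  have "(\<integral>\<omega>. of_bool (\<forall>r\<in>{0..s}. W r \<omega> \<in> {a<..<b}) * ?D \<omega> \<partial>M) = 0"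
    by (rule pass[OF closed shrinking_stays_tendsto[OF c s(1)] closed_meas])
  moreover have "(\<integral>\<omega>. of_bool (ereal s < exit_time \<omega>) * ?D \<omega> \<partial>M) =
      (\<integral>\<omega>. of_bool (\<forall>r\<in>{0..s}. W r \<omega> \<in> {a<..<b}) * ?D \<omega> \<partial>M)"
    by (rule Bochner_Integration.integral_cong[OF refl]) (simp only: less_exit_time_iff[OF _ s(1)])
  ultimately show ?thesis by simp
qed

definition stop_time :: "real \<Rightarrow> 'w \<Rightarrow> real" where
  "stop_time t \<omega> = real_of_ereal (min (exit_time \<omega>) (ereal t))"

lemma exit_time_nonneg: "0 \<le> exit_time \<omega>"
  unfolding exit_time_def by (rule hitting_time_nonneg)

lemma stop_time_ereal: "0 \<le> t \<Longrightarrow> ereal (stop_time t \<omega>) = min (exit_time \<omega>) (ereal t)"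
  using exit_time_nonneg[of \<omega>] unfolding stop_time_def
  by (intro ereal_real') (cases "exit_time \<omega>"; auto simp: min_def)

lemma stop_time_bounds: assumes "0 \<le> t" shows "0 \<le> stop_time t \<omega>" "stop_time t \<omega> \<le> t"
proof -
  have "ereal 0 \<le> ereal (stop_time t \<omega>)"
    unfolding stop_time_ereal[OF assms] using exit_time_nonneg[of \<omega>] assms by (simp add: zero_ereal_def)
  then show "0 \<le> stop_time t \<omega>" by simp
  have "ereal (stop_time t \<omega>) \<le> ereal t"
    unfolding stop_time_ereal[OF assms] by simp
  then show "stop_time t \<omega> \<le> t" by simp
qed

text \<open>The martingale at the first grid time at which the exit has happened, or at \<open>t\<close>, written as a sum
  of increments over the grid times before the exit.\<close>
definition stopped_sum :: "complex \<Rightarrow> real \<Rightarrow> nat \<Rightarrow> 'w \<Rightarrow> complex" where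
  "stopped_sum \<zeta> t m \<omega> = exp_martingale \<zeta> 0 \<omega> + (\<Sum>j<m. of_bool (ereal (t * (real j / real m)) < exit_time \<omega>) *
     (exp_martingale \<zeta> (t * (real (Suc j) / real m)) \<omega> - exp_martingale \<zeta> (t * (real j / real m)) \<omega>))"

lemma stopped_sum_moment:
  assumes t: "0 < t" and m: "0 < m"
  shows "integrable M (stopped_sum \<zeta> t m)" "(\<integral>\<omega>. stopped_sum \<zeta> t m \<omega> \<partial>M) = 1"
proof -
  have [measurable]: "exit_time \<in> borel_measurable M" by (rule exit_time_measurable[OF refl B_measurable])
  have nn: "0 \<le> t * (real j / real m)" for j using t by simp
  have less: "t * (real j / real m) < t * (real (Suc j) / real m)" for j
    using t m by (intro mult_strict_left_mono divide_strict_right_mono) auto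
  have int: "integrable M (\<lambda>\<omega>. of_bool (ereal (t * (real j / real m)) < exit_time \<omega>) *
     (exp_martingale \<zeta> (t * (real (Suc j) / real m)) \<omega> - exp_martingale \<zeta> (t * (real j / real m)) \<omega>))" for j
  proof (rule Bochner_Integration.integrable_bound)
    show i: "integrable M (\<lambda>\<omega>. exp_martingale \<zeta> (t * (real (Suc j) / real m)) \<omega> - exp_martingale \<zeta> (t * (real j / real m)) \<omega>)"
      by (intro Bochner_Integration.integrable_diff exp_martingale_moment nn)
    note borel_measurable_integrable[OF i, measurable]
    show "(\<lambda>\<omega>. of_bool (ereal (t * (real j / real m)) < exit_time \<omega>) *
       (exp_martingale \<zeta> (t * (real (Suc j) / real m)) \<omega> - exp_martingale \<zeta> (t * (real j / real m)) \<omega>)) \<in> borel_measurable M"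
      by measurable
  qed (auto simp: norm_mult)
  show "integrable M (stopped_sum \<zeta> t m)"
    unfolding stopped_sum_def
    by (intro Bochner_Integration.integrable_add Bochner_Integration.integrable_sum int exp_martingale_moment) simp
  show "(\<integral>\<omega>. stopped_sum \<zeta> t m \<omega> \<partial>M) = 1"
    unfolding stopped_sum_def
      Bochner_Integration.integral_add[OF exp_martingale_moment(1)[OF order_refl] Bochner_Integration.integrable_sum[OF int]]
      Bochner_Integration.integral_sum[OF int] exp_martingale_survival_increment[OF nn less] exp_martingale_moment(2)[OF order_refl]
    by simp
qed

text \<open>The time \<open>r\<close> at which the discretisation stops does not depend on the exponent \<open>\<zeta>\<close>. This permits the
  comparison of two martingales at the same time in the proof of optional stopping.\<close>
lemma stopped_sum_eq:
  assumes t: "0 < t" and m: "0 < m"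
  obtains r where "0 \<le> r" "stop_time t \<omega> \<le> r" "r \<le> t" "r \<le> stop_time t \<omega> + t / real m"
    "\<And>\<zeta>. stopped_sum \<zeta> t m \<omega> = exp_martingale \<zeta> r \<omega>"
proof -
  define P where "P j \<longleftrightarrow> j = m \<or> exit_time \<omega> \<le> ereal (t * (real j / real m))" for j
  define J where "J = (LEAST j. P j)"
  have PJ: "P J" unfolding J_def by (rule LeastI[of P m]) (simp add: P_def)
  have Jm: "J \<le> m" unfolding J_def by (rule Least_le) (simp add: P_def)
  have below: "ereal (t * (real j / real m)) < exit_time \<omega>" if "j < J" for j
    using not_less_Least[of j P] that by (auto simp: J_def P_def not_le)
  have above: "\<not> ereal (t * (real j / real m)) < exit_time \<omega>" if "J \<le> j" "j < m" for j
  proof -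
    have "exit_time \<omega> \<le> ereal (t * (real J / real m))" using PJ that by (auto simp: P_def)
    also have "\<dots> \<le> ereal (t * (real j / real m))"
      using that t by (simp add: divide_right_mono mult_left_mono)
    finally show ?thesis by simp
  qed
  define r where "r = t * (real J / real m)"
  have st: "ereal (stop_time t \<omega>) = min (exit_time \<omega>) (ereal t)" using stop_time_ereal t by simp
  have r0: "0 \<le> r" using t by (simp add: r_def)
  have rt: "r \<le> t" unfolding r_def using t Jm m by (intro mult_left_le) auto
  have "ereal (stop_time t \<omega>) \<le> ereal r"
  proof (cases "J = m")
    case True then show ?thesis unfolding st r_def using m by simp
  next
    case False then show ?thesis unfolding st r_def using PJ by (simp add: P_def min.coboundedI1 del: times_divide_eq_right)
  qed
  then have 1: "stop_time t \<omega> \<le> r" by simp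
  have 2: "r \<le> stop_time t \<omega> + t / real m"
  proof (cases J)
    case 0 then show ?thesis using stop_time_bounds[of t \<omega>] t by (simp add: r_def)
  next
    case (Suc i)
    have "ereal (t * (real i / real m)) \<le> ereal (stop_time t \<omega>)"
      unfolding st using below[of i] Suc Jm t m
      by (intro min.boundedI) (auto intro!: mult_left_le simp del: times_divide_eq_right)
    then have "t * (real i / real m) \<le> stop_time t \<omega>" by simp
    then show ?thesis using Suc m by (simp add: r_def field_simps)
  qed
  have 3: "stopped_sum \<zeta> t m \<omega> = exp_martingale \<zeta> r \<omega>" for \<zeta>
  proof -
    let ?f = "\<lambda>j. exp_martingale \<zeta> (t * (real j / real m)) \<omega>"
    have "(\<Sum>j<m. of_bool (ereal (t * (real j / real m)) < exit_time \<omega>) * (?f (Suc j) - ?f j)) =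
        (\<Sum>j<J. of_bool (ereal (t * (real j / real m)) < exit_time \<omega>) * (?f (Suc j) - ?f j))"
      using Jm above by (intro sum.mono_neutral_right) (auto simp del: times_divide_eq_right)
    also have "\<dots> = (\<Sum>j<J. ?f (Suc j) - ?f j)"
      using below by (intro sum.cong) (auto simp del: times_divide_eq_right)
    also have "\<dots> = ?f J - ?f 0" by (rule sum_lessThan_telescope)
    finally show ?thesis unfolding stopped_sum_def r_def by simp
  qed
  show thesis by (rule that[OF r0 1 rt 2 3])
qed

text \<open>The square of the modulus is, up to a bounded factor, the real exponential martingale with doubled
  exponent.\<close>
lemma exp_martingale_square:
  assumes "0 \<le> r" "r \<le> t"
  shows "(norm (exp_martingale \<zeta> r \<omega>))\<^sup>2 \<le> exp (4 * (norm \<zeta>)\<^sup>2 * t) * Re (exp_martingale (of_real (2 * Re \<zeta>)) r \<omega>)"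
proof -
  have "(norm (exp_martingale \<zeta> r \<omega>))\<^sup>2 = exp (2 * (Re \<zeta> * B r \<omega> - Re (\<zeta>\<^sup>2) * r / 2))"
    unfolding exp_martingale_def norm_exp_eq_Re power2_eq_square mult_exp_exp by (rule arg_cong[of _ _ exp]) simp
  also have "\<dots> \<le> exp (4 * (norm \<zeta>)\<^sup>2 * t + (2 * Re \<zeta> * B r \<omega> - (2 * Re \<zeta>)\<^sup>2 * r / 2))"
  proof -
    have "(Re \<zeta>)\<^sup>2 \<le> (norm \<zeta>)\<^sup>2" using abs_Re_le_cmod[of \<zeta>] by (simp add: abs_le_square_iff[symmetric])
    moreover have "- Re (\<zeta>\<^sup>2) \<le> (norm \<zeta>)\<^sup>2" using abs_Re_le_cmod[of "\<zeta>\<^sup>2"] by (simp add: norm_power)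
    ultimately have "2 * (Re \<zeta>)\<^sup>2 - Re (\<zeta>\<^sup>2) \<le> 4 * (norm \<zeta>)\<^sup>2" using zero_le_power2[of "norm \<zeta>"] by linarith
    then have "(2 * (Re \<zeta>)\<^sup>2 - Re (\<zeta>\<^sup>2)) * r \<le> (4 * (norm \<zeta>)\<^sup>2) * r" using assms by (intro mult_right_mono)
    also have "\<dots> \<le> (4 * (norm \<zeta>)\<^sup>2) * t" using assms by (intro mult_left_mono) auto
    finally show ?thesis by (simp add: algebra_simps power_mult_distrib)
  qed
  also have "\<dots> = exp (4 * (norm \<zeta>)\<^sup>2 * t) * Re (exp_martingale (of_real (2 * Re \<zeta>)) r \<omega>)"
  proof -
    have "exp_martingale (of_real (2 * Re \<zeta>)) r \<omega> = of_real (exp (2 * Re \<zeta> * B r \<omega> - (2 * Re \<zeta>)\<^sup>2 * r / 2))"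
      unfolding exp_martingale_def by (simp add: exp_of_real[symmetric])
    then show ?thesis by (simp only: Re_complex_of_real exp_add)
  qed
  finally show ?thesis .
qed

text \<open>The discretised stopping times decrease to the stopping time. The martingale is unbounded just after
  the exit, so the passage to the limit uses a bound in \<open>L\<^sup>2\<close>, which optional stopping at grid times of
  the martingale with doubled real exponent provides.\<close>
theorem exp_martingale_optional_stopping:
  assumes t: "0 \<le> t"
  shows "integrable M (\<lambda>\<omega>. exp_martingale \<zeta> (stop_time t \<omega>) \<omega>)" "(\<integral>\<omega>. exp_martingale \<zeta> (stop_time t \<omega>) \<omega> \<partial>M) = 1"
proof -
  have "integrable M (\<lambda>\<omega>. exp_martingale \<zeta> (stop_time t \<omega>) \<omega>) \<and> (\<integral>\<omega>. exp_martingale \<zeta> (stop_time t \<omega>) \<omega> \<partial>M) = 1"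
  proof (cases "t = 0")
    case True
    then have "stop_time t \<omega> = 0" for \<omega> using stop_time_bounds[of 0 \<omega>] by simp
    then show ?thesis using exp_martingale_moment[of 0 \<zeta>] by simp
  next
    case False
    then have t0: "0 < t" using t by simp
    define f where "f n = stopped_sum \<zeta> t (Suc n)" for n
    have f_int: "integrable M (f n)" and f_1: "(\<integral>\<omega>. f n \<omega> \<partial>M) = 1" for n
      unfolding f_def by (rule stopped_sum_moment[OF t0]; simp)+
    have fm [measurable]: "f n \<in> borel_measurable M" for n using f_int by simp
    have lim: "(\<lambda>n. f n \<omega>) \<longlonglongrightarrow> exp_martingale \<zeta> (stop_time t \<omega>) \<omega>" if \<omega>: "\<omega> \<in> space M" for \<omega>
    proof -
      have "\<exists>r. 0 \<le> r \<and> stop_time t \<omega> \<le> r \<and> r \<le> stop_time t \<omega> + t / real (Suc n) \<and> f n \<omega> = exp_martingale \<zeta> r \<omega>" for n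
        unfolding f_def by (rule stopped_sum_eq[OF t0, of "Suc n" \<omega>]) auto
      then obtain r where r: "\<And>n. 0 \<le> r n" "\<And>n. stop_time t \<omega> \<le> r n"
          "\<And>n. r n \<le> stop_time t \<omega> + t / real (Suc n)" "\<And>n. f n \<omega> = exp_martingale \<zeta> (r n) \<omega>" by metis
      have "(\<lambda>n. t * (1 / real (Suc n))) \<longlonglongrightarrow> t * 0"
        by (intro tendsto_mult tendsto_const LIMSEQ_Suc[OF lim_1_over_n])
      then have "(\<lambda>n. stop_time t \<omega> + t / real (Suc n)) \<longlonglongrightarrow> stop_time t \<omega> + 0"
        by (intro tendsto_add tendsto_const) simp
      then have "r \<longlonglongrightarrow> stop_time t \<omega>"
        using r by (intro real_tendsto_sandwich[OF _ _ tendsto_const, of "stop_time t \<omega>" r sequentially "\<lambda>n. stop_time t \<omega> + t / real (Suc n)"]) auto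
      then have "(\<lambda>n. exp_martingale \<zeta> (r n) \<omega>) \<longlonglongrightarrow> exp_martingale \<zeta> (stop_time t \<omega>) \<omega>"
        using r stop_time_bounds[OF t, of \<omega>]
        by (intro continuous_on_tendsto_compose[OF exp_martingale_continuous[OF \<omega>]]) auto
      then show ?thesis using r(4) by simp
    qed
    \<comment> \<open>integrable majorants of the squared moduli, with mean independent of \<open>n\<close>\<close>
    define g where "g n \<omega> = exp (4 * (norm \<zeta>)\<^sup>2 * t) * Re (stopped_sum (of_real (2 * Re \<zeta>)) t (Suc n) \<omega>)" for n \<omega>
    have g_int: "integrable M (g n)" for n
      unfolding g_def by (intro integrable_mult_right integrable_Re stopped_sum_moment(1)[OF t0]) simp
    have g_val: "(\<integral>\<omega>. g n \<omega> \<partial>M) = exp (4 * (norm \<zeta>)\<^sup>2 * t)" for n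
    proof -
      have "(\<integral>\<omega>. Re (stopped_sum (of_real (2 * Re \<zeta>)) t (Suc n) \<omega>) \<partial>M) = Re (\<integral>\<omega>. stopped_sum (of_real (2 * Re \<zeta>)) t (Suc n) \<omega> \<partial>M)"
        by (rule integral_Re[OF stopped_sum_moment(1)[OF t0]]) simp
      also have "\<dots> = 1" by (subst stopped_sum_moment(2)[OF t0]) auto
      finally show ?thesis unfolding g_def integral_mult_right_zero by simp
    qed
    have fg: "(norm (f n \<omega>))\<^sup>2 \<le> g n \<omega>" for n \<omega>
    proof -
      obtain r where "0 \<le> r" "r \<le> t" "\<And>\<zeta>. stopped_sum \<zeta> t (Suc n) \<omega> = exp_martingale \<zeta> r \<omega>"
        by (rule stopped_sum_eq[OF t0, of "Suc n" \<omega>]) auto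
      then show ?thesis unfolding f_def g_def using exp_martingale_square[of r t \<zeta> \<omega>] by simp
    qed
    have f2: "integrable M (\<lambda>\<omega>. (norm (f n \<omega>))\<^sup>2)" for n
      by (rule Bochner_Integration.integrable_bound[OF g_int[of n]]) (use fg[of n] in \<open>auto intro!: order_trans[OF _ abs_ge_self]\<close>)
    have f2C: "(\<integral>\<omega>. (norm (f n \<omega>))\<^sup>2 \<partial>M) \<le> exp (4 * (norm \<zeta>)\<^sup>2 * t)" for n
      unfolding g_val[of n, symmetric] by (intro integral_mono f2 g_int fg)
    have gm: "(\<lambda>\<omega>. exp_martingale \<zeta> (stop_time t \<omega>) \<omega>) \<in> borel_measurable M"
      by (rule borel_measurable_LIMSEQ_metric[OF fm lim])
    note * = L2_bounded_convergence[OF fm gm f2 f2C lim]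
    have "(\<lambda>n::nat. 1) \<longlonglongrightarrow> (\<integral>\<omega>. exp_martingale \<zeta> (stop_time t \<omega>) \<omega> \<partial>M)" using *(2) f_1 by simp
    then show ?thesis using *(1) by (simp add: LIMSEQ_const_iff)
  qed
  then show "integrable M (\<lambda>\<omega>. exp_martingale \<zeta> (stop_time t \<omega>) \<omega>)" "(\<integral>\<omega>. exp_martingale \<zeta> (stop_time t \<omega>) \<omega> \<partial>M) = 1" by auto
qed

text \<open>Minus the symbol of the generator: \<open>exp (c x)\<close> is an eigenfunction with eigenvalue \<open>- decay_rate c\<close>.\<close>
definition decay_rate :: "complex \<Rightarrow> complex" where
  "decay_rate c = - (of_real (\<sigma>\<^sup>2) * c\<^sup>2 / 2 + of_real \<mu> * c)"

lemma exponential_stopping: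
  assumes t: "0 \<le> t"
  shows "integrable M (\<lambda>\<omega>. exp (decay_rate c * of_real (stop_time t \<omega>) + c * of_real (W (stop_time t \<omega>) \<omega>)))"
    and "(\<integral>\<omega>. exp (decay_rate c * of_real (stop_time t \<omega>) + c * of_real (W (stop_time t \<omega>) \<omega>)) \<partial>M) = exp (c * of_real x)"
proof -
  have e: "exp (decay_rate c * of_real r + c * of_real (W r \<omega>)) = exp (c * of_real x) * exp_martingale (c * of_real \<sigma>) r \<omega>" for r \<omega>
    unfolding exp_martingale_def mult_exp_exp decay_rate_def W_def
    by (rule arg_cong[of _ _ exp]) (simp add: algebra_simps power_mult_distrib add_divide_distrib[symmetric])
  show "integrable M (\<lambda>\<omega>. exp (decay_rate c * of_real (stop_time t \<omega>) + c * of_real (W (stop_time t \<omega>) \<omega>)))"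
    unfolding e by (intro integrable_mult_right exp_martingale_optional_stopping t)
  show "(\<integral>\<omega>. exp (decay_rate c * of_real (stop_time t \<omega>) + c * of_real (W (stop_time t \<omega>) \<omega>)) \<partial>M) = exp (c * of_real x)"
    unfolding e integral_mult_right_zero exp_martingale_optional_stopping(2)[OF t] by simp
qed

end

section \<open>Independent cycles that restart at the midpoint\<close>

context drifted_bm begin

lemma W_stop_time:
  assumes \<omega>: "\<omega> \<in> space M" and t: "0 \<le> t"
  shows "exit_time \<omega> \<le> ereal t \<Longrightarrow> exit_time \<omega> = ereal (stop_time t \<omega>) \<and> W (stop_time t \<omega>) \<omega> \<in> {a, b}"
    and "ereal t < exit_time \<omega> \<Longrightarrow> stop_time t \<omega> = t \<and> W t \<omega> \<in> {a<..<b}"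
proof -
  assume "exit_time \<omega> \<le> ereal t"
  then have *: "exit_time \<omega> = ereal (stop_time t \<omega>)" unfolding stop_time_ereal[OF t] by simp
  then show "exit_time \<omega> = ereal (stop_time t \<omega>) \<and> W (stop_time t \<omega>) \<omega> \<in> {a, b}"
    using at_hitting_time[OF W_continuous[OF \<omega>] W_0[OF \<omega>]] unfolding exit_time_def by blast
next
  assume l: "ereal t < exit_time \<omega>"
  then have "ereal (stop_time t \<omega>) = ereal t" unfolding stop_time_ereal[OF t] by simp
  then show "stop_time t \<omega> = t \<and> W t \<omega> \<in> {a<..<b}"
    using l less_exit_time_iff[OF \<omega> t] t by auto
qed

lemma W_stop_time_mem:
  assumes \<omega>: "\<omega> \<in> space M" and t: "0 \<le> t"
  shows "W (stop_time t \<omega>) \<omega> \<in> {a..b}"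
  using W_stop_time[OF \<omega> t] start by (cases "exit_time \<omega> \<le> ereal t") (auto simp: not_le)

lemma exit_time_pos: "\<omega> \<in> space M \<Longrightarrow> 0 < exit_time \<omega>"
  using less_exit_time_iff[of \<omega> 0] W_0[of \<omega>] by (auto simp: zero_ereal_def)

end

text \<open>The path is the limit of its values at the times \<open>k / (i + 1)\<close> just before the given one, and for
  fixed \<open>i\<close> there are countably many of them. Paths are controlled at nonnegative times only.\<close>
lemma jointly_measurable_path:
  fixes w :: "real \<Rightarrow> 'w \<Rightarrow> real"
  assumes w: "\<And>r. 0 \<le> r \<Longrightarrow> w r \<in> borel_measurable N" and c: "\<And>\<omega>. \<omega> \<in> space N \<Longrightarrow> continuous_on {0..} (\<lambda>r. w r \<omega>)"
  shows "(\<lambda>p. w (max 0 (fst p)) (snd p)) \<in> borel_measurable (borel \<Otimes>\<^sub>M N)"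
proof (rule borel_measurable_LIMSEQ_real)
  let ?k = "\<lambda>i (p :: real \<times> 'w). nat \<lfloor>real (Suc i) * max 0 (fst p)\<rfloor>"
  show "(\<lambda>p. w (real (?k i p) / real (Suc i)) (snd p)) \<in> borel_measurable (borel \<Otimes>\<^sub>M N)" for i
  proof (rule measurable_compose_countable[where f = "\<lambda>j p. w (real j / real (Suc i)) (snd p)" and g = "?k i"])
    show "(\<lambda>p. w (real j / real (Suc i)) (snd p)) \<in> borel_measurable (borel \<Otimes>\<^sub>M N)" for j
      by (rule measurable_compose[OF measurable_snd w]) simp
    show "?k i \<in> measurable (borel \<Otimes>\<^sub>M N) (count_space UNIV)" by measurable
  qed
  fix p :: "real \<times> 'w" assume "p \<in> space (borel \<Otimes>\<^sub>M N)"
  then have p: "snd p \<in> space N" by (auto simp: space_pair_measure)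
  define r where "r = max 0 (fst p)"
  have r: "0 \<le> r" by (simp add: r_def)
  have "(\<lambda>i. r - real (nat \<lfloor>real (Suc i) * r\<rfloor>) / real (Suc i)) \<longlonglongrightarrow> 0"
  proof (rule Lim_null_comparison[OF _ LIMSEQ_Suc[OF lim_1_over_n]], intro always_eventually allI)
    fix i
    define k where "k = real (nat \<lfloor>real (Suc i) * r\<rfloor>)"
    have k: "k \<le> r * real (Suc i)" "r * real (Suc i) \<le> k + 1"
      using r unfolding k_def by (simp_all add: mult.commute)
    have "k / real (Suc i) \<le> r" "r \<le> (k + 1) / real (Suc i)"
      by (rule mult_imp_div_pos_le, simp, rule k(1)) (rule mult_imp_le_div_pos, simp, rule k(2))
    then show "norm (r - real (nat \<lfloor>real (Suc i) * r\<rfloor>) / real (Suc i)) \<le> 1 / real (Suc i)"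
      unfolding k_def add_divide_distrib real_norm_def by linarith
  qed
  from tendsto_diff[OF tendsto_const[of r] this]
  have "(\<lambda>i. real (nat \<lfloor>real (Suc i) * r\<rfloor>) / real (Suc i)) \<longlonglongrightarrow> r" by simp
  then show "(\<lambda>i. w (real (?k i p) / real (Suc i)) (snd p)) \<longlonglongrightarrow> w (max 0 (fst p)) (snd p)"
    unfolding r_def[symmetric] using r by (intro continuous_on_tendsto_compose[OF c[OF p]]) auto
qed

context drifted_bm begin

text \<open>For a start at the midpoint, \<open>exp (i \<pi> (y - x) / h)\<close> with \<open>h = (b - a) / 2\<close> is \<open>1\<close> at the start and \<open>-1\<close> at both
  boundary points. Optional stopping keeps its weighted mean equal to one, while an early exit
  contributes a nonpositive real part as long as the rotation by the drift is at most a quarter turn.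
  The bound depends on the coefficients only, so it holds uniformly over all cycles.\<close>
lemma late_exit:
  assumes mid: "x = (a + b) / 2" and \<delta>: "0 \<le> \<delta>" "\<bar>\<mu>\<bar> * (2 * pi / (b - a)) * \<delta> \<le> pi / 2"
  shows "exp (- norm (decay_rate (\<i> * of_real (2 * pi / (b - a)))) * \<delta>) \<le> prob {\<omega> \<in> space M. ereal \<delta> < exit_time \<omega>}"
proof -
  define c where "c = \<i> * of_real (2 * pi / (b - a))"
  define \<theta> where "\<theta> = decay_rate c"
  have ab: "a < b" using start by auto
  have [measurable]: "exit_time \<in> borel_measurable M" by (rule exit_time_measurable[OF refl B_measurable])
  let ?E = "{\<omega> \<in> space M. ereal \<delta> < exit_time \<omega>}"
  have E [measurable]: "?E \<in> sets M" by measurable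
  have Im\<theta>: "Im \<theta> = - (\<mu> * (2 * pi / (b - a)))"
    by (simp add: \<theta>_def decay_rate_def c_def power2_eq_square)
  define f where "f \<omega> = exp (\<theta> * of_real (stop_time \<delta> \<omega>) + c * of_real (W (stop_time \<delta> \<omega>) \<omega>)) * exp (- c * of_real x)" for \<omega>
  note st = exponential_stopping[OF \<delta>(1), of c, folded \<theta>_def]
  have fi: "integrable M f" unfolding f_def by (intro integrable_mult_left st)
  have "(\<integral>\<omega>. f \<omega> \<partial>M) = exp (c * of_real x) * exp (- c * of_real x)"
    unfolding f_def integral_mult_left_zero st(2) ..
  then have f1: "(\<integral>\<omega>. f \<omega> \<partial>M) = 1" by (simp add: mult_exp_exp)
  have bound: "Re (f \<omega>) \<le> exp (norm \<theta> * \<delta>) * indicator ?E \<omega>" if \<omega>: "\<omega> \<in> space M" for \<omega>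
  proof -
    let ?r = "stop_time \<delta> \<omega>"
    have r: "0 \<le> ?r" "?r \<le> \<delta>" using stop_time_bounds[OF \<delta>(1)] by auto
    have f: "f \<omega> = exp (\<theta> * of_real ?r) * exp (c * of_real (W ?r \<omega> - x))"
      unfolding f_def mult_exp_exp by (rule arg_cong[of _ _ exp]) (simp add: algebra_simps)
    show ?thesis
    proof (cases "ereal \<delta> < exit_time \<omega>")
      case True
      have "Re (f \<omega>) \<le> norm (f \<omega>)" by (rule complex_Re_le_cmod)
      also have "norm (f \<omega>) = exp (Re \<theta> * ?r)" unfolding f norm_mult norm_exp_eq_Re by (simp add: c_def)
      also have "\<dots> \<le> exp (norm \<theta> * \<delta>)"
      proof -
        have "Re \<theta> * ?r \<le> norm \<theta> * ?r" using r complex_Re_le_cmod by (intro mult_right_mono)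
        also have "\<dots> \<le> norm \<theta> * \<delta>" using r by (intro mult_left_mono) auto
        finally show ?thesis by simp
      qed
      finally show ?thesis using True \<omega> by simp
    next
      case False
      then have "W ?r \<omega> \<in> {a, b}" using W_stop_time(1)[OF \<omega> \<delta>(1)] by simp
      moreover have "y - x = - ((b - a) / 2) \<or> y - x = (b - a) / 2" if "y \<in> {a, b}" for y
        using that unfolding mid by (auto simp: field_simps)
      ultimately have "W ?r \<omega> - x = - ((b - a) / 2) \<or> W ?r \<omega> - x = (b - a) / 2" by blast
      moreover have "c * of_real d = \<i> * of_real (2 * pi / (b - a) * d)" for d by (simp add: c_def)
      moreover have "2 * pi / (b - a) * - ((b - a) / 2) = - pi" "2 * pi / (b - a) * ((b - a) / 2) = pi"
        using ab by (auto simp: field_simps)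
      ultimately have "c * of_real (W ?r \<omega> - x) = - (\<i> * of_real pi) \<or> c * of_real (W ?r \<omega> - x) = \<i> * of_real pi"
        by (elim disjE) (simp_all only: of_real_minus mult_minus_right simp_thms)
      then have "exp (c * of_real (W ?r \<omega> - x)) = -1" by (auto simp: exp_minus)
      then have "Re (f \<omega>) = - Re (exp (\<theta> * of_real ?r))" unfolding f by simp
      also have "Re (exp (\<theta> * of_real ?r)) = exp (Re \<theta> * ?r) * cos (Im \<theta> * ?r)" by (simp add: Re_exp)
      also have "cos (Im \<theta> * ?r) \<ge> 0"
      proof -
        have "\<bar>Im \<theta> * ?r\<bar> \<le> \<bar>Im \<theta>\<bar> * \<delta>" using r by (simp add: abs_mult mult_left_mono)
        also have "\<bar>Im \<theta>\<bar> = \<bar>\<mu>\<bar> * (2 * pi / (b - a))" unfolding Im\<theta> using ab by (simp add: abs_mult)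
        also have "\<dots> * \<delta> \<le> pi / 2" by (rule \<delta>)
        finally show ?thesis by (intro cos_ge_zero) (auto simp: abs_le_iff)
      qed
      ultimately show ?thesis using False by simp
    qed
  qed
  have "1 = (\<integral>\<omega>. Re (f \<omega>) \<partial>M)" using integral_Re[OF fi] f1 by simp
  also have "\<dots> \<le> (\<integral>\<omega>. exp (norm \<theta> * \<delta>) * indicator ?E \<omega> \<partial>M)"
    using bound fi by (intro integral_mono integrable_Re integrable_mult_right integrable_real_indicator E) (auto simp: emeasure_eq_measure)
  also have "\<dots> = exp (norm \<theta> * \<delta>) * prob ?E" by simp
  finally show ?thesis unfolding c_def[symmetric] \<theta>_def[symmetric] by (simp add: exp_minus field_simps)
qed

end

text \<open>The cycles of the process after the relocation points have been replaced by their common value. Exit times depend on whole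
  paths, so independence is that of the sigma-algebras of whole paths.\<close>
locale reset_cycles = prob_space M for M :: "'w measure" +
  fixes B :: "nat \<Rightarrow> real \<Rightarrow> 'w \<Rightarrow> real" and start :: "nat \<Rightarrow> real" and x\<^sub>0 \<sigma> \<mu> a b :: real
  assumes cyc: "\<And>n. drifted_bm M (B n) (start n) a b"
    and start_Suc: "\<And>n. start (Suc n) = x\<^sub>0" and mid: "x\<^sub>0 = (a + b) / 2"
    and indep_paths: "indep_sets (\<lambda>n. sets (vimage_algebra (space M) (\<lambda>\<omega>. \<lambda>t\<in>{0..}. B n t \<omega>) (PiM {0..} (\<lambda>_. borel)))) UNIV"
begin

sublocale c: drifted_bm M "B n" "start n" \<sigma> \<mu> a b for n by (rule cyc)

definition path_algebra :: "nat \<Rightarrow> 'w measure" where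
  "path_algebra n = vimage_algebra (space M) (\<lambda>\<omega>. \<lambda>t\<in>{0..}. B n t \<omega>) (PiM {0..} (\<lambda>_. borel))"

lemma space_path_algebra [simp]: "space (path_algebra n) = space M" by (simp add: path_algebra_def)

lemma path_measurable: "(\<lambda>\<omega>. \<lambda>t\<in>{0..}. B n t \<omega>) \<in> measurable M (PiM {0..} (\<lambda>_. borel))"
  by (rule measurable_restrict) (use c.B_measurable in auto)

lemma path_algebra_subset: "A \<in> sets (path_algebra n) \<Longrightarrow> A \<in> sets M"
  unfolding path_algebra_def using measurable_sets[OF path_measurable]
  by (subst (asm) sets_vimage_algebra2) (auto simp: space_PiM)

lemma B_measurable_path_algebra: "0 \<le> r \<Longrightarrow> B n r \<in> borel_measurable (path_algebra n)"
proof -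
  assume r: "0 \<le> r"
  have 1: "(\<lambda>\<omega>. \<lambda>t\<in>{0..}. B n t \<omega>) \<in> measurable (path_algebra n) (PiM {0..} (\<lambda>_. borel))"
    unfolding path_algebra_def by (rule measurable_vimage_algebra1) (auto simp: space_PiM)
  have 2: "(\<lambda>f. f r) \<in> measurable (PiM {0..} (\<lambda>_. borel :: real measure)) borel"
    using r by (intro measurable_component_singleton) auto
  show ?thesis using measurable_compose[OF 1 2] r by simp
qed

lemma id_measurable_path_algebra: "(\<lambda>\<omega>. \<omega>) \<in> measurable M (path_algebra n)"
proof (rule measurableI)
  fix A assume A: "A \<in> sets (path_algebra n)"
  have "(\<lambda>\<omega>. \<omega>) -` A \<inter> space M = A" using sets.sets_into_space[OF path_algebra_subset[OF A]] by auto
  then show "(\<lambda>\<omega>. \<omega>) -` A \<inter> space M \<in> sets M" using path_algebra_subset[OF A] by simp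
qed simp

lemma exit_time_measurable_path_algebra: "c.exit_time n \<in> borel_measurable (path_algebra n)"
  by (rule c.exit_time_measurable[OF space_path_algebra B_measurable_path_algebra])

lemma exit_time_measurable: "c.exit_time n \<in> borel_measurable M"
  by (rule c.exit_time_measurable[OF refl c.B_measurable])

text \<open>Independence of the sigma-algebras, phrased for the identity map into each of them so that
  results on independent random variables apply.\<close>
lemma indep_path_algebra: "indep_vars path_algebra (\<lambda>n \<omega>. \<omega>) UNIV"
proof -
  have "{(\<lambda>\<omega>. \<omega>) -` A \<inter> space M |A. A \<in> sets (path_algebra n)} = sets (path_algebra n)" for n
  proof -
    have "A \<inter> space M = A" if "A \<in> sets (path_algebra n)" for A using sets.sets_into_space[OF that] by auto
    then show ?thesis by (auto intro!: exI)
  qed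
  then show ?thesis
    unfolding indep_vars_def2 using indep_paths id_measurable_path_algebra by (simp add: path_algebra_def[symmetric])
qed

definition reset_time :: "nat \<Rightarrow> 'w \<Rightarrow> ereal" where
  "reset_time n \<omega> = (\<Sum>k<n. c.exit_time k \<omega>)"

lemma reset_time_measurable [measurable]: "reset_time n \<in> borel_measurable M"
  unfolding reset_time_def by (intro borel_measurable_ereal_sum exit_time_measurable)

lemma reset_time_nonneg: "0 \<le> reset_time n \<omega>"
  unfolding reset_time_def by (intro sum_nonneg c.exit_time_nonneg)

lemma reset_time_mono: "n \<le> m \<Longrightarrow> reset_time n \<omega> \<le> reset_time m \<omega>"
  unfolding reset_time_def by (intro sum_mono2) (auto simp: c.exit_time_nonneg)

text \<open>Fubini: the reset time is a function of the earlier cycles and is independent of cycle \<open>n\<close>, so a mean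
  that vanishes for every fixed first argument vanishes for a random one. The proof
  passes to products of copies of the sample space, each with its path sigma-algebra, on which past and
  present are two independent families.\<close>
lemma integral_next_cycle_eq_0:
  fixes H :: "ereal \<Rightarrow> 'w \<Rightarrow> complex"
  assumes H [measurable]: "(\<lambda>p. H (fst p) (snd p)) \<in> borel_measurable (borel \<Otimes>\<^sub>M path_algebra n)"
    and bound: "\<And>e \<omega>. \<omega> \<in> space M \<Longrightarrow> norm (H e \<omega>) \<le> C"
    and 0: "\<And>e. (\<integral>\<omega>. H e \<omega> \<partial>M) = 0"
  shows "(\<integral>\<omega>. H (reset_time n \<omega>) \<omega> \<partial>M) = 0"
proof -
  let ?A = "PiM {..<n} path_algebra" and ?B = "PiM {n} path_algebra"
  let ?R1 = "\<lambda>\<omega>. restrict (\<lambda>i. \<omega>) {..<n}" and ?R2 = "\<lambda>\<omega>. restrict (\<lambda>i. \<omega>) {n}"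
  have iv: "indep_var ?A ?R1 ?B ?R2" by (rule indep_var_restrict[OF indep_path_algebra]) auto
  then have R [measurable]: "?R1 \<in> measurable M ?A" "?R2 \<in> measurable M ?B"
    and eq: "distr M ?A ?R1 \<Otimes>\<^sub>M distr M ?B ?R2 = distr M (?A \<Otimes>\<^sub>M ?B) (\<lambda>\<omega>. (?R1 \<omega>, ?R2 \<omega>))"
    unfolding indep_var_distribution_eq by auto
  define G where "G = (\<lambda>p. H (\<Sum>k<n. c.exit_time k (fst p k)) (snd p n))"
  have Tm: "(\<lambda>z. \<Sum>k<n. c.exit_time k (z k)) \<in> borel_measurable ?A"
  proof (rule borel_measurable_ereal_sum)
    fix k assume k: "k \<in> {..<n}"
    show "(\<lambda>z. c.exit_time k (z k)) \<in> borel_measurable ?A"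
      by (rule measurable_compose[OF measurable_component_singleton[OF k, of path_algebra] exit_time_measurable_path_algebra[of k]])
  qed
  have nm: "(\<lambda>z. z n) \<in> measurable ?B (path_algebra n)" by (rule measurable_component_singleton) simp
  have Gm [measurable]: "G \<in> borel_measurable (?A \<Otimes>\<^sub>M ?B)"
    unfolding G_def
    using measurable_compose[OF measurable_Pair[OF measurable_compose[OF measurable_fst Tm] measurable_compose[OF measurable_snd nm]] H]
    by simp
  have GR: "G (?R1 \<omega>, ?R2 \<omega>') = H (reset_time n \<omega>) \<omega>'" for \<omega> \<omega>'
  proof -
    have "(\<Sum>k<n. c.exit_time k (?R1 \<omega> k)) = (\<Sum>k<n. c.exit_time k \<omega>)" by (intro sum.cong) auto
    then show ?thesis unfolding G_def reset_time_def by simp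
  qed
  interpret P1: prob_space "distr M ?A ?R1" by (rule prob_space_distr) measurable
  interpret P2: prob_space "distr M ?B ?R2" by (rule prob_space_distr) measurable
  interpret P: pair_prob_space "distr M ?A ?R1" "distr M ?B ?R2" ..
  have sp: "f n \<in> space M" if "f \<in> space ?B" for f using that by (auto simp: space_PiM PiE_def Pi_def)
  have Gi: "integrable (distr M ?A ?R1 \<Otimes>\<^sub>M distr M ?B ?R2) G"
  proof (rule P.integrable_const_bound)
    show "AE p in distr M ?A ?R1 \<Otimes>\<^sub>M distr M ?B ?R2. norm (G p) \<le> C"
      by (rule AE_I2) (auto simp: G_def space_pair_measure intro!: bound sp)
    show "G \<in> borel_measurable (distr M ?A ?R1 \<Otimes>\<^sub>M distr M ?B ?R2)"
      using Gm by (simp cong: measurable_cong_sets)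
  qed
  have "(\<integral>\<omega>. H (reset_time n \<omega>) \<omega> \<partial>M) = (\<integral>\<omega>. G (?R1 \<omega>, ?R2 \<omega>) \<partial>M)" unfolding GR ..
  also have "\<dots> = (\<integral>p. G p \<partial>distr M (?A \<Otimes>\<^sub>M ?B) (\<lambda>\<omega>. (?R1 \<omega>, ?R2 \<omega>)))"
    by (rule integral_distr[symmetric]) measurable
  also have "\<dots> = (\<integral>p. G p \<partial>(distr M ?A ?R1 \<Otimes>\<^sub>M distr M ?B ?R2))" unfolding eq ..
  also have "\<dots> = (\<integral>z. \<integral>y. G (z, y) \<partial>distr M ?B ?R2 \<partial>distr M ?A ?R1)"
    by (rule P.integral_fst'[symmetric, OF Gi])
  also have "\<dots> = (\<integral>z. 0 \<partial>distr M ?A ?R1)"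
  proof (rule Bochner_Integration.integral_cong[OF refl])
    fix z assume "z \<in> space (distr M ?A ?R1)"
    then have z: "z \<in> space ?A" by simp
    have "(\<integral>y. G (z, y) \<partial>distr M ?B ?R2) = (\<integral>\<omega>. G (z, ?R2 \<omega>) \<partial>M)"
      by (rule integral_distr[OF R(2)]) (use z in measurable)
    also have "\<dots> = 0" unfolding G_def using 0 by simp
    finally show "(\<integral>y. G (z, y) \<partial>distr M ?B ?R2) = 0" .
  qed
  finally show ?thesis by simp
qed

text \<open>Each cycle after the first one lasts longer than \<open>\<delta>\<close> with probability at least \<open>\<epsilon>\<close>. Replacing a cycle
  by the discount factor \<open>exp (- \<delta>)\<close> if it is long and by \<open>1\<close> otherwise, the product of the factors has
  geometrically small mean, and it is at least \<open>exp (- t)\<close> if the reset happens before \<open>t\<close>.\<close>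
lemma prob_reset_time_tendsto_0:
  "(\<lambda>n. prob {\<omega> \<in> space M. reset_time n \<omega> \<le> ereal t}) \<longlonglongrightarrow> 0"
proof -
  have ab: "a < b" using c.start[of 0] by auto
  define K where "K = \<bar>\<mu>\<bar> * (2 * pi / (b - a))"
  have K: "0 \<le> K" using ab by (simp add: K_def)
  \<comment> \<open>during time \<open>\<delta>\<close> the drift rotates the mode by at most a quarter turn\<close>
  define \<delta> where "\<delta> = (pi / 2) / (K + 1)"
  have \<delta>: "0 < \<delta>" "K * \<delta> \<le> pi / 2"
  proof -
    show "0 < \<delta>" using K by (simp add: \<delta>_def)
    have "K * \<delta> = (pi / 2) * (K / (K + 1))" by (simp add: \<delta>_def)
    also have "\<dots> \<le> (pi / 2) * 1" using K by (intro mult_left_mono) (auto simp: divide_le_eq_1)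
    finally show "K * \<delta> \<le> pi / 2" by simp
  qed
  define \<epsilon> where "\<epsilon> = exp (- norm (drifted_bm.decay_rate \<sigma> \<mu> (\<i> * of_real (2 * pi / (b - a)))) * \<delta>)"
  define \<rho> where "\<rho> = 1 - \<epsilon> * (1 - exp (- \<delta>))"
  \<comment> \<open>the discount factor of a cycle\<close>
  define \<psi> where "\<psi> e = (if ereal \<delta> < e then exp (- \<delta>) else 1)" for e :: ereal
  have \<psi>m [measurable]: "\<psi> \<in> borel_measurable borel" unfolding \<psi>_def by measurable
  have \<psi>01: "0 \<le> \<psi> e" "\<psi> e \<le> 1" for e using \<delta> by (auto simp: \<psi>_def)
  note exit_time_measurable [measurable]
  have \<psi>i: "integrable M (\<lambda>\<omega>. \<psi> (c.exit_time k \<omega>))" for k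
    using \<psi>01 by (intro integrable_const_bound[where B = 1]) auto
  have le: "(\<integral>\<omega>. \<psi> (c.exit_time (Suc k) \<omega>) \<partial>M) \<le> \<rho>" for k
  proof -
    let ?E = "{\<omega> \<in> space M. ereal \<delta> < c.exit_time (Suc k) \<omega>}"
    have "(\<integral>\<omega>. \<psi> (c.exit_time (Suc k) \<omega>) \<partial>M) = (\<integral>\<omega>. 1 - (1 - exp (- \<delta>)) * indicator ?E \<omega> \<partial>M)"
      by (rule Bochner_Integration.integral_cong) (auto simp: \<psi>_def)
    also have "\<dots> = 1 - (1 - exp (- \<delta>)) * prob ?E"
    proof -
      have "integrable M (indicator ?E :: 'w \<Rightarrow> real)"
        by (intro integrable_real_indicator) (auto simp: emeasure_eq_measure)
      then show ?thesis by (simp add: prob_space)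
    qed
    also have "\<dots> \<le> 1 - (1 - exp (- \<delta>)) * \<epsilon>"
    proof -
      have "\<epsilon> \<le> prob ?E"
        unfolding \<epsilon>_def using \<delta> mid start_Suc[of k] by (intro c.late_exit) (auto simp: K_def)
      then show ?thesis using \<delta> by (intro diff_left_mono mult_left_mono) auto
    qed
    finally show ?thesis by (simp add: \<rho>_def mult.commute)
  qed
  have \<rho>0: "0 \<le> \<rho>" by (rule order_trans[OF integral_nonneg_AE le[of 0]]) (use \<psi>01 in auto)
  have \<rho>1: "\<rho> < 1" using \<delta> by (simp add: \<rho>_def \<epsilon>_def)
  have ind: "indep_vars (\<lambda>_. borel) (\<lambda>k \<omega>. \<psi> (c.exit_time k \<omega>)) UNIV"
    using indep_vars_compose2[OF indep_path_algebra, of "\<lambda>k \<omega>. \<psi> (c.exit_time k \<omega>)" "\<lambda>_. borel"]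
      measurable_compose[OF exit_time_measurable_path_algebra \<psi>m] by simp
  have prod_le: "(\<integral>\<omega>. (\<Prod>k<Suc n. \<psi> (c.exit_time k \<omega>)) \<partial>M) \<le> \<rho> ^ n" for n
  proof -
    have "(\<integral>\<omega>. (\<Prod>k<Suc n. \<psi> (c.exit_time k \<omega>)) \<partial>M) = (\<Prod>k<Suc n. \<integral>\<omega>. \<psi> (c.exit_time k \<omega>) \<partial>M)"
      by (rule indep_vars_lebesgue_integral[OF _ indep_vars_subset[OF ind]]) (use \<psi>i in auto)
    also have "\<dots> = (\<integral>\<omega>. \<psi> (c.exit_time 0 \<omega>) \<partial>M) * (\<Prod>k<n. \<integral>\<omega>. \<psi> (c.exit_time (Suc k) \<omega>) \<partial>M)"
      by (rule prod.lessThan_Suc_shift)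
    also have "\<dots> \<le> 1 * (\<Prod>k<n. \<rho>)"
    proof (intro mult_mono prod_mono)
      show "(\<integral>\<omega>. \<psi> (c.exit_time 0 \<omega>) \<partial>M) \<le> 1"
        using integral_mono[OF \<psi>i[of 0], of "\<lambda>_. 1"] \<psi>01 by (simp add: prob_space)
    qed (use le \<psi>01 in \<open>auto intro!: prod_nonneg integral_nonneg_AE\<close>)
    finally show ?thesis by simp
  qed
  have ptw: "reset_time n \<omega> \<le> ereal t \<Longrightarrow> exp (- t) \<le> (\<Prod>k<n. \<psi> (c.exit_time k \<omega>))" for n t \<omega>
  proof (induction n arbitrary: t)
    case 0 then show ?case by (simp add: reset_time_def)
  next
    case (Suc n)
    have eq: "reset_time (Suc n) \<omega> = reset_time n \<omega> + c.exit_time n \<omega>" by (simp add: reset_time_def)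
    show ?case
    proof (cases "ereal \<delta> < c.exit_time n \<omega>")
      case True
      have "reset_time n \<omega> + ereal \<delta> \<le> ereal t"
        using Suc.prems True unfolding eq by (meson add_left_mono less_imp_le order_trans)
      then have "reset_time n \<omega> \<le> ereal (t - \<delta>)"
        by (cases "reset_time n \<omega>") auto
      from Suc.IH[OF this] have "exp (- (t - \<delta>)) * exp (- \<delta>) \<le> (\<Prod>k<n. \<psi> (c.exit_time k \<omega>)) * exp (- \<delta>)"
        by (intro mult_right_mono) auto
      then show ?thesis using True by (simp add: \<psi>_def mult_exp_exp)
    next
      case False
      have "reset_time n \<omega> \<le> ereal t"
        using Suc.prems reset_time_mono[of n "Suc n" \<omega>] by auto
      from Suc.IH[OF this] show ?thesis using False by (simp add: \<psi>_def)
    qed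
  qed
  have "prob {\<omega> \<in> space M. reset_time (Suc n) \<omega> \<le> ereal t} \<le> exp t * \<rho> ^ n" for n
  proof -
    have pi: "integrable M (\<lambda>\<omega>. \<Prod>k<Suc n. \<psi> (c.exit_time k \<omega>))"
    proof (rule integrable_const_bound[where B = 1])
      show "AE \<omega> in M. norm (\<Prod>k<Suc n. \<psi> (c.exit_time k \<omega>)) \<le> 1"
        unfolding prod_norm[symmetric] using \<psi>01 by (intro AE_I2 prod_le_1) auto
    qed measurable
    have "prob {\<omega> \<in> space M. reset_time (Suc n) \<omega> \<le> ereal t} = (\<integral>\<omega>. indicator {\<omega> \<in> space M. reset_time (Suc n) \<omega> \<le> ereal t} \<omega> \<partial>M)"
      by simp
    also have "\<dots> \<le> (\<integral>\<omega>. exp t * (\<Prod>k<Suc n. \<psi> (c.exit_time k \<omega>)) \<partial>M)"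
    proof (rule integral_mono)
      fix \<omega>
      show "indicator {\<omega> \<in> space M. reset_time (Suc n) \<omega> \<le> ereal t} \<omega> \<le> exp t * (\<Prod>k<Suc n. \<psi> (c.exit_time k \<omega>))"
      proof (cases "\<omega> \<in> {\<omega> \<in> space M. reset_time (Suc n) \<omega> \<le> ereal t}")
        case True
        then have "exp (- t) \<le> (\<Prod>k<Suc n. \<psi> (c.exit_time k \<omega>))" by (intro ptw) simp
        then have "exp t * exp (- t) \<le> exp t * (\<Prod>k<Suc n. \<psi> (c.exit_time k \<omega>))" by (intro mult_left_mono) auto
        then show ?thesis using True by (simp only: mult_exp_exp) simp
      qed (auto intro!: mult_nonneg_nonneg prod_nonneg \<psi>01)
    qed (auto intro!: pi simp: emeasure_eq_measure simp del: prod.lessThan_Suc)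
    also have "\<dots> \<le> exp t * \<rho> ^ n"
      unfolding integral_mult_right_zero by (intro mult_left_mono prod_le) simp
    finally show ?thesis .
  qed
  then have "(\<lambda>n. prob {\<omega> \<in> space M. reset_time (Suc n) \<omega> \<le> ereal t}) \<longlonglongrightarrow> 0"
    using \<rho>0 \<rho>1
    by (intro tendsto_sandwich[OF _ _ tendsto_const tendsto_mult_right_zero[OF LIMSEQ_power_zero]]) (auto intro!: always_eventually)
  then show ?thesis by (rule LIMSEQ_imp_Suc)
qed

lemma AE_reset_time_unbounded: "AE \<omega> in M. \<exists>n. ereal t < reset_time n \<omega>"
proof -
  let ?N = "\<lambda>n. {\<omega> \<in> space M. reset_time n \<omega> \<le> ereal t}"
  let ?A = "{\<omega> \<in> space M. \<forall>n. reset_time n \<omega> \<le> ereal t}"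
  have "prob ?A \<le> prob (?N n)" for n by (intro finite_measure_mono) auto
  then have "prob ?A \<le> 0" by (intro LIMSEQ_le_const[OF prob_reset_time_tendsto_0]) auto
  then have "prob ?A = 0" using measure_nonneg[of M ?A] by linarith
  then have "?A \<in> null_sets M" by (intro null_setsI) (auto simp: emeasure_eq_measure)
  then show ?thesis by (rule AE_I') (auto simp: not_less)
qed


definition follows_cycles :: "real \<Rightarrow> ('w \<Rightarrow> real) \<Rightarrow> bool" where
  "follows_cycles t X \<longleftrightarrow> (AE \<omega> in M. \<forall>n. reset_time n \<omega> \<le> ereal t \<and> ereal t < reset_time (Suc n) \<omega> \<longrightarrow>
     X \<omega> = c.W n (t - real_of_ereal (reset_time n \<omega>)) \<omega>)"

lemma AE_position_mem:
  assumes t: "0 \<le> t" and X: "follows_cycles t X"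
  shows "AE \<omega> in M. X \<omega> \<in> {a<..<b}"
  using X[unfolded follows_cycles_def] AE_reset_time_unbounded[of t] AE_space
proof eventually_elim
  case (elim \<omega>)
  define N where "N = (LEAST n. ereal t < reset_time n \<omega>)"
  have N: "ereal t < reset_time N \<omega>" unfolding N_def by (rule LeastI_ex) (use elim in blast)
  have "N \<noteq> 0" using N t by (cases N) (auto simp: reset_time_def)
  then obtain n where n: "N = Suc n" by (cases N) auto
  have le: "reset_time n \<omega> \<le> ereal t"
    using not_less_Least[of n "\<lambda>n. ereal t < reset_time n \<omega>"] n by (simp add: N_def not_less)
  define r where "r = real_of_ereal (reset_time n \<omega>)"
  have r: "reset_time n \<omega> = ereal r" "r \<le> t"
    using le reset_time_nonneg[of n \<omega>] unfolding r_def by (cases "reset_time n \<omega>"; auto)+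
  have "ereal t < ereal r + c.exit_time n \<omega>" using N r by (simp add: n reset_time_def)
  then have "ereal (t - r) < c.exit_time n \<omega>" by (cases "c.exit_time n \<omega>") auto
  then have "c.W n (t - r) \<omega> \<in> {a<..<b}"
    using c.W_stop_time(2)[of \<omega> "t - r" n] elim(3) r by auto
  moreover have "X \<omega> = c.W n (t - r) \<omega>" using elim(1) le N unfolding n r_def by blast
  ultimately show ?case by simp
qed

text \<open>Let \<open>V n\<close> be \<open>exp (\<theta> s) g\<close> at the \<open>n\<close>-th reset time \<open>s\<close>, or at time \<open>t\<close> if that is earlier. Between two
  successive values of \<open>n\<close> only cycle \<open>n\<close> acts, whose stopped expectation is known and which is
  independent of the past; the jump at its end is invisible to \<open>g\<close>. So the mean of \<open>V n\<close> is constant, and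
  it converges to that of \<open>exp (\<theta> t) g (X)\<close> because the reset times are unbounded.\<close>
theorem eigenfunction_decay:
  fixes g :: "real \<Rightarrow> complex" and \<theta> :: complex
  assumes t: "0 \<le> t" and Xm [measurable]: "X \<in> borel_measurable M"
    and X: "follows_cycles t X"
    and gm [measurable]: "g \<in> borel_measurable borel" and G: "\<And>y. y \<in> {a..b} \<Longrightarrow> norm (g y) \<le> G"
    and ga: "g a = g x\<^sub>0" and gb: "g b = g x\<^sub>0"
    and stop: "\<And>n u. 0 \<le> u \<Longrightarrow> (\<integral>\<omega>. exp (\<theta> * of_real (c.stop_time n u \<omega>)) * g (c.W n (c.stop_time n u \<omega>) \<omega>) \<partial>M) = g (start n)"
  shows "(\<integral>\<omega>. g (X \<omega>) \<partial>M) = exp (- \<theta> * of_real t) * g (start 0)"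
proof -
  have ab: "a < b" using c.start[of 0] by auto
  have x0: "x\<^sub>0 \<in> {a..b}" using mid ab by auto
  have G0: "0 \<le> G" using G[OF x0] norm_ge_zero order_trans by blast
  have [measurable]: "(\<lambda>z. exp z :: complex) \<in> borel_measurable borel"
    by (intro borel_measurable_continuous_onI continuous_intros)
  define D where "D = exp (norm \<theta> * t)"
  have D: "norm (exp (\<theta> * of_real r)) \<le> D" if "0 \<le> r" "r \<le> t" for r
  proof -
    have "Re (\<theta> * of_real r) \<le> norm (\<theta> * of_real r)" by (rule complex_Re_le_cmod)
    also have "\<dots> \<le> norm \<theta> * t" using that by (simp add: norm_mult mult_left_mono)
    finally show ?thesis unfolding D_def norm_exp_eq_Re by simp
  qed
  have D0: "0 \<le> D" by (simp add: D_def)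
  define \<Psi> where "\<Psi> n u \<omega> = exp (\<theta> * of_real (c.stop_time n u \<omega>)) * g (c.W n (max 0 (c.stop_time n u \<omega>)) \<omega>)" for n u \<omega>
  have \<Psi>: "\<Psi> n u \<omega> = exp (\<theta> * of_real (c.stop_time n u \<omega>)) * g (c.W n (c.stop_time n u \<omega>) \<omega>)" if "0 \<le> u" for n u \<omega>
    unfolding \<Psi>_def using c.stop_time_bounds[OF that, of n \<omega>] by (simp add: max_def)
  have \<Psi>_int: "(\<integral>\<omega>. \<Psi> n u \<omega> \<partial>M) = g (start n)" if "0 \<le> u" for n u
    unfolding \<Psi>[OF that] by (rule stop[OF that])
  have \<Psi>_le: "norm (\<Psi> n u \<omega>) \<le> D * G" if "0 \<le> u" "u \<le> t" "\<omega> \<in> space M" for n u \<omega>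
    unfolding \<Psi>[OF that(1)] norm_mult
    using c.stop_time_bounds[OF that(1), of n \<omega>] that c.W_stop_time_mem[of \<omega> u n]
    by (intro mult_mono D G D0) auto
  have Wj [measurable]: "(\<lambda>p. c.W n (max 0 (fst p)) (snd p)) \<in> borel_measurable (borel \<Otimes>\<^sub>M path_algebra n)" for n
  proof (rule jointly_measurable_path)
    show "c.W n r \<in> borel_measurable (path_algebra n)" if "0 \<le> r" for r
      using B_measurable_path_algebra[OF that] unfolding c.W_def by measurable
    show "continuous_on {0..} (\<lambda>r. c.W n r \<omega>)" if "\<omega> \<in> space (path_algebra n)" for \<omega>
      using that by (intro c.W_continuous) simp
  qed
  note exit_time_measurable_path_algebra [measurable]
  have st [measurable]: "(\<lambda>p. c.stop_time n (fst p) (snd p)) \<in> borel_measurable (borel \<Otimes>\<^sub>M path_algebra n)" for n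
    unfolding c.stop_time_def by measurable
  have \<Psi>m [measurable]: "(\<lambda>p. \<Psi> n (fst p) (snd p)) \<in> borel_measurable (borel \<Otimes>\<^sub>M path_algebra n)" for n
  proof -
    have "(\<lambda>p. c.W n (max 0 (c.stop_time n (fst p) (snd p))) (snd p)) \<in> borel_measurable (borel \<Otimes>\<^sub>M path_algebra n)"
      using measurable_compose[OF measurable_Pair[OF st[of n] measurable_snd] Wj[of n]] by simp
    then show ?thesis unfolding \<Psi>_def by measurable
  qed
  \<comment> \<open>the contribution of cycle \<open>n\<close> when it starts at time \<open>e\<close>, zero if this is after \<open>t\<close>\<close>
  define H where "H n e \<omega> = (if 0 \<le> e \<and> e \<le> ereal t then exp (\<theta> * of_real (real_of_ereal e)) * (\<Psi> n (t - real_of_ereal e) \<omega> - g x\<^sub>0) else 0)" for n e \<omega>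
  have er: "0 \<le> real_of_ereal e" "real_of_ereal e \<le> t" if "0 \<le> e" "e \<le> ereal t" for e
    using that by (cases e; auto)+
  have H_le: "norm (H n e \<omega>) \<le> D * (D * G + G)" if \<omega>: "\<omega> \<in> space M" for n e \<omega>
  proof (cases "0 \<le> e \<and> e \<le> ereal t")
    case True
    then have r: "0 \<le> real_of_ereal e" "real_of_ereal e \<le> t" using er by auto
    have "norm (\<Psi> n (t - real_of_ereal e) \<omega> - g x\<^sub>0) \<le> D * G + G"
      using r by (intro norm_triangle_le_diff add_mono \<Psi>_le \<omega> G x0) auto
    then have "norm (exp (\<theta> * of_real (real_of_ereal e))) * norm (\<Psi> n (t - real_of_ereal e) \<omega> - g x\<^sub>0) \<le> D * (D * G + G)"
      by (intro mult_mono D r D0) auto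
    moreover have "H n e \<omega> = exp (\<theta> * of_real (real_of_ereal e)) * (\<Psi> n (t - real_of_ereal e) \<omega> - g x\<^sub>0)"
      using True by (simp only: H_def if_True simp_thms)
    ultimately show ?thesis by (simp only: norm_mult)
  qed (use D0 G0 in \<open>auto simp: H_def\<close>)
  have Hm: "(\<lambda>p. H n (fst p) (snd p)) \<in> borel_measurable (borel \<Otimes>\<^sub>M path_algebra n)" for n
  proof -
    have 1: "(\<lambda>p. (t - real_of_ereal (fst p), snd p)) \<in> measurable (borel \<Otimes>\<^sub>M path_algebra n) (borel \<Otimes>\<^sub>M path_algebra n)" by measurable
    have [measurable]: "(\<lambda>p. \<Psi> n (t - real_of_ereal (fst p)) (snd p)) \<in> borel_measurable (borel \<Otimes>\<^sub>M path_algebra n)"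
      using measurable_compose[OF 1 \<Psi>m] by simp
    show ?thesis unfolding H_def by measurable
  qed
  have \<Psi>i: "integrable M (\<Psi> n u)" if "0 \<le> u" "u \<le> t" for n u
  proof (rule integrable_const_bound[where B = "D * G"])
    have "(\<lambda>\<omega>. (u, \<omega>)) \<in> measurable M (borel \<Otimes>\<^sub>M path_algebra n)" using id_measurable_path_algebra by measurable
    from measurable_compose[OF this \<Psi>m] show "\<Psi> n u \<in> borel_measurable M" by simp
  qed (use \<Psi>_le that in auto)
  have H_int: "(\<integral>\<omega>. H n e \<omega> \<partial>M) = (if 0 \<le> e \<and> e \<le> ereal t then exp (\<theta> * of_real (real_of_ereal e)) * (g (start n) - g x\<^sub>0) else 0)" for n e
  proof (cases "0 \<le> e \<and> e \<le> ereal t")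
    case True
    then have r: "0 \<le> real_of_ereal e" "real_of_ereal e \<le> t" using er by auto
    then show ?thesis using True \<Psi>i[of "t - real_of_ereal e" n] \<Psi>_int[of "t - real_of_ereal e" n]
      unfolding H_def by (simp add: prob_space)
  next
    case False
    then have "H n e = (\<lambda>\<omega>. 0)" unfolding H_def by (simp only: if_False)
    then show ?thesis using False by (simp only: if_False Bochner_Integration.integral_zero)
  qed
  have H_0: "(\<integral>\<omega>. H (Suc n) (reset_time (Suc n) \<omega>) \<omega> \<partial>M) = 0" for n
    by (rule integral_next_cycle_eq_0[OF Hm H_le]) (simp_all add: H_int start_Suc)
  define V where "V n \<omega> = (if reset_time n \<omega> \<le> ereal t then exp (\<theta> * of_real (real_of_ereal (reset_time n \<omega>))) * g x\<^sub>0
      else exp (\<theta> * of_real t) * g (X \<omega>))" for n \<omega>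
  have Vm [measurable]: "V n \<in> borel_measurable M" for n unfolding V_def by measurable
  have V_le: "AE \<omega> in M. norm (V n \<omega>) \<le> D * G" for n
    using AE_position_mem[OF t X]
  proof eventually_elim
    case (elim \<omega>)
    show ?case
    proof (cases "reset_time n \<omega> \<le> ereal t")
      case True
      have "norm (exp (\<theta> * of_real (real_of_ereal (reset_time n \<omega>)))) * norm (g x\<^sub>0) \<le> D * G"
        using er[OF reset_time_nonneg True] by (intro mult_mono D G x0 D0) auto
      then show ?thesis using True by (simp only: V_def if_True norm_mult)
    next
      case False
      have "norm (exp (\<theta> * of_real t)) * norm (g (X \<omega>)) \<le> D * G"
        using elim t by (intro mult_mono D G D0) auto
      then show ?thesis using False by (simp only: V_def if_False norm_mult)
    qed
  qed
  have Vi: "integrable M (V n)" for n by (rule integrable_const_bound[OF V_le Vm])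
  have step: "AE \<omega> in M. V (Suc n) \<omega> - V n \<omega> = H n (reset_time n \<omega>) \<omega>" for n
    using X[unfolded follows_cycles_def] AE_space
  proof eventually_elim
    case (elim \<omega>)
    note \<omega> = elim(2)
    show ?case
    proof (cases "reset_time n \<omega> \<le> ereal t")
      case False
      then have "\<not> reset_time (Suc n) \<omega> \<le> ereal t" using reset_time_mono[of n "Suc n" \<omega>] by auto
      then show ?thesis using False by (simp add: V_def H_def)
    next
      case True
      define r where "r = real_of_ereal (reset_time n \<omega>)"
      have r: "reset_time n \<omega> = ereal r" "0 \<le> r" "r \<le> t"
        using True reset_time_nonneg[of n \<omega>] unfolding r_def by (cases "reset_time n \<omega>"; auto)+
      have Suc: "reset_time (Suc n) \<omega> = ereal r + c.exit_time n \<omega>" using r by (simp add: reset_time_def)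
      have u: "0 \<le> t - r" using r by simp
      have Vn: "V n \<omega> = exp (\<theta> * of_real r) * g x\<^sub>0" using r by (simp add: V_def)
      have Hn: "H n (reset_time n \<omega>) \<omega> = exp (\<theta> * of_real r) * (\<Psi> n (t - r) \<omega> - g x\<^sub>0)" using r by (simp add: H_def)
      let ?s = "c.stop_time n (t - r) \<omega>"
      show ?thesis
      proof (cases "c.exit_time n \<omega> \<le> ereal (t - r)")
        case True
        then have s: "c.exit_time n \<omega> = ereal ?s" "c.W n ?s \<omega> \<in> {a, b}" using c.W_stop_time(1)[OF \<omega> u] by auto
        have "?s \<le> t - r" using c.stop_time_bounds[OF u] by auto
        then have "V (Suc n) \<omega> = exp (\<theta> * of_real (r + ?s)) * g x\<^sub>0" by (simp add: V_def Suc s(1))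
        moreover have "\<Psi> n (t - r) \<omega> = exp (\<theta> * of_real ?s) * g x\<^sub>0" unfolding \<Psi>[OF u] using s(2) ga gb by auto
        moreover have "exp (\<theta> * of_real (r + ?s)) = exp (\<theta> * of_real r) * exp (\<theta> * of_real ?s)"
          by (simp add: mult_exp_exp algebra_simps)
        ultimately show ?thesis unfolding Vn Hn by (simp add: algebra_simps)
      next
        case False
        then have l: "ereal (t - r) < c.exit_time n \<omega>" by simp
        have s: "?s = t - r" using c.W_stop_time(2)[OF \<omega> u l] by simp
        have l2: "ereal t < reset_time (Suc n) \<omega>" unfolding Suc using l by (cases "c.exit_time n \<omega>") auto
        then have "V (Suc n) \<omega> = exp (\<theta> * of_real t) * g (X \<omega>)" by (auto simp: V_def)
        also have "X \<omega> = c.W n (t - r) \<omega>" using elim(1) True l2 unfolding r_def by blast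
        finally have "V (Suc n) \<omega> = exp (\<theta> * of_real t) * g (c.W n (t - r) \<omega>)" .
        moreover have "\<Psi> n (t - r) \<omega> = exp (\<theta> * of_real (t - r)) * g (c.W n (t - r) \<omega>)" unfolding \<Psi>[OF u] s ..
        moreover have "exp (\<theta> * of_real t) = exp (\<theta> * of_real r) * exp (\<theta> * of_real (t - r))"
          by (simp add: mult_exp_exp algebra_simps)
        ultimately show ?thesis unfolding Vn Hn by (simp add: algebra_simps)
      qed
    qed
  qed
  have V_diff: "(\<integral>\<omega>. V (Suc n) \<omega> \<partial>M) - (\<integral>\<omega>. V n \<omega> \<partial>M) = (\<integral>\<omega>. H n (reset_time n \<omega>) \<omega> \<partial>M)" for n
  proof -
    have "(\<integral>\<omega>. V (Suc n) \<omega> \<partial>M) - (\<integral>\<omega>. V n \<omega> \<partial>M) = (\<integral>\<omega>. V (Suc n) \<omega> - V n \<omega> \<partial>M)"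
      by (rule Bochner_Integration.integral_diff[symmetric, OF Vi Vi])
    also have "\<dots> = (\<integral>\<omega>. H n (reset_time n \<omega>) \<omega> \<partial>M)"
    proof (rule integral_cong_AE[OF _ _ step])
      have "(\<lambda>\<omega>. (reset_time n \<omega>, \<omega>)) \<in> measurable M (borel \<Otimes>\<^sub>M path_algebra n)" using id_measurable_path_algebra by measurable
      from measurable_compose[OF this Hm] show "(\<lambda>\<omega>. H n (reset_time n \<omega>) \<omega>) \<in> borel_measurable M" by simp
    qed measurable
    finally show ?thesis .
  qed
  have V_val: "(\<integral>\<omega>. V (Suc n) \<omega> \<partial>M) = g (start 0)" for n
  proof (induction n)
    case 0
    have "(\<integral>\<omega>. V 0 \<omega> \<partial>M) = g x\<^sub>0" using t by (simp add: V_def reset_time_def prob_space)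
    moreover have "(\<integral>\<omega>. H 0 (reset_time 0 \<omega>) \<omega> \<partial>M) = g (start 0) - g x\<^sub>0"
      using H_int[of 0 0] t by (simp add: reset_time_def)
    ultimately show ?case using V_diff[of 0] by simp
  next
    case (Suc n)
    then show ?case using V_diff[of "Suc n"] H_0[of n] by simp
  qed
  have "(\<lambda>n. \<integral>\<omega>. V (Suc n) \<omega> \<partial>M) \<longlonglongrightarrow> (\<integral>\<omega>. exp (\<theta> * of_real t) * g (X \<omega>) \<partial>M)"
  proof (rule integral_dominated_convergence[where w = "\<lambda>_. D * G"])
    show "AE \<omega> in M. (\<lambda>n. V (Suc n) \<omega>) \<longlonglongrightarrow> exp (\<theta> * of_real t) * g (X \<omega>)"
      using AE_reset_time_unbounded[of t]
    proof eventually_elim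
      case (elim \<omega>)
      then obtain m where m: "ereal t < reset_time m \<omega>" by blast
      have "V (Suc n) \<omega> = exp (\<theta> * of_real t) * g (X \<omega>)" if "m \<le> n" for n
      proof -
        have "ereal t < reset_time (Suc n) \<omega>" using m reset_time_mono[of m "Suc n" \<omega>] that by auto
        then show ?thesis by (auto simp: V_def)
      qed
      then show ?case by (intro tendsto_eventually eventually_sequentiallyI)
    qed
  qed (use V_le in auto)
  then have "(\<integral>\<omega>. exp (\<theta> * of_real t) * g (X \<omega>) \<partial>M) = g (start 0)"
    unfolding V_val by (simp add: LIMSEQ_const_iff)
  then have "exp (\<theta> * of_real t) * (\<integral>\<omega>. g (X \<omega>) \<partial>M) = g (start 0)" by simp
  then have "exp (- \<theta> * of_real t) * (exp (\<theta> * of_real t) * (\<integral>\<omega>. g (X \<omega>) \<partial>M)) = exp (- \<theta> * of_real t) * g (start 0)" by simp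
  then show ?thesis unfolding mult.assoc[symmetric] mult_exp_exp by simp
qed

end

section \<open>Modes along the diffusion with jump boundary\<close>

lemma (in prob_space) indep_sets_Inr:
  assumes "indep_sets F (UNIV :: ('i + 'j) set)"
  shows "indep_sets (\<lambda>n. F (Inr n)) UNIV"
  unfolding indep_sets_def
proof (intro conjI ballI allI impI)
  fix n show "F (Inr n) \<subseteq> events" using assms unfolding indep_sets_def by blast
next
  fix J :: "'j set" and A assume J: "J \<noteq> {}" "finite J" and A: "A \<in> Pi J (\<lambda>n. F (Inr n))"
  let ?A = "\<lambda>i :: 'i + 'j. A (projr i)"
  have "prob (\<Inter>i\<in>Inr ` J. ?A i) = (\<Prod>i\<in>Inr ` J. prob (?A i))"
    using J A by (intro indep_setsD[OF assms, of "Inr ` J" ?A]) (auto simp: Pi_iff)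
  then show "prob (\<Inter>j\<in>J. A j) = (\<Prod>j\<in>J. prob (A j))"
    by (simp add: prod.reindex)
qed

text \<open>The relocation points have the law of a constant, so almost surely all of them are \<open>x\<^sub>0\<close>, and the
  process follows cycles that are started at \<open>x\<^sub>0\<close> after the first one.\<close>
lemma jump_diffusion_cycles:
  fixes M :: "'w measure"
  assumes J: "jump_diffusion a b \<sigma> \<mu> (return borel x\<^sub>0) M x X" and x: "x \<in> {a<..<b}" and mid: "x\<^sub>0 = (a + b) / 2"
  obtains B where "reset_cycles M B (case_nat x (\<lambda>_. x\<^sub>0)) x\<^sub>0 a b"
    and "\<And>t. 0 \<le> t \<Longrightarrow> X t \<in> borel_measurable M"
    and "\<And>t. 0 \<le> t \<Longrightarrow> reset_cycles.follows_cycles M B (case_nat x (\<lambda>_. x\<^sub>0)) \<sigma> \<mu> a b t (X t)"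
proof -
  let ?start = "case_nat x (\<lambda>_. x\<^sub>0)"
  interpret prob_space M using J unfolding jump_diffusion_def by blast
  obtain Y B where Y: "\<And>n. Y n \<in> borel_measurable M" "\<And>n. distr M borel (Y n) = return borel x\<^sub>0"
    and B: "\<And>n. standard_brownian_motion M (B n)"
    and ind: "indep_sets (\<lambda>i. case i of
             Inl n \<Rightarrow> sets (vimage_algebra (space M) (Y n) borel)
           | Inr n \<Rightarrow> sets (vimage_algebra (space M) (\<lambda>\<omega>. \<lambda>t\<in>{0..}. B n t \<omega>)
                              (PiM {0..} (\<lambda>_. borel)))) (UNIV :: (nat + nat) set)"
    and path: "AE \<omega> in M. \<forall>t\<ge>0. \<forall>n.
           (let Y' = (\<lambda>k. Y k \<omega>); B' = (\<lambda>k s. B k s \<omega>); T = relocation_time a b \<sigma> \<mu> x Y' B'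
            in T n \<le> ereal t \<and> ereal t < T (Suc n) \<longrightarrow>
               X t \<omega> = cycle \<sigma> \<mu> x Y' B' n (t - real_of_ereal (T n)))"
    using J unfolding jump_diffusion_def by blast
  have x0: "x\<^sub>0 \<in> {a<..<b}" using x mid by auto
  have R: "reset_cycles M B ?start x\<^sub>0 a b"
  proof (rule reset_cycles.intro)
    show "prob_space M" by unfold_locales
    show "reset_cycles_axioms M B ?start x\<^sub>0 a b"
    proof (rule reset_cycles_axioms.intro)
      show "drifted_bm M (B n) (?start n) a b" for n
        by unfold_locales
           (use B x x0 in \<open>auto split: nat.split\<close>)
      show "indep_sets (\<lambda>n. sets (vimage_algebra (space M) (\<lambda>\<omega>. \<lambda>t\<in>{0..}. B n t \<omega>) (PiM {0..} (\<lambda>_. borel)))) UNIV"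
        using indep_sets_Inr[OF ind] by simp
    qed (simp_all add: mid)
  qed
  then interpret R: reset_cycles M B ?start x\<^sub>0 \<sigma> \<mu> a b .
  have Yx: "AE \<omega> in M. Y n \<omega> = x\<^sub>0" for n
  proof -
    have "AE y in distr M borel (Y n). y = x\<^sub>0" unfolding Y(2) by (simp add: AE_return)
    then show ?thesis using Y(1) by (subst (asm) AE_distr_iff) auto
  qed
  have Yall: "AE \<omega> in M. \<forall>n. Y n \<omega> = x\<^sub>0" using Yx by (simp add: AE_all_countable)
  have cyc: "cycle \<sigma> \<mu> x (\<lambda>k. Y k \<omega>) (\<lambda>k s. B k s \<omega>) n = (\<lambda>s. R.c.W n s \<omega>)" if "\<forall>n. Y n \<omega> = x\<^sub>0" for \<omega> n
    using that by (auto simp: fun_eq_iff cycle_def R.c.W_def split: nat.split)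
  have rel: "relocation_time a b \<sigma> \<mu> x (\<lambda>k. Y k \<omega>) (\<lambda>k s. B k s \<omega>) = (\<lambda>n. R.reset_time n \<omega>)" if "\<forall>n. Y n \<omega> = x\<^sub>0" for \<omega>
    unfolding fun_eq_iff relocation_time_def R.reset_time_def R.c.exit_time_def cyc[OF that] by simp
  have "R.follows_cycles t (X t)" if t: "0 \<le> t" for t
    unfolding R.follows_cycles_def
    using path Yall
  proof eventually_elim
    case (elim \<omega>)
    then show ?case using t unfolding Let_def rel[OF elim(2)] cyc[OF elim(2)] by blast
  qed
  moreover have "\<And>t. 0 \<le> t \<Longrightarrow> X t \<in> borel_measurable M" using J unfolding jump_diffusion_def by blast
  ultimately show thesis using that R by blast
qed

text \<open>The circle mode is \<open>exp (c y)\<close> with \<open>c = 2 \<pi> i n / h\<close>. The sine mode is the imaginary part of \<open>exp (c y)\<close>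
  with \<open>c = - \<nu> + i k \<pi> / h\<close>; the decay rates of \<open>c\<close> and of its conjugate are the same real number because
  the drift is \<open>\<sigma>\<^sup>2 \<nu>\<close>.\<close>
lemma jump_diffusion_moments:
  fixes M :: "'w measure"
  assumes J: "jump_diffusion a b \<sigma> \<mu> (return borel x\<^sub>0) M x X" and x: "x \<in> {a<..<b}" and mid: "x\<^sub>0 = (a + b) / 2"
    and t: "0 \<le> t" and h: "h = (b - a) / 2"
  shows "X t \<in> borel_measurable M" "AE \<omega> in M. X t \<omega> \<in> {a<..<b}" "AE \<omega> in M. X 0 \<omega> = x"
    and "(\<integral>\<omega>. cis (2 * pi * of_int n * (X t \<omega> - x\<^sub>0) / h) \<partial>M) =
       exp (- Complex (\<sigma>\<^sup>2 * (2 * pi * of_int n / h)\<^sup>2 / 2) (- \<mu> * (2 * pi * of_int n / h)) * of_real t) * cis (2 * pi * of_int n * (x - x\<^sub>0) / h)"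
    and "\<sigma> \<noteq> 0 \<Longrightarrow> (\<integral>\<omega>. exp (- (\<mu> / \<sigma>\<^sup>2) * (X t \<omega> - x\<^sub>0)) * sin (real k * pi * (X t \<omega> - x\<^sub>0) / h) \<partial>M) =
       exp (- (\<sigma>\<^sup>2 / 2 * ((real k * pi / h)\<^sup>2 + (\<mu> / \<sigma>\<^sup>2)\<^sup>2)) * t) * (exp (- (\<mu> / \<sigma>\<^sup>2) * (x - x\<^sub>0)) * sin (real k * pi * (x - x\<^sub>0) / h))"
proof -
  obtain B where R: "reset_cycles M B (case_nat x (\<lambda>_. x\<^sub>0)) x\<^sub>0 a b"
    and Xm: "\<And>t. 0 \<le> t \<Longrightarrow> X t \<in> borel_measurable M"
    and X: "\<And>t. 0 \<le> t \<Longrightarrow> reset_cycles.follows_cycles M B (case_nat x (\<lambda>_. x\<^sub>0)) \<sigma> \<mu> a b t (X t)"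
    using that by (rule jump_diffusion_cycles[OF J x mid])
  interpret R: reset_cycles M B "case_nat x (\<lambda>_. x\<^sub>0)" x\<^sub>0 \<sigma> \<mu> a b by (rule R)
  have ab: "a < b" using x by auto
  have h0: "0 < h" using ab h by simp
  have ax: "a - x\<^sub>0 = - h" "b - x\<^sub>0 = h" using mid h by (auto simp: field_simps)
  show Xt: "X t \<in> borel_measurable M" by (rule Xm[OF t])
  show "AE \<omega> in M. X t \<omega> \<in> {a<..<b}" by (rule R.AE_position_mem[OF t X[OF t]])
  show "AE \<omega> in M. X 0 \<omega> = x"
    using X[OF order_refl, unfolded R.follows_cycles_def] AE_space
  proof eventually_elim
    case (elim \<omega>)
    have "R.reset_time 0 \<omega> = 0" "R.reset_time (Suc 0) \<omega> = R.c.exit_time 0 \<omega>" by (auto simp: R.reset_time_def)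
    then have "X 0 \<omega> = R.c.W 0 (0 - real_of_ereal (R.reset_time 0 \<omega>)) \<omega>"
      using elim(1)[rule_format, of 0] R.c.exit_time_pos[OF elim(2), of 0] by (simp add: zero_ereal_def)
    also have "\<dots> = R.c.W 0 0 \<omega>" by (simp add: R.reset_time_def)
    also have "\<dots> = x" unfolding R.c.W_def using R.c.B_0[OF elim(2), of 0] by simp
    finally show ?case .
  qed
  let ?start = "case_nat x (\<lambda>_. x\<^sub>0)"
  let ?Z = "\<lambda>c n u \<omega>. exp (R.c.decay_rate c * of_real (R.c.stop_time n u \<omega>)) * exp (c * of_real (R.c.W n (R.c.stop_time n u \<omega>) \<omega> - x\<^sub>0))"
  have stop1: "(\<integral>\<omega>. ?Z c n u \<omega> \<partial>M) =
      exp (c * of_real (?start n - x\<^sub>0))"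
   and stop1i: "integrable M (\<lambda>\<omega>. ?Z c n u \<omega>)"
    if u: "0 \<le> u" for n u c
  proof -
    have e: "?Z c n u \<omega> =
       exp (R.c.decay_rate c * of_real (R.c.stop_time n u \<omega>) + c * of_real (R.c.W n (R.c.stop_time n u \<omega>) \<omega>)) * exp (- c * of_real x\<^sub>0)" for \<omega>
      unfolding mult_exp_exp by (rule arg_cong[of _ _ exp]) (simp add: algebra_simps)
    show "integrable M (\<lambda>\<omega>. ?Z c n u \<omega>)"
      unfolding e by (intro integrable_mult_left R.c.exponential_stopping u)
    have "(\<integral>\<omega>. ?Z c n u \<omega> \<partial>M) =
      exp (c * of_real (?start n)) * exp (- c * of_real x\<^sub>0)"
      unfolding e integral_mult_left_zero R.c.exponential_stopping(2)[OF u] ..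
    also have "\<dots> = exp (c * of_real (?start n - x\<^sub>0))"
      unfolding mult_exp_exp by (rule arg_cong[of _ _ exp]) (simp add: algebra_simps)
    finally show "(\<integral>\<omega>. ?Z c n u \<omega> \<partial>M) =
      exp (c * of_real (?start n - x\<^sub>0))" .
  qed
  show "(\<integral>\<omega>. cis (2 * pi * of_int n * (X t \<omega> - x\<^sub>0) / h) \<partial>M) =
       exp (- Complex (\<sigma>\<^sup>2 * (2 * pi * of_int n / h)\<^sup>2 / 2) (- \<mu> * (2 * pi * of_int n / h)) * of_real t) * cis (2 * pi * of_int n * (x - x\<^sub>0) / h)"
  proof -
    define c where "c = \<i> * of_real (2 * pi * of_int n / h)"
    define g where "g y = exp (c * of_real (y - x\<^sub>0))" for y
    have gcis: "g y = cis (2 * pi * of_int n * (y - x\<^sub>0) / h)" for y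
      unfolding g_def cis_conv_exp c_def by (rule arg_cong[of _ _ exp]) simp
    have dr: "R.c.decay_rate c = Complex (\<sigma>\<^sup>2 * (2 * pi * of_int n / h)\<^sup>2 / 2) (- \<mu> * (2 * pi * of_int n / h))"
      by (simp add: R.c.decay_rate_def c_def complex_eq_iff power2_eq_square)
    have bd: "g a = 1" "g b = 1" "g x\<^sub>0 = 1"
      unfolding gcis ax using h0 by (simp_all add: complex_eq_iff cos_integer_2pi sin_integer_2pi)
    have "(\<integral>\<omega>. g (X t \<omega>) \<partial>M) = exp (- R.c.decay_rate c * of_real t) * g (?start 0)"
    proof (rule R.eigenfunction_decay[OF t Xt X[OF t], where G = 1])
      show "g \<in> borel_measurable borel" unfolding g_def
        by (intro borel_measurable_continuous_onI continuous_intros)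
      show "(\<integral>\<omega>. exp (R.c.decay_rate c * of_real (R.c.stop_time n u \<omega>)) * g (R.c.W n (R.c.stop_time n u \<omega>) \<omega>) \<partial>M) = g (?start n)"
        if "0 \<le> u" for n u unfolding g_def by (rule stop1[OF that])
    qed (simp_all add: bd, simp add: gcis)
    then show ?thesis unfolding gcis dr by simp
  qed
  assume \<sigma>: "\<sigma> \<noteq> 0"
  define \<nu> where "\<nu> = \<mu> / \<sigma>\<^sup>2"
  define \<kappa> where "\<kappa> = \<sigma>\<^sup>2 / 2 * ((real k * pi / h)\<^sup>2 + \<nu>\<^sup>2)"
  define c where "c = Complex (- \<nu>) (real k * pi / h)"
  define g where "g y = (exp (c * of_real (y - x\<^sub>0)) - exp (cnj c * of_real (y - x\<^sub>0))) / (2 * \<i>)" for y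
  have gsin: "g y = of_real (exp (- \<nu> * (y - x\<^sub>0)) * sin (real k * pi * (y - x\<^sub>0) / h))" for y
  proof -
    have "exp (cnj c * of_real (y - x\<^sub>0)) = cnj (exp (c * of_real (y - x\<^sub>0)))"
      by (simp add: exp_cnj)
    moreover have "(z - cnj z) / (2 * \<i>) = of_real (Im z)" for z
    proof -
      have "z - cnj z = of_real (Im z) * (2 * \<i>)" by (simp add: complex_eq_iff)
      then show ?thesis by (simp only: nonzero_mult_div_cancel_right[of "2 * \<i>"]) (simp add: complex_eq_iff)
    qed
    ultimately have "g y = of_real (Im (exp (c * of_real (y - x\<^sub>0))))"
      unfolding g_def by (simp only:)
    also have "Im (exp (c * of_real (y - x\<^sub>0))) = exp (- \<nu> * (y - x\<^sub>0)) * sin (real k * pi * (y - x\<^sub>0) / h)"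
      by (simp add: Im_exp c_def)
    finally show ?thesis .
  qed
  have mu: "\<mu> = \<sigma>\<^sup>2 * \<nu>" using \<sigma> by (simp add: \<nu>_def)
  have dr: "R.c.decay_rate c = of_real \<kappa>" "R.c.decay_rate (cnj c) = of_real \<kappa>"
    unfolding R.c.decay_rate_def unfolding mu \<kappa>_def c_def by (simp_all add: complex_eq_iff power2_eq_square algebra_simps diff_divide_distrib)
  have bd: "g a = 0" "g b = 0" "g x\<^sub>0 = 0"
    unfolding gsin ax using h0 by simp_all
  have "continuous_on {a..b} g" unfolding g_def by (intro continuous_intros) auto
  then have "bounded (g ` {a..b})" by (intro compact_imp_bounded compact_continuous_image) auto
  then obtain G where "\<forall>z\<in>g ` {a..b}. norm z \<le> G" unfolding bounded_iff by blast
  then have G: "norm (g y) \<le> G" if "y \<in> {a..b}" for y using that by blast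
  have "(\<integral>\<omega>. g (X t \<omega>) \<partial>M) = exp (- of_real \<kappa> * of_real t) * g (?start 0)"
  proof (rule R.eigenfunction_decay[OF t Xt X[OF t] _ G])
    show "g \<in> borel_measurable borel" unfolding g_def
      by (intro borel_measurable_continuous_onI continuous_intros) auto
    fix n and u :: real assume u: "0 \<le> u"
    note s1 = stop1[OF u, of c n, unfolded dr] stop1[OF u, of "cnj c" n, unfolded dr]
    note si = stop1i[OF u, of c n, unfolded dr] stop1i[OF u, of "cnj c" n, unfolded dr]
    have "(\<integral>\<omega>. exp (of_real \<kappa> * of_real (R.c.stop_time n u \<omega>)) * g (R.c.W n (R.c.stop_time n u \<omega>) \<omega>) \<partial>M) =
       (\<integral>\<omega>. (exp (of_real \<kappa> * of_real (R.c.stop_time n u \<omega>)) * exp (c * of_real (R.c.W n (R.c.stop_time n u \<omega>) \<omega> - x\<^sub>0)) -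
          exp (of_real \<kappa> * of_real (R.c.stop_time n u \<omega>)) * exp (cnj c * of_real (R.c.W n (R.c.stop_time n u \<omega>) \<omega> - x\<^sub>0))) / (2 * \<i>) \<partial>M)"
      unfolding g_def by (simp only: right_diff_distrib times_divide_eq_right)
    also have "\<dots> = g (?start n)"
      unfolding integral_divide_zero Bochner_Integration.integral_diff[OF si] s1 g_def ..
    finally show "(\<integral>\<omega>. exp (of_real \<kappa> * of_real (R.c.stop_time n u \<omega>)) * g (R.c.W n (R.c.stop_time n u \<omega>) \<omega>) \<partial>M) = g (?start n)" .
  qed (simp_all add: bd)
  then have "of_real (\<integral>\<omega>. exp (- \<nu> * (X t \<omega> - x\<^sub>0)) * sin (real k * pi * (X t \<omega> - x\<^sub>0) / h) \<partial>M) =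
     (of_real (exp (- \<kappa> * t) * (exp (- \<nu> * (x - x\<^sub>0)) * sin (real k * pi * (x - x\<^sub>0) / h))) :: complex)"
    unfolding gsin integral_complex_of_real by (simp add: exp_of_real[symmetric])
  then show "(\<integral>\<omega>. exp (- (\<mu> / \<sigma>\<^sup>2) * (X t \<omega> - x\<^sub>0)) * sin (real k * pi * (X t \<omega> - x\<^sub>0) / h) \<partial>M) =
       exp (- (\<sigma>\<^sup>2 / 2 * ((real k * pi / h)\<^sup>2 + (\<mu> / \<sigma>\<^sup>2)\<^sup>2)) * t) * (exp (- (\<mu> / \<sigma>\<^sup>2) * (x - x\<^sub>0)) * sin (real k * pi * (x - x\<^sub>0) / h))"
    unfolding of_real_eq_iff \<nu>_def[symmetric] \<kappa>_def[symmetric] .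
qed

section \<open>The spectral gap for large drift\<close>

theorem theorem1:
  fixes a b \<sigma> x\<^sub>0 :: real
  assumes "a < b" and "\<sigma> > 0" and "x\<^sub>0 = (a + b) / 2"
  shows "\<exists>\<mu>\<^sub>0 :: real. \<forall>\<mu>>\<mu>\<^sub>0. \<forall>(M :: real \<Rightarrow> 'w measure) (X :: real \<Rightarrow> real \<Rightarrow> 'w \<Rightarrow> real).
           (\<forall>x\<in>{a<..<b}. jump_diffusion a b \<sigma> \<mu> (return borel x\<^sub>0) (M x) x (X x)) \<longrightarrow>
           has_spectral_gap a b (\<lambda>x t. distr (M x) borel (X x t)) (8 * \<sigma>\<^sup>2 * pi\<^sup>2 / (b - a)\<^sup>2)"
proof -
  define h where "h = (b - a) / 2"
  have h: "0 < h" using assms(1) by (simp add: h_def)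
  have ends: "x\<^sub>0 - h = a" "x\<^sub>0 + h = b" using assms(3) by (auto simp: h_def field_simps)
  show ?thesis
  \<comment> \<open>this threshold is equivalent to \<open>\<nu> > 2 * pi / h\<close>, hence gives \<open>\<sigma>\<^sup>2 * \<nu>\<^sup>2 / 2 > \<gamma>\<close>\<close>
  proof (intro exI[of _ "2 * \<sigma>\<^sup>2 * pi / h"] allI impI)
    fix \<mu> and M :: "real \<Rightarrow> 'w measure" and X :: "real \<Rightarrow> real \<Rightarrow> 'w \<Rightarrow> real"
    assume \<mu>: "2 * \<sigma>\<^sup>2 * pi / h < \<mu>"
      and J: "\<forall>x\<in>{a<..<b}. jump_diffusion a b \<sigma> \<mu> (return borel x\<^sub>0) (M x) x (X x)"
    define \<nu> where "\<nu> = \<mu> / \<sigma>\<^sup>2"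
    define \<gamma> where "\<gamma> = 8 * \<sigma>\<^sup>2 * pi\<^sup>2 / (b - a)\<^sup>2"
    have \<sigma>2: "0 < \<sigma>\<^sup>2" using assms(2) by simp
    have \<nu>: "2 * pi / h < \<nu>" using \<mu> \<sigma>2 by (simp add: \<nu>_def field_simps)
    have pos: "0 < 2 * pi / h" using h by simp
    have \<gamma>_h: "\<gamma> = \<sigma>\<^sup>2 * (2 * pi / h)\<^sup>2 / 2"
      unfolding \<gamma>_def h_def by (simp add: power_divide power_mult_distrib)
    let ?P = "\<lambda>x t. distr (M x) borel (X x t)"
    interpret T: two_arcs h \<nu> by unfold_locales (use h pos \<nu> in linarith)+
    have "mode_kernel h \<nu> x\<^sub>0 \<gamma> (\<sigma>\<^sup>2 * \<nu>\<^sup>2 / 2) (- \<mu> * (2 * pi / h)) ?P"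
    proof (rule mode_kernel.intro[OF T.two_arcs_axioms mode_kernel_axioms.intro])
      show "0 < \<gamma>" unfolding \<gamma>_h using \<sigma>2 h by simp
      have "(2 * pi / h)\<^sup>2 \<le> \<nu>\<^sup>2" using \<nu> pos by (intro power_mono) auto
      then show "\<gamma> \<le> \<sigma>\<^sup>2 * \<nu>\<^sup>2 / 2" unfolding \<gamma>_h using \<sigma>2 by (simp add: divide_right_mono mult_left_mono)
      fix x assume "x \<in> {x\<^sub>0 - h<..<x\<^sub>0 + h}"
      then have x: "x \<in> {a<..<b}" unfolding ends .
      have Jx: "jump_diffusion a b \<sigma> \<mu> (return borel x\<^sub>0) (M x) x (X x)" using J x by blast
      interpret prob_space "M x" using Jx unfolding jump_diffusion_def by blast
      note mom = jump_diffusion_moments[OF Jx x assms(3) _ h_def]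
      show "prob_space (?P x t)" if t: "0 \<le> t" for t
        using mom(1)[OF t] by (rule prob_space_distr)
      show "sets (?P x t) = sets borel" for t by simp
      show "AE y in ?P x t. y \<in> {x\<^sub>0 - h<..<x\<^sub>0 + h}" if t: "0 \<le> t" for t
        unfolding ends using mom(1,2)[OF t] by (subst AE_distr_iff) auto
      show "(\<integral>y. T.circle_mode n (y - x\<^sub>0) \<partial>?P x t) =
          exp (- Complex (\<gamma> * (of_int n)\<^sup>2) (- \<mu> * (2 * pi / h) * of_int n) * of_real t) * T.circle_mode n (x - x\<^sub>0)"
        if t: "0 \<le> t" for t and n :: int
      proof -
        have "(\<integral>y. T.circle_mode n (y - x\<^sub>0) \<partial>?P x t) = (\<integral>\<omega>. T.circle_mode n (X x t \<omega> - x\<^sub>0) \<partial>M x)"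
          using mom(1)[OF t] by (rule integral_distr) measurable
        also have "\<dots> = exp (- Complex (\<sigma>\<^sup>2 * (2 * pi * of_int n / h)\<^sup>2 / 2) (- \<mu> * (2 * pi * of_int n / h)) * of_real t) * T.circle_mode n (x - x\<^sub>0)"
          unfolding T.circle_mode_def by (rule mom(4)[OF t])
        also have "Complex (\<sigma>\<^sup>2 * (2 * pi * of_int n / h)\<^sup>2 / 2) (- \<mu> * (2 * pi * of_int n / h)) =
            Complex (\<gamma> * (of_int n)\<^sup>2) (- \<mu> * (2 * pi / h) * of_int n)"
          unfolding \<gamma>_h by (simp add: power_mult_distrib power_divide)
        finally show ?thesis .
      qed
      show "(\<integral>y. T.sine_mode k (y - x\<^sub>0) \<partial>?P x t) =
          exp (- (\<gamma> * (real k)\<^sup>2 / 4 + \<sigma>\<^sup>2 * \<nu>\<^sup>2 / 2) * t) * T.sine_mode k (x - x\<^sub>0)"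
        if t: "0 \<le> t" for t k
      proof -
        have "(\<integral>y. T.sine_mode k (y - x\<^sub>0) \<partial>?P x t) = (\<integral>\<omega>. T.sine_mode k (X x t \<omega> - x\<^sub>0) \<partial>M x)"
          using mom(1)[OF t] by (rule integral_distr) measurable
        also have "\<dots> = exp (- (\<sigma>\<^sup>2 / 2 * ((real k * pi / h)\<^sup>2 + \<nu>\<^sup>2)) * t) * T.sine_mode k (x - x\<^sub>0)"
          unfolding T.sine_mode_def unfolding \<nu>_def using assms(2) by (intro mom(5)[OF t]) simp
        also have "\<sigma>\<^sup>2 / 2 * ((real k * pi / h)\<^sup>2 + \<nu>\<^sup>2) = \<gamma> * (real k)\<^sup>2 / 4 + \<sigma>\<^sup>2 * \<nu>\<^sup>2 / 2"
          unfolding \<gamma>_h by (simp add: power_mult_distrib power_divide distrib_left)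
        finally show ?thesis .
      qed
      note X0 [measurable] = mom(1)[OF order_refl]
      have "?P x 0 = distr (M x) borel (\<lambda>_. x)"
        using mom(3)[OF order_refl] by (intro distr_cong_AE) auto
      then show "?P x 0 = return borel x" by simp
    qed
    from mode_kernel.spectral_gap[OF this]
    show "has_spectral_gap a b ?P (8 * \<sigma>\<^sup>2 * pi\<^sup>2 / (b - a)\<^sup>2)"
      unfolding ends \<gamma>_def .
  qed
qed

end
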